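(* Let $\mathbf{k}$ be a commutative ring and let $V$ be an $\mathbf{FI}$-module over $\mathbf{k}$ that is presented in finite degrees and is not $H_0^{\mathbf{FI}}$-acyclic. Let $g, r$ be integers with $t_0(V) \le g$ and $t_1(V) \le r$. Then $t_a(V) - a = \operatorname{reg}(V)$ for every integer $a$ satisfying $$a \ge \begin{cases} \max\{1,\; g + r - 1\} & \text{if } 2 \in \mathbf{k}^{\times} \text{ and } g < r,\\ \max\{1,\; 2r - 2\} & \text{if } 2 \in \mathbf{k}^{\times} \text{ and } g \ge r,\\ \max\{1,\; 2g + 2r - 2\} & \text{if } 2 \notin \mathbf{k}^{\times} \text{ and } g < r,\\ \max\{1,\; 4r - 4\} & \text{if } 2 \notin \mathbf{k}^{\times} \text{ and } g \ge r.\end{cases}$$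
   Context: $\mathbf{k}^\times$ is the group of units of $\mathbf{k}$. $\mathbf{FI}$ is the category of finite sets and injections. An $\mathbf{FI}$-module over $\mathbf{k}$ is a functor $V\colon \mathbf{FI} \to \mathbf{k}\text{-Mod}$; write $V_S$ for its value at $S$. These form an abelian category $[\mathbf{FI},\mathbf{k}\text{-Mod}]$. The degree of an $\mathbf{FI}$-module $W$ is $\deg(W) := \min\{d \ge -1 : W_S = 0 \text{ for } |S| > d\} \in \{-1,0,1,\dots\}\cup\{\infty\}$. $\mathbf{FI}$-homology: $H_0^{\mathbf{FI}}(V)$ is the quotient $\mathbf{FI}$-module of $V$ with $H_0^{\mathbf{FI}}(V)_S := \operatorname{coker}\big(\bigoplus_{A \subsetneq S} V_A \to V_S\big)$. The functor $H_0^{\mathbf{FI}}$ is right exact, and $H_i^{\mathbf{FI}}$ denotes its $i$-th left derived functor. Set $t_i(V) := \deg(H_i^{\mathbf{FI}}(V))$. $V$ is presented in finite degrees if $t_0(V)$ and $t_1(V)$ are finite. $V$ is $H_0^{\mathbf{FI}}$-acyclic if $H_i^{\mathbf{FI}}(V) = 0$ for all $i \ge 1$. The regularity is $\operatorname{reg}(V) := \max\{t_i(V) - i : i \ge 1\} \in \{-2,-1,0,\dots\}\cup\{\infty\}$; it is known to be finite when $V$ is presented in finite degrees. *)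

theory Defs
  imports
    "HOL-Algebra.Module"
    "HOL-Algebra.AbelCoset"
    "HOL-Library.FuncSet"
    "HOL-Library.FSet"
    "HOL-Library.Extended_Real"
begin

section \<open>FI-modules\<close>

text \<open>
  FI is represented by its full subcategory on the finite subsets of \<open>nat\<close>, to which it is
  equivalent. Injections \<open>S \<rightarrow> T\<close> are extensional functions, so that equality of morphisms is
  equality of functions; composition is \<^const>\<open>compose\<close> and the inclusion of a subset \<open>A\<close> of \<open>S\<close>
  is \<open>\<lambda>x\<in>A. x\<close>.
\<close>

definition FI_hom :: "nat set \<Rightarrow> nat set \<Rightarrow> (nat \<Rightarrow> nat) set" where
  "FI_hom S T = {f \<in> S \<rightarrow>\<^sub>E T. inj_on f S}"

text \<open>
  Only the values at finite sets and at morphisms in \<^const>\<open>FI_hom\<close> are meaningful. The ring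
  multiplication and unit contained in the record type \<open>module\<close> are never used.
\<close>

record ('r, 'm) FI_mod =
  obj :: "nat set \<Rightarrow> ('r, 'm) module"
  mor :: "nat set \<Rightarrow> nat set \<Rightarrow> (nat \<Rightarrow> nat) \<Rightarrow> 'm \<Rightarrow> 'm"

locale FI_module = cring R for R :: "('r, 'c) ring_scheme" (structure) +
  fixes V :: "('r, 'm) FI_mod"
  assumes obj_module: "finite S \<Longrightarrow> Module.module R (obj V S)"
    and mor_closed: "\<lbrakk>finite S; finite T; f \<in> FI_hom S T; x \<in> carrier (obj V S)\<rbrakk>
      \<Longrightarrow> mor V S T f x \<in> carrier (obj V T)"
    and mor_add: "\<lbrakk>finite S; finite T; f \<in> FI_hom S T; x \<in> carrier (obj V S); y \<in> carrier (obj V S)\<rbrakk>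
      \<Longrightarrow> mor V S T f (x \<oplus>\<^bsub>obj V S\<^esub> y) = mor V S T f x \<oplus>\<^bsub>obj V T\<^esub> mor V S T f y"
    and mor_smult: "\<lbrakk>finite S; finite T; f \<in> FI_hom S T; a \<in> carrier R; x \<in> carrier (obj V S)\<rbrakk>
      \<Longrightarrow> mor V S T f (a \<odot>\<^bsub>obj V S\<^esub> x) = a \<odot>\<^bsub>obj V T\<^esub> mor V S T f x"
    and mor_id: "\<lbrakk>finite S; x \<in> carrier (obj V S)\<rbrakk> \<Longrightarrow> mor V S S (\<lambda>s\<in>S. s) x = x"
    and mor_comp: "\<lbrakk>finite S; finite T; finite U; f \<in> FI_hom S T; g \<in> FI_hom T U; x \<in> carrier (obj V S)\<rbrakk>
      \<Longrightarrow> mor V S U (compose S g f) x = mor V T U g (mor V S T f x)"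

definition zero_at :: "('r, 'm) FI_mod \<Rightarrow> nat set \<Rightarrow> bool" where
  "zero_at W S \<longleftrightarrow> carrier (obj W S) = {\<zero>\<^bsub>obj W S\<^esub>}"

text \<open>The infimum is a minimum, or \<open>\<infinity>\<close> if there is no such \<open>d\<close>.\<close>

definition FI_degree :: "('r, 'm) FI_mod \<Rightarrow> ereal" where
  "FI_degree W = Inf {ereal (real_of_int d) | d.
     d \<ge> -1 \<and> (\<forall>S. finite S \<longrightarrow> int (card S) > d \<longrightarrow> zero_at W S)}"


section \<open>Submodules, quotients and \<open>H\<^sub>0\<close>\<close>

definition quot_module :: "('r, 'm) module \<Rightarrow> 'm set \<Rightarrow> ('r, 'm set) module" where
  "quot_module M N = \<lparr>
     carrier = a_rcosets\<^bsub>M\<^esub> N,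
     mult = undefined,
     one = undefined,
     zero = N,
     add = (<+>\<^bsub>M\<^esub>),
     smult = (\<lambda>a C. \<Union>x\<in>C. N +>\<^bsub>M\<^esub> (a \<odot>\<^bsub>M\<^esub> x))\<rparr>"

definition FI_sub :: "('r, 'm) FI_mod \<Rightarrow> (nat set \<Rightarrow> 'm set) \<Rightarrow> ('r, 'm) FI_mod" where
  "FI_sub W K = \<lparr>obj = (\<lambda>S. (obj W S)\<lparr>carrier := K S\<rparr>), mor = mor W\<rparr>"

definition FI_quot :: "('r, 'm) FI_mod \<Rightarrow> (nat set \<Rightarrow> 'm set) \<Rightarrow> ('r, 'm set) FI_mod" where
  "FI_quot W N = \<lparr>
     obj = (\<lambda>S. quot_module (obj W S) (N S)),
     mor = (\<lambda>S T f C. \<Union>x\<in>C. N T +>\<^bsub>obj W T\<^esub> mor W S T f x)\<rparr>"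

text \<open>The image of \<open>\<Oplus>A\<subset>S. V A \<rightarrow> V S\<close>; the index set is finite, so a direct sum is a product.\<close>

definition proper_image :: "('r, 'm) FI_mod \<Rightarrow> nat set \<Rightarrow> 'm set" where
  "proper_image V S =
     {finsum (obj V S) (\<lambda>A. mor V A S (\<lambda>a\<in>A. a) (v A)) {A. A \<subset> S} | v.
        \<forall>A. A \<subset> S \<longrightarrow> v A \<in> carrier (obj V A)}"

definition FI_H0 :: "('r, 'm) FI_mod \<Rightarrow> ('r, 'm set) FI_mod" where
  "FI_H0 V = FI_quot V (proper_image V)"

text \<open>The map \<open>H\<^sub>0(V) \<rightarrow> H\<^sub>0(W)\<close> induced by a morphism \<open>\<phi> : V \<rightarrow> W\<close>.\<close>

definition FI_H0_map ::
    "('r, 'n) FI_mod \<Rightarrow> (nat set \<Rightarrow> 'm \<Rightarrow> 'n) \<Rightarrow> nat set \<Rightarrow> 'm set \<Rightarrow> 'n set" where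
  "FI_H0_map W \<phi> S C = (\<Union>x\<in>C. proper_image W S +>\<^bsub>obj W S\<^esub> \<phi> S x)"


section \<open>Free FI-modules\<close>

text \<open>
  \<open>FI_free R X\<close> is the direct sum, over all finite sets \<open>S\<close> and all \<open>x \<in> X S\<close>, of the representable
  FI-modules \<open>R[FI_hom S _]\<close>. Its value at \<open>T\<close> consists of the finitely supported functions on
  \<open>free_basis X T\<close>, extended by zero. In the action of \<open>g\<close>, the sum over the preimages \<open>f\<close> of \<open>h\<close>
  under \<open>f \<mapsto> g \<circ> f\<close> has at most one term.
\<close>

type_synonym 'x key = "nat set \<times> 'x \<times> (nat \<Rightarrow> nat)"

definition free_basis :: "(nat set \<Rightarrow> 'x set) \<Rightarrow> nat set \<Rightarrow> 'x key set" where
  "free_basis X T = {(S, x, f). finite S \<and> x \<in> X S \<and> f \<in> FI_hom S T}"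

definition support :: "('r, 'c) ring_scheme \<Rightarrow> ('k \<Rightarrow> 'r) \<Rightarrow> 'k set" where
  "support R \<phi> = {k. \<phi> k \<noteq> \<zero>\<^bsub>R\<^esub>}"

definition FI_free :: "('r, 'c) ring_scheme \<Rightarrow> (nat set \<Rightarrow> 'x set) \<Rightarrow> ('r, 'x key \<Rightarrow> 'r) FI_mod" where
  "FI_free R X = \<lparr>
     obj = (\<lambda>T. \<lparr>
       carrier = {\<phi> \<in> UNIV \<rightarrow> carrier R. finite (support R \<phi>) \<and> support R \<phi> \<subseteq> free_basis X T},
       mult = undefined,
       one = undefined,
       zero = (\<lambda>k. \<zero>\<^bsub>R\<^esub>),
       add = (\<lambda>\<phi> \<psi> k. \<phi> k \<oplus>\<^bsub>R\<^esub> \<psi> k),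
       smult = (\<lambda>a \<phi> k. a \<otimes>\<^bsub>R\<^esub> \<phi> k)\<rparr>),
     mor = (\<lambda>T U g \<phi> (S, x, h). finsum R (\<lambda>f. \<phi> (S, x, f)) {f \<in> FI_hom S T. compose S g f = h})\<rparr>"

text \<open>
  The morphism \<open>FI_free R X \<rightarrow> W\<close> that sends the generator \<open>x \<in> X S\<close> to \<open>\<eta> x\<close> in the value of \<open>W\<close>
  at \<open>S\<close>.
\<close>

definition free_ext ::
    "('r, 'c) ring_scheme \<Rightarrow> ('r, 'm) FI_mod \<Rightarrow> ('x \<Rightarrow> 'm) \<Rightarrow> nat set \<Rightarrow> ('x key \<Rightarrow> 'r) \<Rightarrow> 'm" where
  "free_ext R W \<eta> T \<phi> =
     finsum (obj W T) (\<lambda>(S, x, f). \<phi> (S, x, f) \<odot>\<^bsub>obj W T\<^esub> mor W S T f (\<eta> x)) (support R \<phi>)"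


section \<open>The canonical free resolution and FI-homology\<close>

text \<open>
  The \<open>0\<close>-th term of the resolution of \<open>V\<close> is free on all elements of \<open>V\<close>, and each further term
  is free on all elements of the kernel of the preceding map (the augmentation to \<open>V\<close>, then the
  differentials \<open>res_diff\<close> below). Generators are labelled by the type
  below, so that all terms have the same element type: \<open>Elt v\<close> labels the element \<open>v\<close> of \<open>V\<close>, and
  a finitely supported function on keys is labelled by its graph over its support.
\<close>

datatype ('m, 'r) label =
    Elt 'm
  | Graph "((nat set \<times> ('m, 'r) label \<times> (nat \<Rightarrow> nat)) \<times> 'r) fset"

type_synonym ('m, 'r) chain = "('m, 'r) label key \<Rightarrow> 'r"

definition encode :: "('r, 'c) ring_scheme \<Rightarrow> ('m, 'r) chain \<Rightarrow> ('m, 'r) label" where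
  "encode R \<phi> = Graph (Abs_fset ((\<lambda>k. (k, \<phi> k)) ` support R \<phi>))"

definition decode :: "('r, 'c) ring_scheme \<Rightarrow> ('m, 'r) label \<Rightarrow> ('m, 'r) chain" where
  "decode R = inv_into {\<phi>. finite (support R \<phi>)} (encode R)"

fun res_gens :: "('r, 'c) ring_scheme \<Rightarrow> ('r, 'm) FI_mod \<Rightarrow> nat \<Rightarrow> nat set \<Rightarrow> ('m, 'r) label set" where
  "res_gens R V 0 S = Elt ` carrier (obj V S)"
| "res_gens R V (Suc 0) S = encode R `
     {\<phi> \<in> carrier (obj (FI_free R (res_gens R V 0)) S).
        free_ext R V (\<lambda>x. case x of Elt v \<Rightarrow> v) S \<phi> = \<zero>\<^bsub>obj V S\<^esub>}"
| "res_gens R V (Suc (Suc n)) S = encode R `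
     {\<phi> \<in> carrier (obj (FI_free R (res_gens R V (Suc n))) S).
        free_ext R (FI_free R (res_gens R V n)) (decode R) S \<phi> =
          \<zero>\<^bsub>obj (FI_free R (res_gens R V n)) S\<^esub>}"

definition res :: "('r, 'c) ring_scheme \<Rightarrow> ('r, 'm) FI_mod \<Rightarrow> nat \<Rightarrow> ('r, ('m, 'r) chain) FI_mod" where
  "res R V n = FI_free R (res_gens R V n)"

definition res_diff :: "('r, 'c) ring_scheme \<Rightarrow> ('r, 'm) FI_mod \<Rightarrow> nat
    \<Rightarrow> nat set \<Rightarrow> ('m, 'r) chain \<Rightarrow> ('m, 'r) chain" where
  \<comment> \<open>the differential from term \<open>n + 1\<close> to term \<open>n\<close>\<close>
  "res_diff R V n = free_ext R (res R V n) (decode R)"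

text \<open>
  The left derived functors of \<^const>\<open>FI_H0\<close>: the homology of the complex obtained by applying
  \<^const>\<open>FI_H0\<close> to the resolution (with the augmentation omitted).
\<close>

fun H0_cycles :: "('r, 'c) ring_scheme \<Rightarrow> ('r, 'm) FI_mod \<Rightarrow> nat \<Rightarrow> nat set
    \<Rightarrow> ('m, 'r) chain set set" where
  "H0_cycles R V 0 S = carrier (obj (FI_H0 (res R V 0)) S)"
| "H0_cycles R V (Suc n) S =
     {C \<in> carrier (obj (FI_H0 (res R V (Suc n))) S).
        FI_H0_map (res R V n) (res_diff R V n) S C = \<zero>\<^bsub>obj (FI_H0 (res R V n)) S\<^esub>}"

definition H0_boundaries :: "('r, 'c) ring_scheme \<Rightarrow> ('r, 'm) FI_mod \<Rightarrow> nat \<Rightarrow> nat set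
    \<Rightarrow> ('m, 'r) chain set set" where
  "H0_boundaries R V n S =
     FI_H0_map (res R V n) (res_diff R V n) S ` carrier (obj (FI_H0 (res R V (Suc n))) S)"

definition FI_homology :: "('r, 'c) ring_scheme \<Rightarrow> ('r, 'm) FI_mod \<Rightarrow> nat
    \<Rightarrow> ('r, ('m, 'r) chain set set) FI_mod" where
  "FI_homology R V i = FI_quot (FI_sub (FI_H0 (res R V i)) (H0_cycles R V i)) (H0_boundaries R V i)"

text \<open>In degree \<open>0\<close> the functor \<^const>\<open>FI_H0\<close> itself is used.\<close>

definition FI_t :: "('r, 'c) ring_scheme \<Rightarrow> ('r, 'm) FI_mod \<Rightarrow> nat \<Rightarrow> ereal" where
  "FI_t R V i = (if i = 0 then FI_degree (FI_H0 V) else FI_degree (FI_homology R V i))"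

definition presented_in_finite_degrees :: "('r, 'c) ring_scheme \<Rightarrow> ('r, 'm) FI_mod \<Rightarrow> bool" where
  "presented_in_finite_degrees R V \<longleftrightarrow> FI_t R V 0 < \<infinity> \<and> FI_t R V 1 < \<infinity>"

definition FI_H0_acyclic :: "('r, 'c) ring_scheme \<Rightarrow> ('r, 'm) FI_mod \<Rightarrow> bool" where
  "FI_H0_acyclic R V \<longleftrightarrow> (\<forall>i\<ge>1. \<forall>S. finite S \<longrightarrow> zero_at (FI_homology R V i) S)"

definition FI_reg :: "('r, 'c) ring_scheme \<Rightarrow> ('r, 'm) FI_mod \<Rightarrow> ereal" where
  "FI_reg R V = (SUP i\<in>{1..}. FI_t R V i - ereal (real i))"

end

theory Submission
  imports Defs "HOL-Library.Function_Algebras" "HOL-Algebra.Free_Abelian_Groups"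
begin

text \<open>
  The FI-homology of \<open>V\<close> at \<open>S\<close> is the homology of the total complex of the cube \<open>T \<mapsto> V (S - T)\<close>, so
  that adding a point to \<open>S\<close> amounts to taking the mapping cone of \<open>V \<rightarrow> \<Sigma>V\<close>, where \<open>\<Sigma>\<close> is the shift.
  Comparing \<open>V\<close> with the cokernel of \<open>V \<rightarrow> \<Sigma>V\<close>, whose generation and relation degrees are smaller,
  gives \<open>reg V \<le> g + r - 1\<close> and \<open>reg V \<le> 2 r - 2\<close>, and the acyclicity of high shifts.

  Let \<open>\<rho> = reg V\<close>. In the cube on \<open>n + 2\<close> points, antisymmetrizing two of them is a chain map to
  the cube of \<open>\<Sigma>V\<close> on \<open>n\<close> points; a cycle of \<open>\<Sigma>V\<close> lifts if it becomes a boundary in \<open>\<Sigma>\<^sup>2V\<close>. On the line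
  \<open>n = i + \<rho>\<close> this carries nonzero classes of \<open>\<Sigma>V\<close> into all further shifts, which are eventually
  acyclic; hence \<open>reg (\<Sigma>V) \<le> \<rho> - 1\<close>. If equality holds, lifting shows \<open>H\<^sub>i V \<noteq> 0\<close> in degree \<open>i + \<rho>\<close>
  by induction on \<open>\<rho>\<close>; otherwise the long exact sequence makes the groups \<open>H\<^sub>i V\<close> in degree \<open>i + \<rho>\<close>
  vanish or not simultaneously for all \<open>i \<ge> 1\<close>. So \<open>t\<^sub>a V - a = \<rho>\<close> for all \<open>a \<ge> max 1 \<rho>\<close>.
\<close>

section \<open>The Koszul complex of a group with insertion operators\<close>

text \<open>The cube complex meets the derived functors only in low degrees. It is acyclic on free
  FI-modules, because their insertions behave like a regular sequence; its degree-0 exactness says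
  that everything comes from smaller sets; and for a quotient of a free module its degree-1
  exactness compares two such images. Dimension shifting along the kernels of the canonical
  resolution turns H_i into such a degree-1 statement.

  An obstacle is that the cube is computed with ordered points. Its cone structure splits off the
  first point, so the long exact sequences and the antisymmetrization see shifts whose new points
  stand in front. The induction for the acyclicity of high shifts forms cokernels at that same front
  position, so there the shifted points must stand behind. Hence there are two systems of
  insertions, \<open>ins\<close> and \<open>ins_rev\<close>, and a reversal of lists that relates
  them.

  The condition a \<ge> \<rho> comes from the lifting: each application lowers the homological
  degree and the regularity together by one, so up to \<rho> steps must fit below a.\<close>

definition add_subgroup :: "'a::ab_group_add set \<Rightarrow> bool" where
  "add_subgroup A \<longleftrightarrow> 0 \<in> A \<and> (\<forall>x\<in>A. \<forall>y\<in>A. x - y \<in> A)"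

lemma add_subgroup_0: "add_subgroup A \<Longrightarrow> 0 \<in> A"
  and add_subgroup_diff: "add_subgroup A \<Longrightarrow> x \<in> A \<Longrightarrow> y \<in> A \<Longrightarrow> x - y \<in> A"
  by (auto simp: add_subgroup_def)

lemma add_subgroup_minus: "add_subgroup A \<Longrightarrow> x \<in> A \<Longrightarrow> - x \<in> A"
  using add_subgroup_diff[of A 0 x] add_subgroup_0[of A] by simp

lemma add_subgroup_minus_iff: "add_subgroup A \<Longrightarrow> - x \<in> A \<longleftrightarrow> x \<in> A"
  using add_subgroup_minus[of A x] add_subgroup_minus[of A "-x"] by auto

lemma add_subgroup_add: "add_subgroup A \<Longrightarrow> x \<in> A \<Longrightarrow> y \<in> A \<Longrightarrow> x + y \<in> A"
  using add_subgroup_diff[of A x "-y"] add_subgroup_minus[of A y] by simp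

lemma add_subgroup_cong: "add_subgroup A \<Longrightarrow> x - y \<in> A \<Longrightarrow> x \<in> A \<longleftrightarrow> y \<in> A"
  using add_subgroup_diff[of A x "x - y"] add_subgroup_add[of A "x - y" y] by auto

text \<open>
  A list of length \<open>n\<close> stands for a subset of an \<open>n\<close>-element set, whose elements are marked by
  \<^const>\<open>True\<close>; the coefficient of that subset lies in the value on its complement.
\<close>

definition kchains :: "nat \<Rightarrow> nat \<Rightarrow> int \<Rightarrow> (nat \<Rightarrow> 'a set) \<Rightarrow> (bool list \<Rightarrow> 'a) set" where
  "kchains b n i S =
     {c. \<forall>l. length l = n \<longrightarrow> int (count_list l True) = i \<longrightarrow> c l \<in> S (b + count_list l False)}"

text \<open>The signed sum over all ways of marking one further point. The position \<open>k\<close>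
  advances only past unmarked points, because a marked point is absent from the complement on which
  the coefficient lives; passing a marked point costs a sign.\<close>

fun kd :: "(nat \<Rightarrow> 'a \<Rightarrow> 'a) \<Rightarrow> nat \<Rightarrow> (bool list \<Rightarrow> 'a::ab_group_add) \<Rightarrow> bool list \<Rightarrow> 'a" where
  "kd \<delta> k c [] = 0"
| "kd \<delta> k c (False # l) = kd \<delta> (Suc k) (\<lambda>l. c (False # l)) l + \<delta> k (c (True # l))"
| "kd \<delta> k c (True # l) = - kd \<delta> k (\<lambda>l. c (True # l)) l"

text \<open>
  Exactness in degree \<open>i\<close> of the Koszul complex on \<open>n\<close> points of the module with values \<open>Z m/B m\<close>.
  The \<open>n\<close> points occupy the positions \<open>k, k + 1, \<dots>\<close>, and the value at the empty set of points has
  level \<open>b\<close>. All modules are subquotients of one group, so that a cokernel only changes \<open>B\<close> and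
  inductions over iterated cokernels stay within one type.
\<close>

definition koszul_exact ::
    "(nat \<Rightarrow> 'a \<Rightarrow> 'a) \<Rightarrow> nat \<Rightarrow> nat \<Rightarrow> (nat \<Rightarrow> 'a::ab_group_add set) \<Rightarrow> (nat \<Rightarrow> 'a set) \<Rightarrow> nat \<Rightarrow> int \<Rightarrow> bool"
  where "koszul_exact \<delta> k b Z B n i \<longleftrightarrow>
    (\<forall>c\<in>kchains b n i Z. kd \<delta> k c \<in> kchains b n (i - 1) B \<longrightarrow>
      (\<exists>e\<in>kchains b n (i + 1) Z. c - kd \<delta> k e \<in> kchains b n i B))"

text \<open>The two summands of the mapping cone: \<open>c0\<close> where the first point is
  unmarked, with values in the shift, and \<open>c1\<close> where it is marked, one degree
  lower.\<close>

definition pair :: "(bool list \<Rightarrow> 'a) \<Rightarrow> (bool list \<Rightarrow> 'a) \<Rightarrow> bool list \<Rightarrow> 'a::zero" where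
  "pair c0 c1 l = (case l of [] \<Rightarrow> 0 | x # l \<Rightarrow> if x then c1 l else c0 l)"

lemma pair_simps [simp]: "pair c0 c1 [] = 0" "pair c0 c1 (False # l) = c0 l" "pair c0 c1 (True # l) = c1 l"
  by (auto simp: pair_def)

lemma kd_pair: "kd \<delta> k (pair c0 c1) = pair (kd \<delta> (Suc k) c0 + (\<delta> k \<circ> c1)) (- kd \<delta> k c1)"
proof
  fix l show "kd \<delta> k (pair c0 c1) l = pair (kd \<delta> (Suc k) c0 + (\<delta> k \<circ> c1)) (- kd \<delta> k c1) l"
    by (cases l; cases "hd l") (auto simp: fun_Compl_def)
qed

lemma chains_Suc:
  "c \<in> kchains b (Suc n) i S \<longleftrightarrow>
     (\<lambda>l. c (False # l)) \<in> kchains (Suc b) n i S \<and> (\<lambda>l. c (True # l)) \<in> kchains b n (i - 1) S"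
  (is "_ \<longleftrightarrow> ?r")
proof
  assume "c \<in> kchains b (Suc n) i S"
  then have "c (x # l) \<in> S (b + count_list (x # l) False)"
    if "length l = n" "int (count_list (x # l) True) = i" for x l
    using that unfolding kchains_def by (auto simp del: count_list.simps)
  from this[of _ False] this[of _ True] show ?r by (auto simp: kchains_def)
next
  assume ?r
  then show "c \<in> kchains b (Suc n) i S"
    unfolding kchains_def
    by (auto simp: length_Suc_conv)
qed

lemma pair_chains:
  "pair c0 c1 \<in> kchains b (Suc n) i S \<longleftrightarrow> c0 \<in> kchains (Suc b) n i S \<and> c1 \<in> kchains b n (i - 1) S"
  by (simp add: chains_Suc)

lemma koszul_exact_SucI:
  assumes "\<And>c0 c1. \<lbrakk>c0 \<in> kchains (Suc b) n i Z; c1 \<in> kchains b n (i - 1) Z;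
      kd \<delta> (Suc k) c0 + (\<delta> k \<circ> c1) \<in> kchains (Suc b) n (i - 1) B; - kd \<delta> k c1 \<in> kchains b n (i - 2) B\<rbrakk> \<Longrightarrow>
    \<exists>e0\<in>kchains (Suc b) n (i + 1) Z. \<exists>e1\<in>kchains b n i Z.
      c0 - (kd \<delta> (Suc k) e0 + (\<delta> k \<circ> e1)) \<in> kchains (Suc b) n i B \<and> c1 + kd \<delta> k e1 \<in> kchains b n (i - 1) B"
  shows "koszul_exact \<delta> k b Z B (Suc n) i"
  unfolding koszul_exact_def
proof (intro ballI impI)
  fix c assume c: "c \<in> kchains b (Suc n) i Z" and d: "kd \<delta> k c \<in> kchains b (Suc n) (i - 1) B"
  let ?c0 = "\<lambda>l. c (False # l)" and ?c1 = "\<lambda>l. c (True # l)"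
  have 1: "kd \<delta> (Suc k) ?c0 + (\<delta> k \<circ> ?c1) \<in> kchains (Suc b) n (i - 1) B"
       "- kd \<delta> k ?c1 \<in> kchains b n (i - 2) B"
    using d by (simp_all add: chains_Suc plus_fun_def comp_def fun_Compl_def)
  have "?c0 \<in> kchains (Suc b) n i Z" "?c1 \<in> kchains b n (i - 1) Z"
    using c by (simp_all add: chains_Suc)
  from assms[OF this 1] obtain e0 e1 where
    e: "e0 \<in> kchains (Suc b) n (i + 1) Z" "e1 \<in> kchains b n i Z"
      "?c0 - (kd \<delta> (Suc k) e0 + (\<delta> k \<circ> e1)) \<in> kchains (Suc b) n i B" "?c1 + kd \<delta> k e1 \<in> kchains b n (i - 1) B"
    by blast
  have "pair e0 e1 \<in> kchains b (Suc n) (i + 1) Z"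
    using e by (simp add: chains_Suc)
  moreover have "c - kd \<delta> k (pair e0 e1) \<in> kchains b (Suc n) i B"
    using e by (simp add: chains_Suc kd_pair plus_fun_def comp_def fun_Compl_def fun_diff_def)
  ultimately show "\<exists>e\<in>kchains b (Suc n) (i + 1) Z. c - kd \<delta> k e \<in> kchains b (Suc n) i B"
    by blast
qed

lemma koszul_exact_SucE:
  assumes "koszul_exact \<delta> k b Z B (Suc n) i"
    and "c0 \<in> kchains (Suc b) n i Z" "c1 \<in> kchains b n (i - 1) Z"
    and "kd \<delta> (Suc k) c0 + (\<delta> k \<circ> c1) \<in> kchains (Suc b) n (i - 1) B" "- kd \<delta> k c1 \<in> kchains b n (i - 2) B"
  obtains e0 e1 where "e0 \<in> kchains (Suc b) n (i + 1) Z" "e1 \<in> kchains b n i Z"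
      "c0 - (kd \<delta> (Suc k) e0 + (\<delta> k \<circ> e1)) \<in> kchains (Suc b) n i B" "c1 + kd \<delta> k e1 \<in> kchains b n (i - 1) B"
proof -
  have "pair c0 c1 \<in> kchains b (Suc n) i Z"
    using assms(2,3) by (simp add: chains_Suc)
  moreover have "kd \<delta> k (pair c0 c1) \<in> kchains b (Suc n) (i - 1) B"
    using assms(4,5) by (simp add: chains_Suc kd_pair plus_fun_def comp_def fun_Compl_def)
  ultimately obtain e where e: "e \<in> kchains b (Suc n) (i + 1) Z" "pair c0 c1 - kd \<delta> k e \<in> kchains b (Suc n) i B"
    using assms(1) unfolding koszul_exact_def by blast
  show thesis
    apply (rule that[of "\<lambda>l. e (False # l)" "\<lambda>l. e (True # l)"])
    using e by (simp_all add: chains_Suc plus_fun_def comp_def fun_Compl_def fun_diff_def)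
qed

lemma chains_add_subgroup:
  assumes "\<And>m. add_subgroup (S m)" shows "add_subgroup (kchains b n i S)"
  using assms by (auto simp: add_subgroup_def kchains_def)

lemma chains_mono: "c \<in> kchains b n i S \<Longrightarrow> (\<And>m. m \<ge> b \<Longrightarrow> S m \<subseteq> T m) \<Longrightarrow> c \<in> kchains b n i T"
  unfolding kchains_def by (simp add: subset_iff)

text \<open>No subset of \<open>n\<close> points has \<open>i\<close> elements, so the condition is
  vacuous; this is how the complex vanishes outside the degrees 0 to \<open>n\<close>.\<close>

lemma chains_trivial:
  assumes "i > int n \<or> i < 0" shows "c \<in> kchains b n i S"
proof -
  have "int (count_list l True) \<noteq> i" if "length l = n" for l
    using assms count_le_length[of l True] that by auto
  then show ?thesis by (auto simp: kchains_def)
qed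

lemma koszul_exact_trivial: "i > int n \<Longrightarrow> koszul_exact \<delta> k b Z B n i"
  unfolding koszul_exact_def by (auto intro!: bexI[of _ 0] chains_trivial)

section \<open>Insertion operators and the mapping cone of an insertion\<close>

locale insertions =
  fixes \<delta> s :: "nat \<Rightarrow> 'a::ab_group_add \<Rightarrow> 'a"
  assumes \<delta>_diff: "\<delta> j (x - y) = \<delta> j x - \<delta> j y"
    and s_diff: "s j (x - y) = s j x - s j y"
    and \<delta>_\<delta>: "i \<le> j \<Longrightarrow> \<delta> (Suc j) (\<delta> i x) = \<delta> i (\<delta> j x)"
    and s_\<delta>: "s j (\<delta> j x) = \<delta> (Suc j) x"
    and s_Suc_\<delta>: "i \<le> j \<Longrightarrow> s (Suc j) (\<delta> i x) = \<delta> i (s j x)"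
begin

lemma \<delta>_0 [simp]: "\<delta> j 0 = 0"
  using \<delta>_diff[of j 0 0] by simp

lemma \<delta>_minus: "\<delta> j (- x) = - \<delta> j x"
  using \<delta>_diff[of j 0 x] by simp

lemma \<delta>_add: "\<delta> j (x + y) = \<delta> j x + \<delta> j y"
  using \<delta>_diff[of j x "-y"] by (simp add: \<delta>_minus)

lemma s_add: "s j (x + y) = s j x + s j y"
  using s_diff[of j x "-y"] s_diff[of j 0 y] s_diff[of j 0 0] by simp

lemma comp_diff: "\<delta> j \<circ> (c - c') = (\<delta> j \<circ> c) - (\<delta> j \<circ> c')"
  and comp_add: "\<delta> j \<circ> (c + c') = (\<delta> j \<circ> c) + (\<delta> j \<circ> c')"
  and comp_minus: "\<delta> j \<circ> (- c) = - (\<delta> j \<circ> c)"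
  and comp_0: "\<delta> j \<circ> 0 = 0"
  by (auto simp: fun_eq_iff \<delta>_diff \<delta>_add \<delta>_minus)

lemma kd_diff: "kd \<delta> k (c - c') = kd \<delta> k c - kd \<delta> k c'"
proof
  fix l show "kd \<delta> k (c - c') l = (kd \<delta> k c - kd \<delta> k c') l"
  proof (induction l arbitrary: k c c')
    case (Cons x l)
    then show ?case by (cases x) (auto simp: \<delta>_diff fun_diff_def)
  qed simp
qed

lemma kd_0: "kd \<delta> k 0 = 0"
  using kd_diff[of k 0 0] by simp

lemma kd_minus: "kd \<delta> k (- c) = - kd \<delta> k c"
  using kd_diff[of k 0 c] by (simp add: kd_0)

lemma kd_add: "kd \<delta> k (c + c') = kd \<delta> k c + kd \<delta> k c'"
  using kd_diff[of k c "-c'"] by (simp add: kd_minus)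

lemma kd_comp: "i \<le> k \<Longrightarrow> kd \<delta> (Suc k) (\<delta> i \<circ> c) = \<delta> i \<circ> kd \<delta> k c"
proof
  fix l show "i \<le> k \<Longrightarrow> kd \<delta> (Suc k) (\<delta> i \<circ> c) l = (\<delta> i \<circ> kd \<delta> k c) l"
  proof (induction l arbitrary: k c)
    case (Cons x l)
    then show ?case by (cases x) (auto simp: \<delta>_add \<delta>_minus \<delta>_\<delta> comp_def)
  qed simp
qed

lemma kd_kd: "kd \<delta> k (kd \<delta> k c) = 0"
proof
  fix l show "kd \<delta> k (kd \<delta> k c) l = 0 l"
  proof (induction l arbitrary: k c)
    case (Cons x l)
    show ?case
    proof (cases x)
      case True
      have "(\<lambda>l. kd \<delta> k c (True # l)) = - kd \<delta> k (\<lambda>l. c (True # l))" by (simp add: fun_eq_iff)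
      with Cons True show ?thesis by (simp add: kd_minus)
    next
      case False
      have "(\<lambda>l. kd \<delta> k c (False # l)) =
          kd \<delta> (Suc k) (\<lambda>l. c (False # l)) + (\<delta> k \<circ> (\<lambda>l. c (True # l)))" by (simp add: fun_eq_iff)
      with Cons False show ?thesis by (simp add: kd_add kd_comp \<delta>_minus)
    qed
  qed simp
qed

text \<open>The threshold \<open>k\<close> rises with each cokernel: once the image of position
  \<open>k\<close> is divided out, closure is retained for the later positions, as in
  \<open>stable_cokernel\<close>.\<close>

definition stable :: "nat \<Rightarrow> (nat \<Rightarrow> 'a set) \<Rightarrow> bool" where
  "stable k S \<longleftrightarrow> (\<forall>n. add_subgroup (S n)) \<and>
     (\<forall>n j x. j \<ge> k \<longrightarrow> x \<in> S n \<longrightarrow> \<delta> j x \<in> S (Suc n) \<and> s j x \<in> S n)"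

definition admissible :: "nat \<Rightarrow> (nat \<Rightarrow> 'a set) \<Rightarrow> (nat \<Rightarrow> 'a set) \<Rightarrow> bool" where
  "admissible k Z B \<longleftrightarrow> stable k Z \<and> stable k B \<and> (\<forall>n. B n \<subseteq> Z n)"

definition cokernel :: "nat \<Rightarrow> (nat \<Rightarrow> 'a set) \<Rightarrow> (nat \<Rightarrow> 'a set) \<Rightarrow> nat \<Rightarrow> 'a set" where
  "cokernel k Z B m = (case m of 0 \<Rightarrow> B 0 | Suc m' \<Rightarrow> {x + \<delta> k z | x z. x \<in> B m \<and> z \<in> Z m'})"

definition insertion_inj :: "nat \<Rightarrow> (nat \<Rightarrow> 'a set) \<Rightarrow> (nat \<Rightarrow> 'a set) \<Rightarrow> nat \<Rightarrow> bool" where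
  "insertion_inj k Z B m \<longleftrightarrow> (\<forall>v\<in>Z m. \<delta> k v \<in> B (Suc m) \<longrightarrow> v \<in> B m)"

lemma stable_Suc: "stable k S \<Longrightarrow> stable (Suc k) S"
  by (simp add: stable_def)

lemma admissible_Suc: "admissible k Z B \<Longrightarrow> admissible (Suc k) Z B"
  by (simp add: stable_Suc admissible_def)

lemma stable_add_subgroup: "stable k S \<Longrightarrow> add_subgroup (S m)"
  by (simp add: stable_def)

lemma stable_cokernel:
  assumes "stable k Z" "stable k B" shows "stable (Suc k) (cokernel k Z B)"
proof -
  note sg = stable_add_subgroup[OF assms(1)] stable_add_subgroup[OF assms(2)]
  have "add_subgroup (cokernel k Z B n)" for n
  proof (cases n)
    case 0
    then show ?thesis using sg by (simp add: cokernel_def)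
  next
    case (Suc m)
    have "0 \<in> cokernel k Z B n"
      using Suc sg[THEN add_subgroup_0] by (force simp: cokernel_def)
    moreover have "x - y \<in> cokernel k Z B n" if xy: "x \<in> cokernel k Z B n" "y \<in> cokernel k Z B n" for x y
    proof -
      from xy Suc obtain a v b w where *: "x = a + \<delta> k v" "y = b + \<delta> k w" "a \<in> B n" "b \<in> B n" "v \<in> Z m" "w \<in> Z m"
        by (auto simp: cokernel_def)
      then have "x - y = (a - b) + \<delta> k (v - w)" by (simp add: \<delta>_diff)
      moreover have "a - b \<in> B n" "v - w \<in> Z m" using * sg[THEN add_subgroup_diff] by auto
      ultimately show ?thesis using Suc unfolding cokernel_def by auto
    qed
    ultimately show ?thesis by (simp add: add_subgroup_def)
  qed
  moreover have "\<delta> j x \<in> cokernel k Z B (Suc n) \<and> s j x \<in> cokernel k Z B n"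
    if j: "j \<ge> Suc k" and x: "x \<in> cokernel k Z B n" for n j x
  proof (cases n)
    case 0
    then have "x \<in> B 0" using x by (simp add: cokernel_def)
    then have "\<delta> j x + \<delta> k 0 \<in> cokernel k Z B (Suc n)" "s j x \<in> B 0"
      using assms j 0 sg(1)[THEN add_subgroup_0] unfolding cokernel_def stable_def by (auto intro!: exI)
    then show ?thesis using 0 by (simp add: cokernel_def)
  next
    case (Suc m)
    with x obtain a v where *: "x = a + \<delta> k v" "a \<in> B n" "v \<in> Z m" by (auto simp: cokernel_def)
    obtain j' where j': "j = Suc j'" "k \<le> j'" using j by (cases j) auto
    have "\<delta> j x = \<delta> j a + \<delta> k (\<delta> j' v)" "s j x = s j a + \<delta> k (s j' v)"
      using * j' by (simp_all add: \<delta>_add s_add \<delta>_\<delta> s_Suc_\<delta>)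
    moreover have "\<delta> j a \<in> B (Suc n)" "\<delta> j' v \<in> Z n" "s j a \<in> B n" "s j' v \<in> Z m"
      using assms * j' Suc by (auto simp: stable_def)
    ultimately show ?thesis using Suc by (auto simp: cokernel_def)
  qed
  ultimately show ?thesis by (simp add: stable_def)
qed

lemma admissible_cokernel:
  assumes "admissible k Z B" shows "admissible (Suc k) Z (cokernel k Z B)"
proof -
  have "cokernel k Z B n \<subseteq> Z n" for n
    using assms unfolding admissible_def cokernel_def stable_def
    by (auto split: nat.splits) (meson add_subgroup_add order_refl subsetD)
  with assms show ?thesis by (simp add: admissible_def stable_Suc stable_cokernel)
qed

text \<open>Source and target families are kept apart so that the lemma also covers chains with
  coefficients in the kernel of all insertions, whose differential lands in
  \<open>B\<close>.\<close>

lemma kd_chains_gen: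
  assumes "\<And>m v j. v \<in> S m \<Longrightarrow> j \<ge> k \<Longrightarrow> \<delta> j v \<in> T (Suc m)" "\<And>m. add_subgroup (T m)" "c \<in> kchains b n i S"
  shows "kd \<delta> k c \<in> kchains b n (i - 1) T"
  using assms
proof (induction n arbitrary: b k c i)
  case 0
  then show ?case by (auto simp: kchains_def add_subgroup_0)
next
  case (Suc n)
  let ?c0 = "\<lambda>l. c (False # l)" and ?c1 = "\<lambda>l. c (True # l)"
  from Suc.prems have c: "?c0 \<in> kchains (Suc b) n i S" "?c1 \<in> kchains b n (i - 1) S"
    by (simp_all add: chains_Suc)
  have "kd \<delta> (Suc k) ?c0 \<in> kchains (Suc b) n (i - 1) T" "kd \<delta> k ?c1 \<in> kchains b n (i - 2) T"
    using Suc.IH[OF Suc.prems(1,2) c(1), of "Suc k"] Suc.IH[OF Suc.prems(1,2) c(2)] by auto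
  moreover have "(\<delta> k \<circ> ?c1) \<in> kchains (Suc b) n (i - 1) T"
    using c(2) Suc.prems(1)[OF _ order_refl] by (auto simp: kchains_def)
  ultimately have "kd \<delta> (Suc k) ?c0 + (\<delta> k \<circ> ?c1) \<in> kchains (Suc b) n (i - 1) T"
    "- kd \<delta> k ?c1 \<in> kchains b n (i - 2) T"
    using chains_add_subgroup[of T] Suc.prems(2) by (auto intro: add_subgroup_add add_subgroup_minus)
  then show ?case by (simp add: chains_Suc plus_fun_def comp_def fun_Compl_def)
qed

lemma kd_chains: "stable k S \<Longrightarrow> c \<in> kchains b n i S \<Longrightarrow> kd \<delta> k c \<in> kchains b n (i - 1) S"
  by (rule kd_chains_gen[of S]) (auto simp: stable_def)

lemma comp_chains: "stable k S \<Longrightarrow> c \<in> kchains b n i S \<Longrightarrow> \<delta> k \<circ> c \<in> kchains (Suc b) n i S"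
  by (auto simp: kchains_def stable_def)

lemma chains_cokernelE:
  assumes "c \<in> kchains (Suc b) n i (cokernel k Z B)"
  obtains g where "g \<in> kchains b n i Z" "c - (\<delta> k \<circ> g) \<in> kchains (Suc b) n i B"
proof -
  have "\<exists>z. length l = n \<longrightarrow> int (count_list l True) = i \<longrightarrow>
      z \<in> Z (b + count_list l False) \<and> c l - \<delta> k z \<in> B (Suc b + count_list l False)" for l
    using assms by (force simp: kchains_def cokernel_def)
  then obtain g where "length l = n \<longrightarrow> int (count_list l True) = i \<longrightarrow>
      g l \<in> Z (b + count_list l False) \<and> c l - \<delta> k (g l) \<in> B (Suc b + count_list l False)" for l
    by metis
  then show thesis by (intro that[of g]) (auto simp: kchains_def)
qed

lemma chains_cokernelI:
  assumes "g \<in> kchains b n i Z" "c - (\<delta> k \<circ> g) \<in> kchains (Suc b) n i B"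
  shows "c \<in> kchains (Suc b) n i (cokernel k Z B)"
  using assms unfolding kchains_def cokernel_def
  by auto (metis diff_add_cancel)

lemma koszul_exactD:
  assumes "koszul_exact \<delta> k b Z B n i" "c \<in> kchains b n i Z" "kd \<delta> k c \<in> kchains b n (i - 1) B"
  obtains e where "e \<in> kchains b n (i + 1) Z" "c - kd \<delta> k e \<in> kchains b n i B"
  using assms by (auto simp: koszul_exact_def)

lemma koszul_exactI:
  assumes "\<And>c. c \<in> kchains b n i Z \<Longrightarrow> kd \<delta> k c \<in> kchains b n (i - 1) B \<Longrightarrow>
    \<exists>e\<in>kchains b n (i + 1) Z. c - kd \<delta> k e \<in> kchains b n i B"
  shows "koszul_exact \<delta> k b Z B n i"
  using assms by (auto simp: koszul_exact_def)

text \<open>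
  The Koszul complex on \<open>n + 1\<close> points is the mapping cone of \<^term>\<open>\<delta> k\<close> from the complex on \<open>n\<close>
  points to its shift.
\<close>

lemma admissibleD:
  assumes "admissible k Z B"
  shows "stable k Z" "stable k B" "add_subgroup (kchains b n i Z)" "add_subgroup (kchains b n i B)"
  using assms by (auto simp: admissible_def intro!: chains_add_subgroup stable_add_subgroup)

text \<open>The cone maps to the complex of the cokernel, and the obstruction to lifting a cycle
  lies two degrees lower, in the complex of the kernel. For \<open>i \<le> 1\<close> that degree is
  negative.\<close>

lemma koszul_exact_cokernel:
  assumes adm: "admissible k Z B" and ex: "koszul_exact \<delta> k b Z B (Suc n) i" and i: "i \<le> 1"
  shows "koszul_exact \<delta> (Suc k) (Suc b) Z (cokernel k Z B) n i"
proof (rule koszul_exactI)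
  have stZ: "stable k Z" and stB: "stable k B" using adm by (auto simp: admissible_def)
  fix z assume z: "z \<in> kchains (Suc b) n i Z"
    and dz: "kd \<delta> (Suc k) z \<in> kchains (Suc b) n (i - 1) (cokernel k Z B)"
  obtain g where g: "g \<in> kchains b n (i - 1) Z" "kd \<delta> (Suc k) z - (\<delta> k \<circ> g) \<in> kchains (Suc b) n (i - 1) B"
    using chains_cokernelE[OF dz] by blast
  have 1: "- g \<in> kchains b n (i - 1) Z"
    using g chains_add_subgroup[of Z] stable_add_subgroup[OF stZ] by (blast intro: add_subgroup_minus)
  have 2: "- kd \<delta> k (- g) \<in> kchains b n (i - 2) B" using i by (intro chains_trivial) auto
  have 3: "kd \<delta> (Suc k) z + (\<delta> k \<circ> (- g)) \<in> kchains (Suc b) n (i - 1) B"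
    using g(2) by (simp add: comp_minus)
  obtain e0 e1 where e: "e0 \<in> kchains (Suc b) n (i + 1) Z" "e1 \<in> kchains b n i Z"
      "z - (kd \<delta> (Suc k) e0 + (\<delta> k \<circ> e1)) \<in> kchains (Suc b) n i B"
    by (rule koszul_exact_SucE[OF ex z 1 3 2])
  have "z - kd \<delta> (Suc k) e0 \<in> kchains (Suc b) n i (cokernel k Z B)"
    by (rule chains_cokernelI[of e1]) (use e in \<open>simp_all add: algebra_simps\<close>)
  with e(1) show "\<exists>e\<in>kchains (Suc b) n (i + 1) Z. z - kd \<delta> (Suc k) e \<in> kchains (Suc b) n i (cokernel k Z B)"
    by blast
qed

text \<open>An adjacent transposition carries the insertion at one position to the insertion at the
  next. Here the symmetric group action makes the kernel of one insertion a module on which all of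
  them vanish.\<close>

lemma insertion_inj_0_all:
  assumes "stable k B" "\<delta> k v \<in> B m" "j \<ge> k" shows "\<delta> j v \<in> B m"
  using assms(3)
proof (induction rule: dec_induct)
  case (step j)
  then have "s j (\<delta> j v) \<in> B m" using assms(1) by (simp add: stable_def)
  then show ?case by (simp add: s_\<delta>)
qed (use assms in auto)

text \<open>All insertions vanish on the kernel of \<open>\<delta> k\<close>, so its Koszul
  differential is zero and its H_0 on \<open>n\<close> points is its whole value at level
  \<open>b + n\<close>. In the long exact sequence this group stands between H_2 of the cokernel and
  H_1 of the cone.\<close>

lemma koszul_exact_imp_insertion_inj:
  assumes adm: "admissible k Z B" and ex1: "koszul_exact \<delta> k b Z B (Suc n) 1"
    and ex2: "koszul_exact \<delta> (Suc k) (Suc b) Z (cokernel k Z B) n 2"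
  shows "insertion_inj k Z B (b + n)"
  unfolding insertion_inj_def
proof (intro ballI impI)
  note stZ = admissibleD(1)[OF adm] and stB = admissibleD(2)[OF adm]
    and sgZ = admissibleD(3)[OF adm] and sgB = admissibleD(4)[OF adm]
  fix v assume v: "v \<in> Z (b + n)" "\<delta> k v \<in> B (Suc (b + n))"
  \<comment> \<open>The element \<open>v\<close> is placed in the marked half of the cone. A
    constant chain is enough, since in degree 0 only the subset without marked points is
    inspected.\<close>
  let ?c1 = "\<lambda>l::bool list. v"
  have len: "count_list l False = length l" if "count_list l True = 0" for l
    using that by (induction l) (auto split: if_splits)
  have 1: "0 \<in> kchains (Suc b) n 1 Z" "?c1 \<in> kchains b n (1 - 1) Z"
    "- kd \<delta> k ?c1 \<in> kchains b n (1 - 2) B"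
    "kd \<delta> (Suc k) 0 + (\<delta> k \<circ> ?c1) \<in> kchains (Suc b) n (1 - 1) B"
    using v stable_add_subgroup[OF stZ, THEN add_subgroup_0]
    by (auto simp: kd_0 kchains_def len intro!: chains_trivial)
  obtain e0 e1 where e: "e0 \<in> kchains (Suc b) n 2 Z" "e1 \<in> kchains b n 1 Z"
      "0 - (kd \<delta> (Suc k) e0 + (\<delta> k \<circ> e1)) \<in> kchains (Suc b) n 1 B" "?c1 + kd \<delta> k e1 \<in> kchains b n 0 B"
    by (rule koszul_exact_SucE[OF ex1 1(1,2,4,3)]) simp
  have "kd \<delta> (Suc k) e0 - (\<delta> k \<circ> (- e1)) \<in> kchains (Suc b) n 1 B"
    using e(3) add_subgroup_minus[OF sgB, of _ "Suc b" n 1] by (force simp: comp_minus algebra_simps)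
  moreover have "- e1 \<in> kchains b n 1 Z" using e sgZ by (blast intro: add_subgroup_minus)
  ultimately have "kd \<delta> (Suc k) e0 \<in> kchains (Suc b) n (2 - 1) (cokernel k Z B)"
    by (auto intro: chains_cokernelI)
  from koszul_exactD[OF ex2 e(1) this] obtain f where
    f: "f \<in> kchains (Suc b) n 3 Z" "e0 - kd \<delta> (Suc k) f \<in> kchains (Suc b) n 2 (cokernel k Z B)" by auto
  from chains_cokernelE[OF f(2)] obtain g where
    g: "g \<in> kchains b n 2 Z" "e0 - kd \<delta> (Suc k) f - (\<delta> k \<circ> g) \<in> kchains (Suc b) n 2 B" by blast
  have "kd \<delta> (Suc k) (e0 - kd \<delta> (Suc k) f - (\<delta> k \<circ> g)) \<in> kchains (Suc b) n (2 - 1) B"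
    by (rule kd_chains[OF stable_Suc[OF stB] g(2)])
  then have 2: "kd \<delta> (Suc k) e0 - (\<delta> k \<circ> kd \<delta> k g) \<in> kchains (Suc b) n 1 B"
    by (simp add: kd_diff kd_kd kd_comp)
  \<comment> \<open>Adding the boundary of \<open>g\<close> does not change the differential of
    \<open>e1\<close>, but it makes the insertion of \<open>?e\<close> vanish modulo
    \<open>B\<close>. So \<open>?e\<close> has coefficients in the kernel, and its differential lies
    in \<open>B\<close>.\<close>
  let ?e = "e1 + kd \<delta> k g"
  have "- ((0 - (kd \<delta> (Suc k) e0 + (\<delta> k \<circ> e1))) + (kd \<delta> (Suc k) e0 - (\<delta> k \<circ> kd \<delta> k g)))
      \<in> kchains (Suc b) n 1 B"
    using add_subgroup_add[OF sgB e(3) 2] sgB by (blast intro: add_subgroup_minus)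
  then have 3: "\<delta> k \<circ> ?e \<in> kchains (Suc b) n 1 B"
    by (simp add: comp_add algebra_simps)
  have "kd \<delta> k g \<in> kchains b n (2 - 1) Z" by (rule kd_chains[OF stZ g(1)])
  then have "?e \<in> kchains b n 1 Z" using e(2) sgZ by (auto intro: add_subgroup_add)
  with 3 have "?e \<in> kchains b n 1 (\<lambda>m. {v. \<forall>j\<ge>k. \<delta> j v \<in> B (Suc m)})"
    using insertion_inj_0_all[OF stB] by (auto simp: kchains_def)
  then have "kd \<delta> k ?e \<in> kchains b n (1 - 1) B"
    by (rule kd_chains_gen[rotated 2]) (auto intro: stable_add_subgroup[OF stB])
  then have "kd \<delta> k e1 \<in> kchains b n 0 B" by (simp add: kd_add kd_kd)
  with e(4) have "?c1 \<in> kchains b n 0 B" using add_subgroup_diff[OF sgB] by force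
  moreover have "count_list (replicate n False) False = n" "count_list (replicate n False) True = 0"
    by (induction n) auto
  ultimately show "v \<in> B (b + n)"
    unfolding kchains_def by (auto dest!: spec[of _ "replicate n False"])
qed

text \<open>Besides the cokernel in degree \<open>i\<close>, the homology of the cone sees the
  kernel in degree \<open>i - 1\<close>. A coefficient of that degree leaves
  \<open>n - i + 1\<close> points unmarked, which gives the level at which injectivity is
  required.\<close>

lemma koszul_exact_of_cokernel:
  assumes adm: "admissible k Z B"
    and ex: "koszul_exact \<delta> (Suc k) (Suc b) Z (cokernel k Z B) n i"
    and inj: "\<And>m. int m = int b + int n - i + 1 \<Longrightarrow> m \<ge> b \<Longrightarrow> insertion_inj k Z B m"
  shows "koszul_exact \<delta> k b Z B (Suc n) i"
proof (rule koszul_exact_SucI)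
  note stZ = admissibleD(1)[OF adm] and stB = admissibleD(2)[OF adm]
    and sgZ = admissibleD(3)[OF adm] and sgB = admissibleD(4)[OF adm]
  fix c0 c1 assume c: "c0 \<in> kchains (Suc b) n i Z" "c1 \<in> kchains b n (i - 1) Z"
      "kd \<delta> (Suc k) c0 + (\<delta> k \<circ> c1) \<in> kchains (Suc b) n (i - 1) B" "- kd \<delta> k c1 \<in> kchains b n (i - 2) B"
  have "- c1 \<in> kchains b n (i - 1) Z" using c sgZ by (blast intro: add_subgroup_minus)
  then have "kd \<delta> (Suc k) c0 \<in> kchains (Suc b) n (i - 1) (cokernel k Z B)"
    by (rule chains_cokernelI) (use c in \<open>simp add: comp_minus\<close>)
  from koszul_exactD[OF ex c(1) this] obtain f where
    f: "f \<in> kchains (Suc b) n (i + 1) Z" "c0 - kd \<delta> (Suc k) f \<in> kchains (Suc b) n i (cokernel k Z B)" .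
  from chains_cokernelE[OF f(2)] obtain g where
    g: "g \<in> kchains b n i Z" "c0 - kd \<delta> (Suc k) f - (\<delta> k \<circ> g) \<in> kchains (Suc b) n i B" by blast
  have "kd \<delta> (Suc k) (c0 - kd \<delta> (Suc k) f - (\<delta> k \<circ> g)) \<in> kchains (Suc b) n (i - 1) B"
    by (rule kd_chains[OF stable_Suc[OF stB] g(2)])
  then have 2: "kd \<delta> (Suc k) c0 - (\<delta> k \<circ> kd \<delta> k g) \<in> kchains (Suc b) n (i - 1) B"
    by (simp add: kd_diff kd_kd kd_comp)
  let ?e = "c1 + kd \<delta> k g"
  have 3: "\<delta> k \<circ> ?e \<in> kchains (Suc b) n (i - 1) B"
    using add_subgroup_diff[OF sgB c(3) 2] by (simp add: comp_add algebra_simps)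
  have "kd \<delta> k g \<in> kchains b n (i - 1) Z" by (rule kd_chains[OF stZ g(1)])
  then have e: "?e \<in> kchains b n (i - 1) Z" using c(2) sgZ by (auto intro: add_subgroup_add)
  have "?e \<in> kchains b n (i - 1) B"
    unfolding kchains_def
  proof (intro CollectI allI impI)
    fix l :: "bool list" assume l: "length l = n" "int (count_list l True) = i - 1"
    have "count_list l True + count_list l False = length l" by (induction l) auto
    with l have "insertion_inj k Z B (b + count_list l False)" by (intro inj) auto
    with l e 3 show "?e l \<in> B (b + count_list l False)"
      unfolding insertion_inj_def kchains_def by auto
  qed
  with f g show "\<exists>e0\<in>kchains (Suc b) n (i + 1) Z. \<exists>e1\<in>kchains b n i Z.
      c0 - (kd \<delta> (Suc k) e0 + (\<delta> k \<circ> e1)) \<in> kchains (Suc b) n i B \<and> c1 + kd \<delta> k e1 \<in> kchains b n (i - 1) B"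
    by (intro bexI[of _ f] bexI[of _ g]) (auto simp: diff_diff_eq)
qed

text \<open>The long exact sequence of the cone: H_i of the shift on \<open>n\<close> points stands
  between H_i of the module on \<open>n\<close> and on \<open>n + 1\<close> points.\<close>

lemma koszul_exact_shift:
  assumes adm: "admissible k Z B"
    and ex: "koszul_exact \<delta> k b Z B n i" "koszul_exact \<delta> k b Z B (Suc n) i"
  shows "koszul_exact \<delta> (Suc k) (Suc b) Z B n i"
proof (rule koszul_exactI)
  note stZ = admissibleD(1)[OF adm] and stB = admissibleD(2)[OF adm]
    and sgZ = admissibleD(3)[OF adm] and sgB = admissibleD(4)[OF adm]
  fix z assume z: "z \<in> kchains (Suc b) n i Z" "kd \<delta> (Suc k) z \<in> kchains (Suc b) n (i - 1) B"
  have 1: "0 \<in> kchains b n (i - 1) Z" "kd \<delta> (Suc k) z + (\<delta> k \<circ> 0) \<in> kchains (Suc b) n (i - 1) B"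
    "- kd \<delta> k 0 \<in> kchains b n (i - 2) B"
    using z sgZ[THEN add_subgroup_0] sgB[THEN add_subgroup_0] by (auto simp: comp_0 kd_0)
  obtain e0 e1 where e: "e0 \<in> kchains (Suc b) n (i + 1) Z" "e1 \<in> kchains b n i Z"
      "z - (kd \<delta> (Suc k) e0 + (\<delta> k \<circ> e1)) \<in> kchains (Suc b) n i B" "0 + kd \<delta> k e1 \<in> kchains b n (i - 1) B"
    by (rule koszul_exact_SucE[OF ex(2) z(1) 1])
  from koszul_exactD[OF ex(1) e(2)] e(4) obtain h where
    h: "h \<in> kchains b n (i + 1) Z" "e1 - kd \<delta> k h \<in> kchains b n i B" by auto
  have "\<delta> k \<circ> (e1 - kd \<delta> k h) \<in> kchains (Suc b) n i B" by (rule comp_chains[OF stB h(2)])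
  from add_subgroup_add[OF sgB e(3) this]
  have "z - kd \<delta> (Suc k) (e0 + (\<delta> k \<circ> h)) \<in> kchains (Suc b) n i B"
    by (simp add: kd_add kd_comp comp_diff algebra_simps)
  moreover have "e0 + (\<delta> k \<circ> h) \<in> kchains (Suc b) n (i + 1) Z"
    using e(1) comp_chains[OF stZ h(1)] sgZ by (auto intro: add_subgroup_add)
  ultimately show "\<exists>e\<in>kchains (Suc b) n (i + 1) Z. z - kd \<delta> (Suc k) e \<in> kchains (Suc b) n i B" by blast
qed

text \<open>The next place of the same sequence: H_(i+1) of the module on \<open>n + 1\<close>
  points stands between H_(i+1) of the shift and H_i of the module, both on \<open>n\<close>
  points.\<close>

lemma koszul_exact_up:
  assumes adm: "admissible k Z B"
    and ex: "koszul_exact \<delta> (Suc k) (Suc b) Z B n (i + 1)" "koszul_exact \<delta> k b Z B n i"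
  shows "koszul_exact \<delta> k b Z B (Suc n) (i + 1)"
proof (rule koszul_exact_SucI)
  note stZ = admissibleD(1)[OF adm] and stB = admissibleD(2)[OF adm]
    and sgZ = admissibleD(3)[OF adm] and sgB = admissibleD(4)[OF adm]
  fix c0 c1 assume c: "c0 \<in> kchains (Suc b) n (i + 1) Z" "c1 \<in> kchains b n (i + 1 - 1) Z"
      "kd \<delta> (Suc k) c0 + (\<delta> k \<circ> c1) \<in> kchains (Suc b) n (i + 1 - 1) B" "- kd \<delta> k c1 \<in> kchains b n (i + 1 - 2) B"
  have "kd \<delta> k c1 \<in> kchains b n (i - 1) B" using c(4) add_subgroup_minus_iff[OF sgB] by auto
  with c koszul_exactD[OF ex(2), of c1] obtain h where
    h: "h \<in> kchains b n (i + 1) Z" "c1 - kd \<delta> k h \<in> kchains b n i B" by auto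
  have "\<delta> k \<circ> (c1 - kd \<delta> k h) \<in> kchains (Suc b) n i B" by (rule comp_chains[OF stB h(2)])
  from add_subgroup_diff[OF sgB c(3)[simplified] this]
  have 1: "kd \<delta> (Suc k) (c0 + (\<delta> k \<circ> h)) \<in> kchains (Suc b) n (i + 1 - 1) B"
    by (simp add: kd_add kd_comp comp_diff algebra_simps)
  have 2: "c0 + (\<delta> k \<circ> h) \<in> kchains (Suc b) n (i + 1) Z"
    using c(1) comp_chains[OF stZ h(1)] sgZ by (auto intro: add_subgroup_add)
  from koszul_exactD[OF ex(1) 2 1] obtain e where
    e: "e \<in> kchains (Suc b) n (i + 1 + 1) Z" "c0 + (\<delta> k \<circ> h) - kd \<delta> (Suc k) e \<in> kchains (Suc b) n (i + 1) B" .
  show "\<exists>e0\<in>kchains (Suc b) n (i + 1 + 1) Z. \<exists>e1\<in>kchains b n (i + 1) Z.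
      c0 - (kd \<delta> (Suc k) e0 + (\<delta> k \<circ> e1)) \<in> kchains (Suc b) n (i + 1) B \<and> c1 + kd \<delta> k e1 \<in> kchains b n (i + 1 - 1) B"
    by (rule bexI[of _ e], rule bexI[of _ "- h"])
      (use e h sgZ in \<open>auto simp: comp_minus kd_minus algebra_simps intro: add_subgroup_minus\<close>)
qed

text \<open>The third place of the sequence. Together with \<open>koszul_exact_up\<close> it moves
  vanishing along a line of slope one in both directions.\<close>

lemma koszul_exact_down:
  assumes adm: "admissible k Z B"
    and ex: "koszul_exact \<delta> k b Z B (Suc n) (i + 1)" "koszul_exact \<delta> (Suc k) (Suc b) Z B n i"
  shows "koszul_exact \<delta> k b Z B n i"
proof (rule koszul_exactI)
  note stZ = admissibleD(1)[OF adm] and stB = admissibleD(2)[OF adm]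
    and sgZ = admissibleD(3)[OF adm] and sgB = admissibleD(4)[OF adm]
  fix h assume h: "h \<in> kchains b n i Z" "kd \<delta> k h \<in> kchains b n (i - 1) B"
  have "kd \<delta> (Suc k) (\<delta> k \<circ> h) \<in> kchains (Suc b) n (i - 1) B"
    using comp_chains[OF stB h(2)] by (simp add: kd_comp)
  from koszul_exactD[OF ex(2) comp_chains[OF stZ h(1)] this] obtain f where
    f: "f \<in> kchains (Suc b) n (i + 1) Z" "(\<delta> k \<circ> h) - kd \<delta> (Suc k) f \<in> kchains (Suc b) n i B" .
  have 1: "- f \<in> kchains (Suc b) n (i + 1) Z" using f sgZ by (blast intro: add_subgroup_minus)
  have 2: "kd \<delta> (Suc k) (- f) + (\<delta> k \<circ> h) \<in> kchains (Suc b) n (i + 1 - 1) B"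
    using f by (simp add: kd_minus)
  have 3: "h \<in> kchains b n (i + 1 - 1) Z" "- kd \<delta> k h \<in> kchains b n (i + 1 - 2) B"
    using h sgB by (auto intro: add_subgroup_minus)
  obtain e1 where e: "e1 \<in> kchains b n (i + 1) Z" "h + kd \<delta> k e1 \<in> kchains b n i B"
    by (rule koszul_exact_SucE[OF ex(1) 1 3(1) 2 3(2)]) simp
  show "\<exists>e\<in>kchains b n (i + 1) Z. h - kd \<delta> k e \<in> kchains b n i B"
    by (rule bexI[of _ "- e1"]) (use e sgZ in \<open>auto simp: kd_minus intro: add_subgroup_minus\<close>)
qed

text \<open>
  A cycle of the shift is carried, with its new point removed, to the complex on two further points
  \<open>x\<close>, \<open>y\<close>; antisymmetrizing in \<open>x\<close> and \<open>y\<close> is a chain map in the opposite direction.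
\<close>

lemma koszul_exact_antisymmetrize:
  assumes adm: "admissible k Z B"
    and ex: "koszul_exact \<delta> k b Z B (Suc (Suc n)) (i + 1)"
      "koszul_exact \<delta> (Suc (Suc k)) (Suc (Suc b)) Z B n i"
  shows "koszul_exact \<delta> (Suc k) (Suc b) Z B n i"
proof (rule koszul_exactI)
  note stZ = admissibleD(1)[OF adm] and stB = admissibleD(2)[OF adm]
    and sgZ = admissibleD(3)[OF adm] and sgB = admissibleD(4)[OF adm]
  fix z assume z: "z \<in> kchains (Suc b) n i Z" "kd \<delta> (Suc k) z \<in> kchains (Suc b) n (i - 1) B"
  have "kd \<delta> (Suc (Suc k)) (\<delta> (Suc k) \<circ> z) \<in> kchains (Suc (Suc b)) n (i - 1) B"
    using comp_chains[OF stable_Suc[OF stB] z(2)] by (simp add: kd_comp)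
  from koszul_exactD[OF ex(2) comp_chains[OF stable_Suc[OF stZ] z(1)] this] obtain w where
    w: "w \<in> kchains (Suc (Suc b)) n (i + 1) Z"
      "(\<delta> (Suc k) \<circ> z) - kd \<delta> (Suc (Suc k)) w \<in> kchains (Suc (Suc b)) n i B" .
  \<comment> \<open>Among the coefficients with the first point unmarked, \<open>- w\<close> sits
    where the second is unmarked and \<open>z\<close> where it is marked; those with the first point
    marked are 0. The choice of \<open>w\<close> as a primitive in the second shift is what makes
    this a cycle.\<close>
  let ?c0 = "pair (- w) z" and ?c1 = "pair 0 0"
  have 0: "(0 :: bool list \<Rightarrow> 'a) \<in> kchains b' n' i' Z" "(0 :: bool list \<Rightarrow> 'a) \<in> kchains b' n' i' B"
    for b' n' i' using sgZ sgB by (auto intro: add_subgroup_0)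
  have c0: "?c0 \<in> kchains (Suc b) (Suc n) (i + 1) Z"
    using w z sgZ by (auto simp: pair_chains intro: add_subgroup_minus)
  have p0: "pair 0 0 = (0 :: bool list \<Rightarrow> 'a)"
    by (auto simp: pair_def fun_eq_iff split: list.splits)
  have "kd \<delta> (Suc k) ?c0 \<in> kchains (Suc b) (Suc n) i B"
    using w z sgB by (auto simp: kd_pair pair_chains kd_minus intro: add_subgroup_minus)
  then have 1: "kd \<delta> (Suc k) ?c0 + (\<delta> k \<circ> 0) \<in> kchains (Suc b) (Suc n) (i + 1 - 1) B"
    by (simp add: comp_0)
  have 2: "- kd \<delta> k 0 \<in> kchains b (Suc n) (i + 1 - 2) B" by (simp add: kd_0 0)
  obtain e0 e1 where e: "e0 \<in> kchains (Suc b) (Suc n) (i + 1 + 1) Z" "e1 \<in> kchains b (Suc n) (i + 1) Z"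
      "?c0 - (kd \<delta> (Suc k) e0 + (\<delta> k \<circ> e1)) \<in> kchains (Suc b) (Suc n) (i + 1) B"
      "0 + kd \<delta> k e1 \<in> kchains b (Suc n) i B"
    by (rule koszul_exact_SucE[OF ex(1) c0 _ 1 2]) (auto intro: 0)
  let ?u = "\<lambda>l. e0 (True # l)" and ?v = "\<lambda>l. e1 (False # l)" and ?t = "\<lambda>l. e1 (True # l)"
  have u: "?u \<in> kchains (Suc b) n (i + 1) Z" "?v \<in> kchains (Suc b) n (i + 1) Z"
    using e(1,2) by (simp_all add: chains_Suc add.commute)
  have 3: "z + kd \<delta> (Suc k) ?u - (\<delta> k \<circ> ?t) \<in> kchains (Suc b) n i B"
    using e(3) by (simp add: chains_Suc plus_fun_def comp_def fun_Compl_def fun_diff_def diff_diff_eq2)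
  have 4: "kd \<delta> (Suc k) ?v + (\<delta> k \<circ> ?t) \<in> kchains (Suc b) n i B"
    using e(4) by (simp add: chains_Suc plus_fun_def comp_def)
  \<comment> \<open>\<open>?t\<close>, the coefficient with both points marked, enters relations 3
    and 4 with opposite signs. Their sum eliminates it and exhibits \<open>z\<close> as a boundary
    without a division by 2.\<close>
  have "z - kd \<delta> (Suc k) (- (?u + ?v)) \<in> kchains (Suc b) n i B"
    using add_subgroup_add[OF sgB 3 4] by (simp add: kd_minus kd_add kd_diff algebra_simps)
  moreover have "- (?u + ?v) \<in> kchains (Suc b) n (i + 1) Z"
    using u sgZ by (blast intro: add_subgroup_minus add_subgroup_add)
  ultimately show "\<exists>e\<in>kchains (Suc b) n (i + 1) Z. z - kd \<delta> (Suc k) e \<in> kchains (Suc b) n i B" by blast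
qed

section \<open>Regularity bounds\<close>

lemma koszul_exact_cokernel_range:
  assumes "admissible k Z B" "i = 0 \<or> i = 1" "\<And>n. int n > g \<Longrightarrow> koszul_exact \<delta> k b Z B n i"
    and "int n > g - 1"
  shows "koszul_exact \<delta> (Suc k) (Suc b) Z (cokernel k Z B) n i"
  using assms by (intro koszul_exact_cokernel) auto

lemma insertion_inj_le:
  assumes adm: "admissible k Z B"
    and ex1: "\<And>n. int n > r \<Longrightarrow> koszul_exact \<delta> k b Z B n 1"
    and ex2: "\<And>n. int n > N \<Longrightarrow> koszul_exact \<delta> (Suc k) (Suc b) Z (cokernel k Z B) n 2"
    and m: "m \<ge> b" "int m > int b + N" "int m > int b + r - 1"
  shows "insertion_inj k Z B m"
proof -
  obtain n where n: "m = b + n" using m(1) le_Suc_ex by blast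
  show ?thesis unfolding n
    by (rule koszul_exact_imp_insertion_inj[OF adm ex1 ex2]) (use m n in auto)
qed

lemma koszul_exact_step:
  assumes adm: "admissible k Z B"
    and ex: "\<And>n. int n > i + N \<Longrightarrow> koszul_exact \<delta> (Suc k) (Suc b) Z (cokernel k Z B) n i"
    and inj: "\<And>m. m \<ge> b \<Longrightarrow> int m > int b + M \<Longrightarrow> insertion_inj k Z B m"
    and n: "int n > i + N + 1" "int n > i + M" and i: "i \<ge> 1"
  shows "koszul_exact \<delta> k b Z B n i"
proof (cases n)
  case 0
  then show ?thesis using i by (intro koszul_exact_trivial) auto
next
  case (Suc n')
  show ?thesis unfolding Suc
    by (rule koszul_exact_of_cokernel[OF adm ex inj]) (use n Suc in auto)
qed

text \<open>A Nakayama argument: a value generated from strictly lower levels that are all zero in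
  the subquotient is itself zero.\<close>

lemma all_exact_0:
  assumes adm: "admissible k Z B" and ex: "\<And>n. koszul_exact \<delta> k b Z B n 0" and m: "m \<ge> b"
  shows "Z m = B m"
proof -
  have stB: "stable k B" and sub: "\<And>m. B m \<subseteq> Z m" using adm by (auto simp: admissible_def)
  have nf: "count_list (replicate n False) False = n" "count_list (replicate n False) True = 0" for n
    by (induction n) auto
  have "Z (b + n) \<subseteq> B (b + n)" for n
  proof (induction n rule: less_induct)
    case (less n)
    show ?case
    proof
      fix v assume v: "v \<in> Z (b + n)"
      have len: "count_list l False = length l" if "count_list l True = 0" for l
        using that by (induction l) (auto split: if_splits)
      have "(\<lambda>_. v) \<in> kchains b n 0 Z" using v by (auto simp: kchains_def len)
      moreover have "kd \<delta> k (\<lambda>_. v) \<in> kchains b n (0 - 1) B" by (rule chains_trivial) simp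
      ultimately obtain e where e: "e \<in> kchains b n (0 + 1) Z" "(\<lambda>_. v) - kd \<delta> k e \<in> kchains b n 0 B"
        using koszul_exactD[OF ex] by metis
      have "e l \<in> B (b + count_list l False)" if l: "length l = n" "count_list l True = 1" for l
      proof -
        have "count_list l True + count_list l False = length l" by (induction l) auto
        then have "count_list l False < n" using l by simp
        then show ?thesis using less e(1) l by (auto simp: kchains_def)
      qed
      then have "e \<in> kchains b n 1 B" by (auto simp: kchains_def)
      from kd_chains[OF stB this] have "kd \<delta> k e \<in> kchains b n 0 B" by simp
      moreover have "add_subgroup (kchains b n 0 B)"
        using stB by (auto intro: chains_add_subgroup stable_add_subgroup)
      ultimately have "(\<lambda>_. v) \<in> kchains b n 0 B"
        using e(2) add_subgroup_cong by blast
      then show "v \<in> B (b + n)"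
        using nf[of n] unfolding kchains_def by (auto dest!: spec[of _ "replicate n False"])
    qed
  qed
  then show ?thesis using m sub le_Suc_ex by blast
qed

lemma koszul_exact_zero:
  assumes adm: "admissible k Z B" and "\<And>m. m \<ge> b \<Longrightarrow> Z m = B m"
  shows "koszul_exact \<delta> k b Z B n i"
proof (rule koszul_exactI)
  fix c assume "c \<in> kchains b n i Z"
  then have "c \<in> kchains b n i B" by (rule chains_mono) (use assms in auto)
  moreover have "0 \<in> kchains b n (i + 1) Z"
    using adm by (auto simp: admissible_def intro!: add_subgroup_0 chains_add_subgroup stable_add_subgroup)
  ultimately show "\<exists>e\<in>kchains b n (i + 1) Z. c - kd \<delta> k e \<in> kchains b n i B"
    by (intro bexI[of _ 0]) (auto simp: kd_0)
qed

text \<open>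
  The cokernel of \<open>V \<rightarrow> \<Sigma>V\<close> lowers both degrees, and its second homology bounds the degree of the
  kernel, on which all insertions vanish.
\<close>

lemma regularity_le:
  assumes "admissible k Z B"
    and "\<And>n. int n > int g - 1 \<Longrightarrow> koszul_exact \<delta> k b Z B n 0"
    and "\<And>n. int n > r \<Longrightarrow> koszul_exact \<delta> k b Z B n 1"
  shows "(i \<ge> 1 \<longrightarrow> int n > i + int g + r - 2 \<longrightarrow> koszul_exact \<delta> k b Z B n i) \<and>
    (m \<ge> b \<longrightarrow> int m > int b + int g + r - 2 \<longrightarrow> insertion_inj k Z B m)"
  using assms
\<comment> \<open>\<open>g\<close> is one more than the bound on the generation degree, so that 0
  stands for the zero module and each cokernel lowers it by one.\<close>
proof (induction g arbitrary: k b B r i n m)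
  case 0
  have "Z m = B m" if "m \<ge> b" for m
    using all_exact_0[OF 0(1,2)] that by auto
  then show ?case
    using koszul_exact_zero[OF 0(1)] by (auto simp: insertion_inj_def)
next
  case (Suc g)
  note adm = Suc.prems(1)
  let ?C = "cokernel k Z B"
  have C0: "koszul_exact \<delta> (Suc k) (Suc b) Z ?C n 0" if "int n > int g - 1" for n
    by (rule koszul_exact_cokernel_range[OF adm _ Suc.prems(2)]) (use that in auto)
  have C1: "koszul_exact \<delta> (Suc k) (Suc b) Z ?C n 1" if "int n > r - 1" for n
    by (rule koszul_exact_cokernel_range[OF adm _ Suc.prems(3)]) (use that in auto)
  have C: "koszul_exact \<delta> (Suc k) (Suc b) Z ?C n i" if "i \<ge> 1" "int n > i + (int g + r - 3)" for n i
    using Suc.IH[where r = "r - 1", OF admissible_cokernel[OF adm] C0 C1] that by auto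
  \<comment> \<open>The kernel is bounded by H_2 of the cokernel, which ends at 2 plus the
    regularity bound \<open>int g + r - 3\<close>, and by H_1 of the module, which allows levels up
    to \<open>r - 1\<close> above \<open>b\<close>; the former bound is at least as large.\<close>
  have inj: "insertion_inj k Z B m" if m: "m \<ge> b" "int m > int b + (int (Suc g) + r - 2)" for m
    by (rule insertion_inj_le[OF adm Suc.prems(3), where N = "2 + (int g + r - 3)"]) (use C m in auto)
  have "koszul_exact \<delta> k b Z B n i" if "i \<ge> 1" "int n > i + int (Suc g) + r - 2"
    by (rule koszul_exact_step[where N = "int g + r - 3" and M = "int (Suc g) + r - 2", OF adm C inj])
      (use that in auto)
  with inj[of m] show ?case by auto
qed

text \<open>The relation bound in \<open>regularity_le\<close> is an arbitrary integer, and
  \<open>r = - int g\<close> turns its conclusion into \<open>n > i - 2\<close>, which covers every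
  \<open>n\<close> with nonzero chains in degree \<open>i\<close>. On zero points H_1 vanishes
  anyway.\<close>

lemma acyclic_of_exact_1:
  assumes "admissible k Z B"
    and ex0: "\<And>n. int n > int g - 1 \<Longrightarrow> koszul_exact \<delta> k b Z B n 0"
    and "\<And>n. int n > 0 \<Longrightarrow> koszul_exact \<delta> k b Z B n 1" and i: "i \<ge> 1"
  shows "koszul_exact \<delta> k b Z B n i"
proof (cases "int n < i")
  case False
  have "koszul_exact \<delta> k b Z B n 1" for n
    using assms(3)[of n] by (cases n) (auto intro: koszul_exact_trivial)
  then show ?thesis using regularity_le[OF assms(1) ex0, where r = "- int g" and i = i and n = n] i False by auto
qed (auto intro: koszul_exact_trivial)

text \<open>The induction runs over the relation degree, bounded here by \<open>r + 1\<close>,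
  instead of the generation degree. If it is at most 1, the cokernel has no H_1 on a nonempty set of
  points and is acyclic. Each further step costs 2, because the kernel is controlled by H_2 of the
  cokernel.\<close>

lemma regularity_le_relations:
  assumes "admissible k Z B"
    and "\<And>n. int n > int g - 1 \<Longrightarrow> koszul_exact \<delta> k b Z B n 0"
    and "\<And>n. n > Suc r \<Longrightarrow> koszul_exact \<delta> k b Z B n 1"
    and "i \<ge> 1" "int n > i + 2 * int r"
  shows "koszul_exact \<delta> k b Z B n i"
  using assms
proof (induction r arbitrary: k b B i n)
  case 0
  note adm = "0.prems"(1)
  let ?C = "cokernel k Z B"
  have C0: "koszul_exact \<delta> (Suc k) (Suc b) Z ?C n 0" if "int n > int g - 1" for n
    by (rule koszul_exact_cokernel_range[OF adm _ "0.prems"(2)]) (use that in auto)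
  have C1: "koszul_exact \<delta> (Suc k) (Suc b) Z ?C n 1" if "int n > 0" for n
    by (rule koszul_exact_cokernel_range[OF adm _ "0.prems"(3), where g = 1]) (use that in auto)
  have C: "koszul_exact \<delta> (Suc k) (Suc b) Z ?C n i" if "i \<ge> 1" for n i
    using acyclic_of_exact_1[OF admissible_cokernel[OF adm] C0 C1] that by auto
  \<comment> \<open>The cokernel is acyclic, whence \<open>N = -1\<close>; only H_1 of the module
    limits the kernel, which can survive at level \<open>b\<close> alone.\<close>
  have inj: "insertion_inj k Z B m" if m: "m \<ge> b" "int m > int b + 0" for m
    by (rule insertion_inj_le[where r = 1 and N = "-1", OF adm "0.prems"(3)]) (use C m in auto)
  show ?case by (rule koszul_exact_step[where N = "-2" and M = 0, OF adm C inj]) (use "0.prems" in auto)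
next
  case (Suc r)
  note adm = Suc.prems(1)
  let ?C = "cokernel k Z B"
  have C0: "koszul_exact \<delta> (Suc k) (Suc b) Z ?C n 0" if "int n > int g - 1" for n
    by (rule koszul_exact_cokernel_range[OF adm _ Suc.prems(2), where g = "int g - 1"]) (use that in auto)
  have C1: "koszul_exact \<delta> (Suc k) (Suc b) Z ?C n 1" if "n > Suc r" for n
    by (rule koszul_exact_cokernel_range[OF adm _ Suc.prems(3), where g = "int r + 2"]) (use that in auto)
  have C: "koszul_exact \<delta> (Suc k) (Suc b) Z ?C n i" if "i \<ge> 1" "int n > i + 2 * int r" for n i
    using Suc.IH[OF admissible_cokernel[OF adm] C0 C1] that by auto
  have inj: "insertion_inj k Z B m" if m: "m \<ge> b" "int m > int b + (2 * int r + 2)" for m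
    by (rule insertion_inj_le[where r = "int r + 2" and N = "2 + 2 * int r", OF adm Suc.prems(3)]) (use C m in auto)
  show ?case by (rule koszul_exact_step[where N = "2 * int r" and M = "2 * int r + 2", OF adm C inj]) (use Suc.prems in auto)
qed

text \<open>Raising \<open>b\<close> alone shifts the module while adding the new points behind all others.\<close>

lemma eventually_acyclic:
  assumes "admissible k Z B"
    and "\<And>n. int n > int g - 1 \<Longrightarrow> koszul_exact \<delta> k b Z B n 0"
    and "\<And>n. int n > r \<Longrightarrow> koszul_exact \<delta> k b Z B n 1"
  shows "\<exists>b0. \<forall>b'\<ge>b0. \<forall>i\<ge>1. \<forall>n. koszul_exact \<delta> k b' Z B n i"
  using assms
proof (induction g arbitrary: k b B r)
  case 0
  have "Z m = B m" if "m \<ge> b" for m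
    using all_exact_0[OF 0(1,2)] that by auto
  then show ?case
    using koszul_exact_zero[OF 0(1)] by (meson le_trans)
next
  case (Suc g)
  note adm = Suc.prems(1)
  let ?C = "cokernel k Z B"
  have C0: "koszul_exact \<delta> (Suc k) (Suc b) Z ?C n 0" if "int n > int g - 1" for n
    by (rule koszul_exact_cokernel_range[OF adm _ Suc.prems(2)]) (use that in auto)
  have C1: "koszul_exact \<delta> (Suc k) (Suc b) Z ?C n 1" if "int n > r - 1" for n
    by (rule koszul_exact_cokernel_range[OF adm _ Suc.prems(3)]) (use that in auto)
  from Suc.IH[where r = "r - 1", OF admissible_cokernel[OF adm] C0 C1] obtain b0 where
    b0: "\<And>b' i n. b' \<ge> b0 \<Longrightarrow> i \<ge> 1 \<Longrightarrow> koszul_exact \<delta> (Suc k) b' Z ?C n i" by auto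
  have inj: "insertion_inj k Z B m" if "m \<ge> b" "int m > int b + int (Suc g) + r - 2" for m
    using regularity_le[OF Suc.prems] that by blast
  \<comment> \<open>Large enough for the cokernel to be acyclic and for every level from here on to
    lie beyond the kernel. Injectivity of the insertion depends only on the level, so it persists
    when \<open>b\<close> is raised.\<close>
  let ?b = "Suc (b0 + b + Suc g + nat r)"
  have "koszul_exact \<delta> k b' Z B n i" if "b' \<ge> ?b" "i \<ge> 1" for b' n i
  proof (cases n)
    case 0
    then show ?thesis using that by (intro koszul_exact_trivial) auto
  next
    case (Suc n')
    show ?thesis unfolding Suc
      by (rule koszul_exact_of_cokernel[OF adm b0 inj]) (use that in auto)
  qed
  then show ?case by blast
qed

end

section \<open>Reversing the order of the points\<close>

lemma kd_snoc_True: "kd \<delta> k c (l @ [True]) = kd \<delta> k (\<lambda>l. c (l @ [True])) l"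
proof (induction l arbitrary: k c)
  case (Cons x l)
  then show ?case by (cases x) auto
qed simp

lemma kd_snoc_False:
  "kd \<delta> k c (l @ [False]) = kd \<delta> k (\<lambda>l. c (l @ [False])) l +
     (if even (count_list l True) then \<delta> (k + count_list l False) (c (l @ [True]))
      else - \<delta> (k + count_list l False) (c (l @ [True])))"
proof (induction l arbitrary: k c)
  case (Cons x l)
  then show ?case by (cases x) auto
qed simp

lemmas kd_snoc = kd_snoc_True kd_snoc_False

lemma count_list_rev: "count_list (rev l) x = count_list l x"
  by (induction l) auto

text \<open>The marked points before and after the inserted one add up to all marked points of
  \<open>l\<close>, so the signs of the two differentials differ by a factor depending only on the
  degree. \<open>k\<close> counts the unmarked points already read from the front, and
  \<open>N\<close> the points contributed by the shift.\<close>

lemma kd_rev: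
  assumes op: "\<And>M j x. x \<in> Z M \<Longrightarrow> j \<le> M \<Longrightarrow> \<delta>' j x = \<delta> (M - j) x"
    and c: "\<And>l. length l = n \<Longrightarrow> int (count_list l True) = i \<Longrightarrow> c l \<in> Z (N + k + count_list l False)"
    and l: "length l = n" "int (count_list l True) = i - 1"
  shows "kd \<delta>' k c l = (if even (count_list l True) then kd \<delta> N (c \<circ> rev) (rev l) else - kd \<delta> N (c \<circ> rev) (rev l))"
  using c l
proof (induction l arbitrary: n k c i)
  case Nil
  then show ?case by simp
next
  case (Cons x l)
  from Cons.prems(2) obtain n' where n': "n = Suc n'" by (cases n) auto
  show ?case
  proof (cases x)
    case True
    have "kd \<delta>' k (\<lambda>l. c (True # l)) l = (if even (count_list l True)
        then kd \<delta> N ((\<lambda>l. c (True # l)) \<circ> rev) (rev l) else - kd \<delta> N ((\<lambda>l. c (True # l)) \<circ> rev) (rev l))"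
      by (rule Cons.IH[where n = n' and i = "i - 1"])
        (use Cons.prems(1)[of "True # _"] Cons.prems(2,3) n' True in auto)
    with True show ?thesis by (simp add: kd_snoc comp_def)
  next
    case False
    have "kd \<delta>' (Suc k) (\<lambda>l. c (False # l)) l = (if even (count_list l True)
        then kd \<delta> N ((\<lambda>l. c (False # l)) \<circ> rev) (rev l) else - kd \<delta> N ((\<lambda>l. c (False # l)) \<circ> rev) (rev l))"
      by (rule Cons.IH[where n = n' and i = i])
        (use Cons.prems(1)[of "False # _"] Cons.prems(2,3) n' False in auto)
    moreover have "\<delta>' k (c (True # l)) = \<delta> (N + count_list l False) (c (True # l))"
    proof -
      have "c (True # l) \<in> Z (N + k + count_list l False)"
        using Cons.prems(1)[of "True # l"] Cons.prems(2,3) False by simp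
      from op[OF this, of k] show ?thesis by simp
    qed
    ultimately have 1: "kd \<delta>' k c (False # l) = (if even (count_list l True)
        then kd \<delta> N ((\<lambda>l. c (False # l)) \<circ> rev) (rev l) else - kd \<delta> N ((\<lambda>l. c (False # l)) \<circ> rev) (rev l)) +
        \<delta> (N + count_list l False) (c (True # l))" by (simp only: kd.simps)
    have 2: "kd \<delta> N (c \<circ> rev) (rev (False # l)) = kd \<delta> N ((\<lambda>l. c (False # l)) \<circ> rev) (rev l) +
     (if even (count_list l True) then \<delta> (N + count_list l False) (c (True # l))
      else - \<delta> (N + count_list l False) (c (True # l)))"
      by (simp add: kd_snoc_False comp_def count_list_rev)
    have x: "x # l = False # l" using False by simp
    show ?thesis unfolding x 1 2 by simp
  qed
qed

lemma rev_chains: "c \<circ> rev \<in> kchains b n i S \<longleftrightarrow> c \<in> kchains b n i S"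
proof -
  have imp: "c \<circ> rev \<in> kchains b n i S" if c: "c \<in> kchains b n i S" for c
    unfolding kchains_def
  proof (intro CollectI allI impI)
    fix l assume l: "length l = n" "int (count_list l True) = i"
    have "\<forall>l. length l = n \<longrightarrow> int (count_list l True) = i \<longrightarrow> c l \<in> S (b + count_list l False)"
      using c by (simp add: kchains_def)
    from spec[OF this, of "rev l"] l show "(c \<circ> rev) l \<in> S (b + count_list l False)"
      by (simp add: count_list_rev)
  qed
  have "(c \<circ> rev) \<circ> rev = c" by (simp add: fun_eq_iff)
  with imp[of "c \<circ> rev"] have "c \<circ> rev \<in> kchains b n i S \<Longrightarrow> c \<in> kchains b n i S" by simp
  with imp[of c] show ?thesis by blast
qed

lemma kchains_cong:
  "(\<And>l. length l = n \<Longrightarrow> int (count_list l True) = i \<Longrightarrow> c l = c' l) \<Longrightarrow>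
    c \<in> kchains b n i S \<longleftrightarrow> c' \<in> kchains b n i S"
  by (auto simp: kchains_def)

text \<open>Reversing the order of the points multiplies the differential by a sign depending on the degree.\<close>

lemma koszul_exact_rev:
  assumes op: "\<And>M j x. x \<in> Z M \<Longrightarrow> j \<le> M \<Longrightarrow> \<delta>' j x = \<delta> (M - j) x"
    and sg: "\<And>m. add_subgroup (Z m)" "\<And>m. add_subgroup (B m)"
    and minus: "\<And>c. kd \<delta> N (- c) = - kd \<delta> N c"
  shows "koszul_exact \<delta>' 0 N Z B n i \<Longrightarrow> koszul_exact \<delta> N N Z B n i"
    and "koszul_exact \<delta> N N Z B n i \<Longrightarrow> koszul_exact \<delta>' 0 N Z B n i"
proof -
  have sgZ: "add_subgroup (kchains b' n' i' Z)" and sgB: "add_subgroup (kchains b' n' i' B)" for b' n' i'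
    using sg by (auto intro!: chains_add_subgroup)
  have kd: "kd \<delta>' 0 c l = (if even (nat (i - 1)) then kd \<delta> N (c \<circ> rev) (rev l) else - kd \<delta> N (c \<circ> rev) (rev l))"
    if "c \<in> kchains N n i Z" "length l = n" "int (count_list l True) = i - 1" for c l i
  proof -
    have "count_list l True = nat (i - 1)" using that(3) by auto
    moreover have "c l \<in> Z (N + 0 + count_list l False)" if "length l = n" "int (count_list l True) = i" for l
      using that \<open>c \<in> kchains N n i Z\<close> by (simp add: kchains_def)
    ultimately show ?thesis using kd_rev[of Z \<delta>' \<delta> n i c N 0 l, OF op] that(2,3) by simp
  qed
  have cyc: "kd \<delta>' 0 c \<in> kchains N n (i - 1) B \<longleftrightarrow> kd \<delta> N (c \<circ> rev) \<in> kchains N n (i - 1) B"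
    if c: "c \<in> kchains N n i Z" for c i
  proof -
    have "kd \<delta>' 0 c \<in> kchains N n (i - 1) B \<longleftrightarrow> kd \<delta> N (c \<circ> rev) \<circ> rev \<in> kchains N n (i - 1) B"
      using kd[OF c] add_subgroup_minus_iff[OF sg(2)] by (auto simp: kchains_def)
    then show ?thesis by (simp add: rev_chains)
  qed
  have bd: "\<exists>e\<in>kchains N n (i + 1) Z. c - kd \<delta>' 0 e \<in> kchains N n i B"
    if e: "e \<in> kchains N n (i + 1) Z" "(c \<circ> rev) - kd \<delta> N e \<in> kchains N n i B" for c e i
  proof -
    \<comment> \<open>The sign by which the two differentials differ on chains of degree
      \<open>i + 1\<close> is absorbed into the chain.\<close>
    define e' where "e' = (if even (nat i) then e else - e)"
    have e': "e' \<in> kchains N n (i + 1) Z" "e' \<circ> rev \<in> kchains N n (i + 1) Z"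
      using e sgZ by (auto simp: e'_def rev_chains intro: add_subgroup_minus)
    have *: "kd \<delta>' 0 (e' \<circ> rev) l = kd \<delta> N e (rev l)" if "length l = n" "int (count_list l True) = i" for l
      using kd[OF e'(2), of l] that minus[of e] by (auto simp: e'_def comp_def fun_Compl_def)
    have "((c \<circ> rev) - kd \<delta> N e) \<circ> rev \<in> kchains N n i B" using e(2) by (simp add: rev_chains)
    then have "c - kd \<delta>' 0 (e' \<circ> rev) \<in> kchains N n i B"
      by (rule kchains_cong[THEN iffD1, rotated]) (simp add: *)
    with e' show ?thesis by blast
  qed
  have bd': "\<exists>e\<in>kchains N n (i + 1) Z. (c \<circ> rev) - kd \<delta> N e \<in> kchains N n i B"
    if e: "e \<in> kchains N n (i + 1) Z" "c - kd \<delta>' 0 e \<in> kchains N n i B" for c e i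
  proof -
    define e' where "e' = (if even (nat i) then e \<circ> rev else - (e \<circ> rev))"
    have e': "e' \<in> kchains N n (i + 1) Z"
      using e sgZ by (auto simp: e'_def rev_chains intro: add_subgroup_minus)
    have *: "kd \<delta>' 0 e l = kd \<delta> N e' (rev l)" if "length l = n" "int (count_list l True) = i" for l
      using kd[OF e(1), of l] that minus[of "e \<circ> rev"] by (auto simp: e'_def)
    have "(c - kd \<delta>' 0 e) \<circ> rev \<in> kchains N n i B" using e(2) by (simp add: rev_chains)
    then have "(c \<circ> rev) - kd \<delta> N e' \<in> kchains N n i B"
      by (rule kchains_cong[THEN iffD1, rotated]) (simp add: * count_list_rev)
    with e' show ?thesis by blast
  qed
  show "koszul_exact \<delta>' 0 N Z B n i \<Longrightarrow> koszul_exact \<delta> N N Z B n i"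
    unfolding koszul_exact_def
  proof (intro ballI impI)
    fix c assume a: "\<forall>c\<in>kchains N n i Z. kd \<delta>' 0 c \<in> kchains N n (i - 1) B \<longrightarrow>
          (\<exists>e\<in>kchains N n (i + 1) Z. c - kd \<delta>' 0 e \<in> kchains N n i B)"
      and c: "c \<in> kchains N n i Z" "kd \<delta> N c \<in> kchains N n (i - 1) B"
    have "(c \<circ> rev) \<circ> rev = c" by (simp add: fun_eq_iff)
    have "c \<circ> rev \<in> kchains N n i Z" using c by (simp add: rev_chains)
    moreover from this c have "kd \<delta>' 0 (c \<circ> rev) \<in> kchains N n (i - 1) B"
      using cyc[of "c \<circ> rev" i] \<open>(c \<circ> rev) \<circ> rev = c\<close> by simp
    ultimately obtain e where "e\<in>kchains N n (i + 1) Z" "(c \<circ> rev) - kd \<delta>' 0 e \<in> kchains N n i B"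
      using a by blast
    from bd'[OF this] \<open>(c \<circ> rev) \<circ> rev = c\<close> show "\<exists>e\<in>kchains N n (i + 1) Z. c - kd \<delta> N e \<in> kchains N n i B"
      by simp
  qed
  show "koszul_exact \<delta> N N Z B n i \<Longrightarrow> koszul_exact \<delta>' 0 N Z B n i"
    unfolding koszul_exact_def
  proof (intro ballI impI)
    fix c assume a: "\<forall>c\<in>kchains N n i Z. kd \<delta> N c \<in> kchains N n (i - 1) B \<longrightarrow>
          (\<exists>e\<in>kchains N n (i + 1) Z. c - kd \<delta> N e \<in> kchains N n i B)"
      and c: "c \<in> kchains N n i Z" "kd \<delta>' 0 c \<in> kchains N n (i - 1) B"
    have "c \<circ> rev \<in> kchains N n i Z" using c by (auto simp: rev_chains)
    moreover have "kd \<delta> N (c \<circ> rev) \<in> kchains N n (i - 1) B" using cyc[OF c(1)] c(2) by simp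
    ultimately obtain e where "e\<in>kchains N n (i + 1) Z" "(c \<circ> rev) - kd \<delta> N e \<in> kchains N n i B"
      using a by blast
    then show "\<exists>e\<in>kchains N n (i + 1) Z. c - kd \<delta>' 0 e \<in> kchains N n i B" by (rule bd)
  qed
qed

context insertions begin

section \<open>The strand of slope one\<close>

text \<open>The \<open>k\<close>-fold shift with its new points in front: they raise the level by
  \<open>k\<close> and push the first free position to \<open>k\<close>.\<close>

abbreviation exact where "exact Z B k \<equiv> koszul_exact \<delta> k k Z B"

definition regularity_at_most where
  "regularity_at_most Z B k \<rho> \<longleftrightarrow> (\<forall>i\<ge>1. \<forall>n. int n > i + \<rho> \<longrightarrow> exact Z B k n i)"

definition eventually_exact where
  "eventually_exact Z B \<longleftrightarrow> (\<exists>N. \<forall>k\<ge>N. \<forall>i\<ge>1. \<forall>n. exact Z B k n i)"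

lemma admissible_le:
  assumes "admissible k Z B" "k \<le> k'" shows "admissible k' Z B"
  using assms(2,1) by (induction rule: dec_induct) (auto intro: admissible_Suc)

lemma exact_shift_range:
  assumes "admissible k Z B" "\<And>n. int n > N \<Longrightarrow> exact Z B k n i" "k \<le> k'" "int n > N"
  shows "exact Z B k' n i"
  using assms(3,4)
proof (induction arbitrary: n rule: dec_induct)
  case (step k')
  then show ?case
    using admissible_le[OF assms(1) step(1)] by (intro koszul_exact_shift) auto
qed (use assms(2) in auto)

text \<open>
  A nonzero class of the shift on the line \<open>n = i + \<rho>\<close> survives into all further shifts by
  \<open>koszul_exact_antisymmetrize\<close>, but these are eventually acyclic.
\<close>

lemma regularity_shift:
  assumes adm: "admissible k Z B" and ev: "eventually_exact Z B" and reg: "regularity_at_most Z B k \<rho>"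
  shows "regularity_at_most Z B (Suc k) (\<rho> - 1)"
  unfolding regularity_at_most_def
proof (intro allI impI)
  have R: "exact Z B k' n i" if "k' \<ge> k" "i \<ge> 1" "int n > i + \<rho>" for k' n i
    by (rule exact_shift_range[where N = "i + \<rho>", OF adm _ that(1,3)])
      (use reg that(2) in \<open>auto simp: regularity_at_most_def\<close>)
  fix i :: int and n assume i: "i \<ge> 1" and n: "int n > i + (\<rho> - 1)"
  obtain N where N: "\<And>k' n. k' \<ge> N \<Longrightarrow> exact Z B k' n i"
    using ev i by (auto simp: eventually_exact_def)
  show "exact Z B (Suc k) n i"
  proof (cases "int n = i + \<rho>")
    case True
    \<comment> \<open>A descending induction from an acyclic shift. Each step lifts through the
      antisymmetrization, whose other hypothesis holds since H_(i+1) on \<open>n + 2\<close> points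
      lies above the line given by \<rho>.\<close>
    have "exact Z B k' n i" if "k' \<le> max N (Suc k)" "k' > k" for k'
      using that
    proof (induction rule: inc_induct)
      case (step k')
      obtain k'' where k'': "k' = Suc k''" "k \<le> k''" using step by (cases k') auto
      have "exact Z B k'' (Suc (Suc n)) (i + 1)" using R[OF k''(2)] i True by auto
      moreover have "exact Z B (Suc k') n i" using step by auto
      ultimately show ?case
        using koszul_exact_antisymmetrize[OF admissible_le[OF adm k''(2)]] k'' by auto
    qed (use N[of "max N (Suc k)"] in auto)
    then show ?thesis by simp
  next
    case False
    show ?thesis by (rule R) (use n i False in auto)
  qed
qed

text \<open>Lifting from the shift replaces (i, \<rho>) by (i - 1, \<rho> - 1). This preserves
  \<open>i \<ge> \<rho>\<close> and leaves the range \<open>i \<ge> 1\<close> only for i = \<rho> =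
  1, where the bound by the relation degree takes over.\<close>

lemma slope_one_strand:
  assumes "admissible k Z B" "eventually_exact Z B" "regularity_at_most Z B k (int \<rho>)"
    and "\<And>n. int n > int g - 1 \<Longrightarrow> exact Z B k n 0"
    and "\<exists>i\<ge>1. \<not> exact Z B k (i + \<rho>) (int i)"
    and "i \<ge> 1" "i \<ge> \<rho>"
  shows "\<not> exact Z B k (i + \<rho>) (int i)"
  using assms
proof (induction \<rho> arbitrary: k i rule: less_induct)
  case (less \<rho>)
  note adm = less.prems(1) and ev = less.prems(2) and reg = less.prems(3) and t0 = less.prems(4)
  have reg1: "regularity_at_most Z B (Suc k) (int \<rho> - 1)"
    by (rule regularity_shift[OF adm ev reg])
  have reg2: "regularity_at_most Z B (Suc (Suc k)) (int \<rho> - 1 - 1)"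
    by (rule regularity_shift[OF admissible_Suc[OF adm] ev reg1])
  show ?case
  proof (cases "\<exists>j\<ge>1. \<rho> \<ge> 1 \<and> \<not> exact Z B (Suc k) (j + (\<rho> - 1)) (int j)")
    case False
    \<comment> \<open>The critical line of the shift is zero: by the case assumption if \<rho> is
      positive, and for \<rho> = 0 because the degree exceeds the number of points.\<close>
    have small: "exact Z B (Suc k) n (int j)" if "j \<ge> 1" "n + 1 = j + \<rho>" for j n
    proof (cases \<rho>)
      case 0
      then show ?thesis using that by (intro koszul_exact_trivial) auto
    next
      case (Suc \<rho>')
      then have "n = j + (\<rho> - 1)" using that by simp
      then show ?thesis using False that Suc by auto
    qed
    \<comment> \<open>On \<open>j + \<rho>\<close> points the shift vanishes in degree
      \<open>j + 1\<close> by \<open>small\<close> and in degree \<open>j\<close> by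
      \<open>reg1\<close>, so the connecting map between neighbouring groups on the line is an
      isomorphism.\<close>
    have step1: "exact Z B k (Suc (j + \<rho>)) (int j + 1) \<longleftrightarrow> exact Z B k (j + \<rho>) (int j)" if "j \<ge> 1" for j
    proof
      have *: "exact Z B (Suc k) (j + \<rho>) (int j + 1)"
        using small[of "Suc j" "j + \<rho>"] that by (simp add: add.commute)
      show "exact Z B k (j + \<rho>) (int j) \<Longrightarrow> exact Z B k (Suc (j + \<rho>)) (int j + 1)"
        by (rule koszul_exact_up[OF adm *])
      have *: "exact Z B (Suc k) (j + \<rho>) (int j)"
        by (rule reg1[unfolded regularity_at_most_def, rule_format]) (use that in auto)
      show "exact Z B k (Suc (j + \<rho>)) (int j + 1) \<Longrightarrow> exact Z B k (j + \<rho>) (int j)"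
        by (rule koszul_exact_down[OF adm _ *])
    qed
    have "exact Z B k (j + \<rho>) (int j) \<longleftrightarrow> exact Z B k (1 + \<rho>) (int 1)" if "j \<ge> 1" for j
      using that
    proof (induction rule: dec_induct)
      case (step j)
      with step1[of j] show ?case by (simp add: add.commute)
    qed simp
    with less.prems show ?thesis by blast
  next
    case True
    then have \<rho>: "\<rho> \<ge> 1" and ex: "\<exists>j\<ge>1. \<not> exact Z B (Suc k) (j + (\<rho> - 1)) (int j)" by auto
    show ?thesis
    proof (cases "i = 1")
      case True
      then have \<rho>1: "\<rho> = 1" using less.prems \<rho> by simp
      show ?thesis
      proof
        assume "exact Z B k (i + \<rho>) (int i)"
        \<comment> \<open>If H_1 vanished on 2 points as well, the relation degree would be at most
          1, and hence the regularity at most 0, against \<rho> = 1.\<close>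
        then have *: "exact Z B k n 1" if "n > Suc 0" for n
          using reg that True \<rho>1 by (cases "n = 2") (auto simp: regularity_at_most_def numeral_2_eq_2)
        have "exact Z B k (j + \<rho>) (int j)" if "j \<ge> 1" for j
          by (rule regularity_le_relations[OF adm t0 *]) (use that \<rho>1 in auto)
        with less.prems(5) show False by blast
      qed
    next
      case False
      then obtain i' where i': "i = Suc i'" "i' \<ge> 1" using less.prems by (cases i) auto
      obtain \<rho>' where \<rho>': "\<rho> = Suc \<rho>'" using \<rho> by (cases \<rho>) auto
      have 1: "\<not> exact Z B (Suc k) (i' + (\<rho> - 1)) (int i')"
      proof (rule less.IH[of "\<rho> - 1" "Suc k"])
        show "exact Z B (Suc k) n 0" if "int n > int g - 1" for n
          by (rule exact_shift_range[OF adm t0 _ that]) auto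
      qed (use \<rho> reg1 ex ev i' less.prems admissible_Suc[OF adm] in \<open>auto simp: of_nat_diff\<close>)
      \<comment> \<open>Shifting twice lowers the regularity bound by two, so the lifted class finds
        no obstruction in the second shift.\<close>
      have 2: "exact Z B (Suc (Suc k)) (i' + \<rho>') (int i')"
        by (rule reg2[unfolded regularity_at_most_def, rule_format]) (use \<rho>' i' in auto)
      have eq: "i + \<rho> = Suc (Suc (i' + \<rho>'))" "int i = int i' + 1" using i' \<rho>' by auto
      show ?thesis
      proof
        assume "exact Z B k (i + \<rho>) (int i)"
        then have "exact Z B k (Suc (Suc (i' + \<rho>'))) (int i' + 1)" by (simp only: eq)
        from koszul_exact_antisymmetrize[OF adm this 2] 1 \<rho>' show False by simp
      qed
    qed
  qed
qed

theorem regularity_attained: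
  assumes adm: "admissible 0 Z B" and ev: "eventually_exact Z B"
    and t0: "\<And>n. int n > g \<Longrightarrow> exact Z B 0 n 0" and t1: "\<And>n. int n > r \<Longrightarrow> exact Z B 0 n 1"
    and nonacyclic: "i0 \<ge> 1" "\<not> exact Z B 0 n0 (int i0)"
  obtains \<rho> :: nat where "int \<rho> \<le> g + r - 1" "int \<rho> \<le> 2 * r - 2" "r \<ge> 1"
    "\<And>i n. i \<ge> 1 \<Longrightarrow> n > i + \<rho> \<Longrightarrow> exact Z B 0 n (int i)"
    "\<And>i. i \<ge> 1 \<Longrightarrow> i \<ge> \<rho> \<Longrightarrow> \<not> exact Z B 0 (i + \<rho>) (int i)"
proof -
  define G where "G = nat (g + 1)"
  have t0': "exact Z B 0 n 0" if "int n > int G - 1" for n by (rule t0) (use that in \<open>simp add: G_def split: if_splits\<close>)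
  have low: "n \<ge> i" if "\<not> exact Z B 0 n (int i)" for n i
    using koszul_exact_trivial[of n "int i"] that by (meson not_less of_nat_less_iff)
  have r: "r \<ge> 1"
  proof (rule ccontr)
    assume "\<not> r \<ge> 1"
    then show False
      using acyclic_of_exact_1[where g = G and n = n0 and i = "int i0", OF adm t0' t1] nonacyclic by auto
  qed
  have g: "g \<ge> 0"
  proof (rule ccontr)
    assume "\<not> g \<ge> 0"
    then have "exact Z B 0 n 0" for n using t0 by auto
    from koszul_exact_zero[OF adm all_exact_0[OF adm this]] show False using nonacyclic by auto
  qed
  have bound1: "int n \<le> int i + (g + r - 1)" if "i \<ge> 1" "\<not> exact Z B 0 n (int i)" for i n
    using regularity_le[where g = G and r = r and i = "int i" and n = n, OF adm t0' t1, THEN conjunct1] that g by (auto simp: G_def not_less)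
  have bound2: "int n \<le> int i + (2 * r - 2)" if "i \<ge> 1" "\<not> exact Z B 0 n (int i)" for i n
  proof -
    have "exact Z B 0 n 1" if "n > Suc (nat (r - 1))" for n using t1 that r by auto
    from regularity_le_relations[where i = "int i" and n = n, OF adm t0' this] that show ?thesis using r by force
  qed
  \<comment> \<open>The offsets of nonzero groups. They are natural numbers because the degree never
    exceeds the number of points, and the relation bound makes them bounded; the largest one is the
    regularity.\<close>
  define P where "P \<rho> \<longleftrightarrow> (\<exists>i\<ge>1. \<not> exact Z B 0 (i + \<rho>) (int i))" for \<rho>
  have "n0 = i0 + (n0 - i0)" using low[OF nonacyclic(2)] by simp
  then have "P (n0 - i0)" using nonacyclic unfolding P_def by metis
  moreover have bd: "int \<rho> \<le> g + r - 1 \<and> int \<rho> \<le> 2 * r - 2" if P: "P \<rho>" for \<rho>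
  proof -
    obtain i where "i \<ge> 1" "\<not> exact Z B 0 (i + \<rho>) (int i)" using P by (auto simp: P_def)
    from bound1[OF this] bound2[OF this] show ?thesis by simp
  qed
  moreover from bd have "\<rho> \<le> nat (2 * r - 2)" if "P \<rho>" for \<rho>
    using that by fastforce
  ultimately obtain \<rho> where \<rho>: "P \<rho>" "\<And>\<rho>'. P \<rho>' \<Longrightarrow> \<rho>' \<le> \<rho>"
    using Greatest_le_nat[of P _ "nat (2 * r - 2)"] GreatestI_nat[of P _ "nat (2 * r - 2)"] by blast
  have above: "exact Z B 0 n (int i)" if "i \<ge> 1" "n > i + \<rho>" for i n
  proof (rule ccontr)
    assume *: "\<not> exact Z B 0 n (int i)"
    have "n = i + (n - i)" using that by simp
    then have "P (n - i)" unfolding P_def using that(1) * by metis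
    then show False using \<rho>(2) that by fastforce
  qed
  have "regularity_at_most Z B 0 (int \<rho>)"
    unfolding regularity_at_most_def
  proof (intro allI impI)
    fix i :: int and n assume "1 \<le> i" "i + int \<rho> < int n"
    then show "exact Z B 0 n i" using above[of "nat i" n] by auto
  qed
  then have strand: "\<not> exact Z B 0 (i + \<rho>) (int i)" if "i \<ge> 1" "i \<ge> \<rho>" for i
    using slope_one_strand[OF adm ev _ t0'] \<rho>(1) that unfolding P_def by blast
  show thesis by (rule that[OF _ _ r above strand]) (use bd[OF \<rho>(1)] in auto)
qed

end

section \<open>Subquotients and resolutions\<close>

lemma kchains_0: "c \<in> kchains b n 0 S \<longleftrightarrow> c (replicate n False) \<in> S (b + n)"
proof -
  have *: "length l = n \<and> count_list l True = 0 \<longleftrightarrow> l = replicate n False" for l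
  proof (induction l arbitrary: n)
    case (Cons x l)
    then show ?case by (cases n) auto
  qed auto
  have "count_list (replicate n False) False = n" by (induction n) auto
  moreover have "c \<in> kchains b n 0 S \<longleftrightarrow>
      (\<forall>l. length l = n \<and> count_list l True = 0 \<longrightarrow> c l \<in> S (b + count_list l False))"
    unfolding kchains_def by simp blast
  ultimately show ?thesis by (simp only: *) simp
qed

context insertions begin

text \<open>These sums are the degree-0 boundaries on \<open>n\<close> points; evaluated in an
  FI-module they become the elements coming from smaller sets.\<close>

definition insertion_span :: "nat \<Rightarrow> nat \<Rightarrow> (nat \<Rightarrow> 'a set) \<Rightarrow> nat \<Rightarrow> 'a set" where
  "insertion_span k b S n = {\<Sum>p<n. \<delta> (k + p) (a p) | a. \<forall>p<n. a p \<in> S (b + n - 1)}"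

lemma kd_replicate_False:
  "(\<lambda>c. kd \<delta> k c (replicate n False)) ` kchains b n 1 S = insertion_span k b S n"
proof (induction n arbitrary: k b)
  case 0
  have "(0 :: bool list \<Rightarrow> 'a) \<in> kchains b 0 1 S" by (simp add: kchains_def)
  then show ?case by (force simp: insertion_span_def)
next
  case (Suc n)
  show ?case
  proof (intro equalityI subsetI)
    fix x assume "x \<in> (\<lambda>c. kd \<delta> k c (replicate (Suc n) False)) ` kchains b (Suc n) 1 S"
    then obtain c where c: "c \<in> kchains b (Suc n) 1 S" and x: "x = kd \<delta> k c (replicate (Suc n) False)" by auto
    have "(\<lambda>l. c (False # l)) \<in> kchains (Suc b) n 1 S" using c by (simp add: chains_Suc)
    with Suc[of "Suc k" "Suc b"] have "kd \<delta> (Suc k) (\<lambda>l. c (False # l)) (replicate n False) \<in> insertion_span (Suc k) (Suc b) S n"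
      by blast
    then obtain a where a: "\<And>p. p < n \<Longrightarrow> a p \<in> S (b + n)"
      "kd \<delta> (Suc k) (\<lambda>l. c (False # l)) (replicate n False) = (\<Sum>p<n. \<delta> (Suc k + p) (a p))"
      by (auto simp: insertion_span_def)
    have "c (True # replicate n False) \<in> S (b + n)"
      using c by (simp add: chains_Suc kchains_0)
    then show "x \<in> insertion_span k b S (Suc n)"
      unfolding insertion_span_def
      by (intro CollectI exI[of _ "\<lambda>p. case p of 0 \<Rightarrow> c (True # replicate n False) | Suc p \<Rightarrow> a p"])
        (auto simp: x a sum.lessThan_Suc_shift add.commute split: nat.splits simp del: sum.lessThan_Suc)
  next
    fix x assume "x \<in> insertion_span k b S (Suc n)"
    then obtain a where a: "\<And>p. p < Suc n \<Longrightarrow> a p \<in> S (b + n)" and x: "x = (\<Sum>p<Suc n. \<delta> (k + p) (a p))"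
      by (auto simp: insertion_span_def)
    have "(\<Sum>p<n. \<delta> (Suc k + p) (a (Suc p))) \<in> insertion_span (Suc k) (Suc b) S n"
      unfolding insertion_span_def by (auto intro!: exI[of _ "\<lambda>p. a (Suc p)"] a)
    with Suc[of "Suc k" "Suc b"] obtain c where c: "c \<in> kchains (Suc b) n 1 S"
      "kd \<delta> (Suc k) c (replicate n False) = (\<Sum>p<n. \<delta> (Suc k + p) (a (Suc p)))" by force
    have "pair c (\<lambda>_. a 0) \<in> kchains b (Suc n) 1 S"
      using c a[of 0] by (simp add: pair_chains kchains_0)
    moreover have "kd \<delta> k (pair c (\<lambda>_. a 0)) (replicate (Suc n) False) = x"
      using c by (simp add: kd_pair x sum.lessThan_Suc_shift add.commute del: sum.lessThan_Suc)
    ultimately show "x \<in> (\<lambda>c. kd \<delta> k c (replicate (Suc n) False)) ` kchains b (Suc n) 1 S" by blast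
  qed
qed

lemma koszul_exact_0_iff:
  "koszul_exact \<delta> k b Z B n 0 \<longleftrightarrow> (\<forall>z\<in>Z (b + n). \<exists>x\<in>insertion_span k b Z n. z - x \<in> B (b + n))"
proof -
  have "koszul_exact \<delta> k b Z B n 0 \<longleftrightarrow>
      (\<forall>c\<in>kchains b n 0 Z. \<exists>e\<in>kchains b n 1 Z. c - kd \<delta> k e \<in> kchains b n 0 B)"
    by (simp add: koszul_exact_def chains_trivial)
  also have "\<dots> \<longleftrightarrow> (\<forall>c\<in>kchains b n 0 Z. \<exists>x\<in>insertion_span k b Z n. c (replicate n False) - x \<in> B (b + n))"
    unfolding kd_replicate_False[symmetric] by (simp add: kchains_0)
  also have "\<dots> \<longleftrightarrow> (\<forall>z\<in>Z (b + n). \<exists>x\<in>insertion_span k b Z n. z - x \<in> B (b + n))"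
  proof (intro iffI ballI)
    fix z assume *: "\<forall>c\<in>kchains b n 0 Z. \<exists>x\<in>insertion_span k b Z n. c (replicate n False) - x \<in> B (b + n)"
      and z: "z \<in> Z (b + n)"
    from bspec[OF *, of "\<lambda>_. z"] z show "\<exists>x\<in>insertion_span k b Z n. z - x \<in> B (b + n)"
      by (simp add: kchains_0)
  qed (simp add: kchains_0)
  finally show ?thesis .
qed

section \<open>Quotients of acyclic modules and dimension shifting\<close>

context
  fixes k b n Z N B
  assumes ZB: "admissible k Z B" and N: "stable k N" "\<And>m. B m \<subseteq> N m" "\<And>m. N m \<subseteq> Z m"
    and acyclic: "\<And>i. i \<ge> 1 \<Longrightarrow> koszul_exact \<delta> k b Z B n i"
begin

text \<open>In the sequence 0 -> N/B -> Z/B -> Z/N -> 0 the middle term has no homology in degree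
  \<open>i + 1\<close>, so H_(i+1)(Z/N) is the kernel of H_i(N/B) -> H_i(Z/B). The case
  \<open>i = 0\<close>, in which the last group may be nonzero, is the one that yields H_1.\<close>

lemma koszul_exact_quotient_iff:
  assumes i: "i \<ge> 0"
  shows "koszul_exact \<delta> k b Z N n (i + 1) \<longleftrightarrow>
    (\<forall>c\<in>kchains b n (i + 1) Z. kd \<delta> k c \<in> kchains b n i N \<longrightarrow>
      (\<exists>\<nu>\<in>kchains b n (i + 1) N. kd \<delta> k c - kd \<delta> k \<nu> \<in> kchains b n i B))" (is "?L \<longleftrightarrow> ?R")
proof -
  have st: "stable k Z" "stable k B" "stable k N" using ZB N by (auto simp: admissible_def)
  have sg: "add_subgroup (kchains b' n' i' Z)" "add_subgroup (kchains b' n' i' B)"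
    "add_subgroup (kchains b' n' i' N)" for b' n' i'
    using st by (auto intro!: chains_add_subgroup stable_add_subgroup)
  have sub: "c \<in> kchains b n i N" if "c \<in> kchains b n i B" for c i
    using that by (rule chains_mono) (use N in auto)
  have sub': "c \<in> kchains b n i Z" if "c \<in> kchains b n i N" for c i
    using that by (rule chains_mono) (use N in auto)
  show ?thesis
  proof
    assume L: ?L
    show ?R
    proof (intro ballI impI)
      fix c assume c: "c \<in> kchains b n (i + 1) Z" "kd \<delta> k c \<in> kchains b n i N"
      obtain e where e: "e \<in> kchains b n (i + 1 + 1) Z" "c - kd \<delta> k e \<in> kchains b n (i + 1) N"
        by (rule koszul_exactD[OF L c(1)]) (use c in simp)
      have "kd \<delta> k c - kd \<delta> k (c - kd \<delta> k e) = 0" by (simp add: kd_diff kd_kd)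
      then show "\<exists>\<nu>\<in>kchains b n (i + 1) N. kd \<delta> k c - kd \<delta> k \<nu> \<in> kchains b n i B"
        using e sg(2)[THEN add_subgroup_0] by metis
    qed
  next
    assume R: ?R
    show ?L
    proof (rule koszul_exactI)
      fix c assume c: "c \<in> kchains b n (i + 1) Z" "kd \<delta> k c \<in> kchains b n (i + 1 - 1) N"
      with R obtain \<nu> where \<nu>: "\<nu> \<in> kchains b n (i + 1) N" "kd \<delta> k (c - \<nu>) \<in> kchains b n (i + 1 - 1) B"
        by (auto simp: kd_diff)
      have "c - \<nu> \<in> kchains b n (i + 1) Z" using c \<nu> sg(1) sub' by (auto intro: add_subgroup_diff)
      from koszul_exactD[OF acyclic this \<nu>(2)] i obtain f where
        f: "f \<in> kchains b n (i + 1 + 1) Z" "c - \<nu> - kd \<delta> k f \<in> kchains b n (i + 1) B" by auto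
      have "\<nu> + (c - \<nu> - kd \<delta> k f) \<in> kchains b n (i + 1) N"
        using \<nu> f sub sg(3) by (blast intro: add_subgroup_add)
      then show "\<exists>e\<in>kchains b n (i + 1 + 1) Z. c - kd \<delta> k e \<in> kchains b n (i + 1) N"
        using f(1) by (intro bexI[of _ f]) auto
    qed
  qed
qed

lemma koszul_exact_dimension_shift:
  assumes i: "i \<ge> 1"
  shows "koszul_exact \<delta> k b Z N n (i + 1) \<longleftrightarrow> koszul_exact \<delta> k b N B n i"
proof -
  have st: "stable k Z" "stable k B" "stable k N" using ZB N by (auto simp: admissible_def)
  have sg: "add_subgroup (kchains b' n' i' Z)" "add_subgroup (kchains b' n' i' B)"
    "add_subgroup (kchains b' n' i' N)" for b' n' i'
    using st by (auto intro!: chains_add_subgroup stable_add_subgroup)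
  have sub: "c \<in> kchains b n i N" if "c \<in> kchains b n i B" for c i
    using that by (rule chains_mono) (use N in auto)
  have sub': "c \<in> kchains b n i Z" if "c \<in> kchains b n i N" for c i
    using that by (rule chains_mono) (use N in auto)
  have eq: "koszul_exact \<delta> k b Z N n (i + 1) \<longleftrightarrow>
    (\<forall>c\<in>kchains b n (i + 1) Z. kd \<delta> k c \<in> kchains b n i N \<longrightarrow>
      (\<exists>\<nu>\<in>kchains b n (i + 1) N. kd \<delta> k c - kd \<delta> k \<nu> \<in> kchains b n i B))"
    using i by (intro koszul_exact_quotient_iff) auto
  show ?thesis
    unfolding eq
  proof
    assume R: "\<forall>c\<in>kchains b n (i + 1) Z. kd \<delta> k c \<in> kchains b n i N \<longrightarrow>
      (\<exists>\<nu>\<in>kchains b n (i + 1) N. kd \<delta> k c - kd \<delta> k \<nu> \<in> kchains b n i B)"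
    show "koszul_exact \<delta> k b N B n i"
    proof (rule koszul_exactI)
      fix c assume c: "c \<in> kchains b n i N" "kd \<delta> k c \<in> kchains b n (i - 1) B"
      obtain f where f: "f \<in> kchains b n (i + 1) Z" "c - kd \<delta> k f \<in> kchains b n i B"
        by (rule koszul_exactD[OF acyclic[OF i] sub'[OF c(1)] c(2)])
      have "kd \<delta> k f \<in> kchains b n i N"
        using add_subgroup_diff[OF sg(3) c(1) sub[OF f(2)]] by simp
      with R f obtain \<nu> where \<nu>: "\<nu> \<in> kchains b n (i + 1) N" "kd \<delta> k f - kd \<delta> k \<nu> \<in> kchains b n i B" by blast
      have "c - kd \<delta> k \<nu> \<in> kchains b n i B"
        using add_subgroup_add[OF sg(2) f(2) \<nu>(2)] by simp
      with \<nu> show "\<exists>e\<in>kchains b n (i + 1) N. c - kd \<delta> k e \<in> kchains b n i B" by blast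
    qed
  next
    assume L: "koszul_exact \<delta> k b N B n i"
    show "\<forall>c\<in>kchains b n (i + 1) Z. kd \<delta> k c \<in> kchains b n i N \<longrightarrow>
      (\<exists>\<nu>\<in>kchains b n (i + 1) N. kd \<delta> k c - kd \<delta> k \<nu> \<in> kchains b n i B)"
    proof (intro ballI impI)
      fix c assume c: "c \<in> kchains b n (i + 1) Z" "kd \<delta> k c \<in> kchains b n i N"
      have "kd \<delta> k (kd \<delta> k c) \<in> kchains b n (i - 1) B" using sg(2) by (simp add: kd_kd add_subgroup_0)
      from koszul_exactD[OF L c(2) this] show
        "\<exists>\<nu>\<in>kchains b n (i + 1) N. kd \<delta> k c - kd \<delta> k \<nu> \<in> kchains b n i B" by blast
    qed
  qed
qed

lemma koszul_exact_1_iff: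
  "koszul_exact \<delta> k b Z N n 1 \<longleftrightarrow>
    (\<forall>x\<in>insertion_span k b Z n. x \<in> N (b + n) \<longrightarrow> (\<exists>y\<in>insertion_span k b N n. x - y \<in> B (b + n)))"
  using koszul_exact_quotient_iff[of 0] unfolding kd_replicate_False[symmetric]
  by (simp add: kchains_0)

end

section \<open>Regular sequences of insertions\<close>

fun iterated_cokernel :: "(nat \<Rightarrow> 'a set) \<Rightarrow> (nat \<Rightarrow> 'a set) \<Rightarrow> nat \<Rightarrow> nat \<Rightarrow> 'a set" where
  "iterated_cokernel Z B 0 = B"
| "iterated_cokernel Z B (Suc k) = cokernel k Z (iterated_cokernel Z B k)"

lemma admissible_iterated_cokernel: "admissible 0 Z B \<Longrightarrow> admissible k Z (iterated_cokernel Z B k)"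
  by (induction k) (auto intro: admissible_cokernel)

text \<open>Injectivity on each successive cokernel is the analogue of a regular sequence: no kernel
  contributes, and the cone on \<open>n + 1\<close> points is exact as soon as the complex of the
  next cokernel is exact on \<open>n\<close> points.\<close>

lemma acyclic_if_insertion_inj:
  assumes "admissible 0 Z B"
    and "\<And>k m. k \<le> m \<Longrightarrow> insertion_inj k Z (iterated_cokernel Z B k) m" and i: "i \<ge> 1"
  shows "koszul_exact \<delta> k k Z (iterated_cokernel Z B k) n i"
proof (induction n arbitrary: k)
  case 0
  show ?case using i by (intro koszul_exact_trivial) auto
next
  case (Suc n)
  show ?case
  proof (rule koszul_exact_of_cokernel[OF admissible_iterated_cokernel[OF assms(1)]])
    show "koszul_exact \<delta> (Suc k) (Suc k) Z (cokernel k Z (iterated_cokernel Z B k)) n i"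
      using Suc[of "Suc k"] by simp
  qed (rule assms(2))
qed

end

section \<open>Isomorphisms of subquotients\<close>

locale insertion_map = dom: insertions \<delta> s + cod: insertions \<delta>' s'
  for \<delta> s :: "nat \<Rightarrow> 'a::ab_group_add \<Rightarrow> 'a" and \<delta>' s' :: "nat \<Rightarrow> 'b::ab_group_add \<Rightarrow> 'b" +
  fixes f :: "'a \<Rightarrow> 'b"
  assumes f_diff: "f (x - y) = f x - f y" and f_\<delta>: "\<delta>' j (f x) = f (\<delta> j x)"
begin

lemma f_minus: "f (- x) = - f x"
  using f_diff[of 0 x] f_diff[of 0 0] by simp

lemma f_add: "f (x + y) = f x + f y"
  using f_diff[of x "- y"] by (simp add: f_minus)

lemma kd_f: "kd \<delta>' k (f \<circ> c) = f \<circ> kd \<delta> k c"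
proof
  fix l show "kd \<delta>' k (f \<circ> c) l = (f \<circ> kd \<delta> k c) l"
  proof (induction l arbitrary: k c)
    case Nil
    then show ?case using f_diff[of 0 0] by simp
  next
    case (Cons x l)
    then show ?case by (cases x) (auto simp: f_add f_minus f_\<delta> comp_def)
  qed
qed

text \<open>The assumptions make \<open>f\<close> an isomorphism from Z/B to Z'/B'. Chains lift one
  coefficient at a time, since the coefficients of a chain are independent of each other.\<close>

lemma koszul_exact_iso:
  assumes Z: "\<And>m x. x \<in> Z m \<Longrightarrow> f x \<in> Z' m"
    and surj: "\<And>m y. y \<in> Z' m \<Longrightarrow> \<exists>x\<in>Z m. y - f x \<in> B' m"
    and B: "\<And>m x. x \<in> Z m \<Longrightarrow> f x \<in> B' m \<longleftrightarrow> x \<in> B m"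
    and adm: "dom.admissible k Z B" "cod.admissible k Z' B'"
  shows "koszul_exact \<delta> k b Z B n i \<longleftrightarrow> koszul_exact \<delta>' k b Z' B' n i"
proof -
  have stZ: "dom.stable k Z" and stZ': "cod.stable k Z'" and stB': "cod.stable k B'"
    using adm by (auto simp: dom.admissible_def cod.admissible_def)
  have sgZ: "add_subgroup (kchains b' n' i' Z)" and sgB: "add_subgroup (kchains b' n' i' B')" for b' n' i'
    using stZ stB' by (auto intro!: chains_add_subgroup dom.stable_add_subgroup cod.stable_add_subgroup)
  have fZ: "f \<circ> c \<in> kchains b n i Z'" if "c \<in> kchains b n i Z" for c i
    using that Z by (auto simp: kchains_def)
  have fB: "f \<circ> c \<in> kchains b n i B' \<longleftrightarrow> c \<in> kchains b n i B" if "c \<in> kchains b n i Z" for c i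
    using that B by (auto simp: kchains_def)
  have lift: "\<exists>c'\<in>kchains b n i Z. c - (f \<circ> c') \<in> kchains b n i B'" if c: "c \<in> kchains b n i Z'" for c i
  proof -
    have "\<exists>x. length l = n \<longrightarrow> int (count_list l True) = i \<longrightarrow>
        x \<in> Z (b + count_list l False) \<and> c l - f x \<in> B' (b + count_list l False)" for l
      using c surj by (fastforce simp: kchains_def)
    then obtain c' where "length l = n \<longrightarrow> int (count_list l True) = i \<longrightarrow>
        c' l \<in> Z (b + count_list l False) \<and> c l - f (c' l) \<in> B' (b + count_list l False)" for l
      by metis
    then show ?thesis by (intro bexI[of _ c']) (auto simp: kchains_def)
  qed
  have f_comp_diff: "f \<circ> (c - c') = (f \<circ> c) - (f \<circ> c')" for c c'
    by (simp add: fun_eq_iff f_diff)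
  have kdZ: "kd \<delta> k c \<in> kchains b n (i - 1) Z" if "c \<in> kchains b n i Z" for c i
    using dom.kd_chains[OF stZ that] .
  show ?thesis
  proof
    assume L: "koszul_exact \<delta> k b Z B n i"
    show "koszul_exact \<delta>' k b Z' B' n i"
    proof (rule cod.koszul_exactI)
      fix c assume c: "c \<in> kchains b n i Z'" "kd \<delta>' k c \<in> kchains b n (i - 1) B'"
      obtain c' where c': "c' \<in> kchains b n i Z" "c - (f \<circ> c') \<in> kchains b n i B'" using lift[OF c(1)] by blast
      from cod.kd_chains[OF stB' c'(2)] have "kd \<delta>' k c - (f \<circ> kd \<delta> k c') \<in> kchains b n (i - 1) B'"
        by (simp add: cod.kd_diff kd_f)
      then have "f \<circ> kd \<delta> k c' \<in> kchains b n (i - 1) B'"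
        using c(2) add_subgroup_cong[OF sgB] by blast
      then have "kd \<delta> k c' \<in> kchains b n (i - 1) B" using fB[OF kdZ[OF c'(1)]] by simp
      from dom.koszul_exactD[OF L c'(1) this] obtain e where
        e: "e \<in> kchains b n (i + 1) Z" "c' - kd \<delta> k e \<in> kchains b n i B" .
      have "kd \<delta> k e \<in> kchains b n i Z" using kdZ[OF e(1)] by simp
      then have "c' - kd \<delta> k e \<in> kchains b n i Z" using c'(1) sgZ by (auto intro: add_subgroup_diff)
      from fB[OF this] e(2) have "(f \<circ> c') - kd \<delta>' k (f \<circ> e) \<in> kchains b n i B'" by (simp add: f_comp_diff kd_f)
      from add_subgroup_add[OF sgB c'(2) this]
      show "\<exists>e\<in>kchains b n (i + 1) Z'. c - kd \<delta>' k e \<in> kchains b n i B'"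
        using fZ[OF e(1)] by (intro bexI[of _ "f \<circ> e"]) auto
    qed
  next
    assume L: "koszul_exact \<delta>' k b Z' B' n i"
    show "koszul_exact \<delta> k b Z B n i"
    proof (rule dom.koszul_exactI)
      fix c assume c: "c \<in> kchains b n i Z" "kd \<delta> k c \<in> kchains b n (i - 1) B"
      then have "kd \<delta>' k (f \<circ> c) \<in> kchains b n (i - 1) B'"
        using fB[OF kdZ[OF c(1)]] by (simp add: kd_f)
      from cod.koszul_exactD[OF L fZ[OF c(1)] this] obtain e where
        e: "e \<in> kchains b n (i + 1) Z'" "(f \<circ> c) - kd \<delta>' k e \<in> kchains b n i B'" .
      obtain e' where e': "e' \<in> kchains b n (i + 1) Z" "e - (f \<circ> e') \<in> kchains b n (i + 1) B'"
        using lift[OF e(1)] by blast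
      from cod.kd_chains[OF stB' e'(2)] have "kd \<delta>' k e - (f \<circ> kd \<delta> k e') \<in> kchains b n i B'"
        by (simp add: cod.kd_diff kd_f)
      from add_subgroup_add[OF sgB e(2) this] have *: "f \<circ> (c - kd \<delta> k e') \<in> kchains b n i B'"
        by (simp add: f_comp_diff)
      have "kd \<delta> k e' \<in> kchains b n i Z" using kdZ[OF e'(1)] by simp
      then have "c - kd \<delta> k e' \<in> kchains b n i Z" using c(1) sgZ by (auto intro: add_subgroup_diff)
      from fB[OF this] * e'(1) show "\<exists>e\<in>kchains b n (i + 1) Z. c - kd \<delta> k e \<in> kchains b n i B" by blast
    qed
  qed
qed

end

section \<open>From FI-modules to insertion operators\<close>

definition skip :: "nat \<Rightarrow> nat \<Rightarrow> nat \<Rightarrow> nat" where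
  "skip j n = (\<lambda>x\<in>{..<n}. if x < j then x else Suc x)"

definition swap_adj :: "nat \<Rightarrow> nat \<Rightarrow> nat \<Rightarrow> nat" where
  "swap_adj j n = (\<lambda>x\<in>{..<n}. if x = j then Suc j else if x = Suc j then j else x)"

lemma skip_hom: "skip j n \<in> FI_hom {..<n} {..<Suc n}"
  by (auto simp: skip_def FI_hom_def inj_on_def split: if_splits)

lemma swap_adj_hom: "Suc j < n \<Longrightarrow> swap_adj j n \<in> FI_hom {..<n} {..<n}"
  by (auto simp: swap_adj_def FI_hom_def inj_on_def split: if_splits)

lemma skip_skip: "i \<le> j \<Longrightarrow> j \<le> n \<Longrightarrow>
    compose {..<n} (skip (Suc j) (Suc n)) (skip i n) = compose {..<n} (skip i (Suc n)) (skip j n)"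
  by (auto simp: skip_def compose_def fun_eq_iff restrict_def)

lemma swap_skip: "j < n \<Longrightarrow> compose {..<n} (swap_adj j (Suc n)) (skip j n) = skip (Suc j) n"
  and swap_skip': "j < n \<Longrightarrow> compose {..<n} (swap_adj j (Suc n)) (skip (Suc j) n) = skip j n"
  by (auto simp: skip_def swap_adj_def compose_def fun_eq_iff restrict_def)

lemma swap_Suc_skip: "i \<le> j \<Longrightarrow> Suc j < n \<Longrightarrow>
    compose {..<n} (swap_adj (Suc j) (Suc n)) (skip i n) = compose {..<n} (skip i n) (swap_adj j n)"
  and swap_skip_greater: "Suc j < i \<Longrightarrow> i \<le> n \<Longrightarrow>
    compose {..<n} (swap_adj j (Suc n)) (skip i n) = compose {..<n} (skip i n) (swap_adj j n)"
  by (auto simp: skip_def swap_adj_def compose_def fun_eq_iff restrict_def)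

text \<open>
  The values of an FI-module at the sets \<open>{..<n}\<close> are presented as quotients of one abelian group,
  the free one on pairs \<open>(n, x)\<close> with \<open>x\<close> a value at \<open>{..<n}\<close>. A family of morphisms defined for the
  levels \<open>n\<close> with \<open>p n\<close> acts on it by permuting generators, all others being sent to \<open>0\<close>; in this way
  the simplicial identities hold without side conditions.
\<close>

type_synonym 'm level_frag = "(nat \<times> 'm) \<Rightarrow>\<^sub>0 int"

definition frag_act :: "('r, 'm) FI_mod \<Rightarrow> (nat \<Rightarrow> bool) \<Rightarrow> (nat \<Rightarrow> nat) \<Rightarrow> (nat \<Rightarrow> nat \<Rightarrow> nat)
    \<Rightarrow> 'm level_frag \<Rightarrow> 'm level_frag" where
  "frag_act V p t g = frag_extend (\<lambda>(n, x). if p n \<and> x \<in> carrier (obj V {..<n})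
     then frag_of (t n, mor V {..<n} {..<t n} (g n) x) else 0)"

definition ins :: "('r, 'm) FI_mod \<Rightarrow> nat \<Rightarrow> 'm level_frag \<Rightarrow> 'm level_frag" where
  "ins V j = frag_act V (\<lambda>n. j \<le> n) Suc (skip j)"

definition transp :: "('r, 'm) FI_mod \<Rightarrow> nat \<Rightarrow> 'm level_frag \<Rightarrow> 'm level_frag" where
  "transp V j = frag_act V (\<lambda>n. Suc j < n) (\<lambda>n. n) (swap_adj j)"

text \<open>Positions are counted from the other end. This system serves for the acyclicity of high
  shifts, where the new points have to stand behind.\<close>

definition ins_rev :: "('r, 'm) FI_mod \<Rightarrow> nat \<Rightarrow> 'm level_frag \<Rightarrow> 'm level_frag" where
  "ins_rev V j = frag_act V (\<lambda>n. j \<le> n) Suc (\<lambda>n. skip (n - j) n)"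

definition transp_rev :: "('r, 'm) FI_mod \<Rightarrow> nat \<Rightarrow> 'm level_frag \<Rightarrow> 'm level_frag" where
  "transp_rev V j = frag_act V (\<lambda>n. Suc j < n) (\<lambda>n. n) (\<lambda>n. swap_adj (n - 2 - j) n)"

text \<open>The homomorphism given by the universal property of the free group at level
  \<open>n\<close>; it is determined on elements supported at that level.\<close>

definition evaluate :: "('r, 'm) FI_mod \<Rightarrow> nat \<Rightarrow> 'm level_frag \<Rightarrow> 'm" where
  "evaluate V n = (SOME h. h \<in> hom (free_Abelian_group ({n} \<times> carrier (obj V {..<n}))) (add_monoid (obj V {..<n}))
     \<and> (\<forall>x\<in>carrier (obj V {..<n}). h (frag_of (n, x)) = x))"

text \<open>The family of all values modulo the family of zero values recovers the FI-module at
  \<open>{..<n}\<close>; passing to a submodule or a quotient only changes \<open>K\<close>.\<close>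

definition level_family :: "('r, 'm) FI_mod \<Rightarrow> (nat set \<Rightarrow> 'm set) \<Rightarrow> nat \<Rightarrow> 'm level_frag set" where
  "level_family V K n =
     {a. Poly_Mapping.keys a \<subseteq> {n} \<times> carrier (obj V {..<n}) \<and> evaluate V n a \<in> K {..<n}}"

inductive_set image_span :: "('r, 'm) FI_mod \<Rightarrow> (nat set \<Rightarrow> 'm set) \<Rightarrow> nat set \<Rightarrow> 'm set"
  for V K S where
    zero: "\<zero>\<^bsub>obj V S\<^esub> \<in> image_span V K S"
  | add: "\<lbrakk>x \<in> image_span V K S; finite A; card A < card S; f \<in> FI_hom A S; v \<in> K A\<rbrakk>
      \<Longrightarrow> x \<oplus>\<^bsub>obj V S\<^esub> mor V A S f v \<in> image_span V K S"

lemma frag_act_diff: "frag_act V p t g (a - b) = frag_act V p t g a - frag_act V p t g b"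
  by (simp add: frag_act_def frag_extend_diff)

lemma frag_act_of: "frag_act V p t g (frag_of (n, x)) =
    (if p n \<and> x \<in> carrier (obj V {..<n}) then frag_of (t n, mor V {..<n} {..<t n} (g n) x) else 0)"
  by (simp add: frag_act_def)

lemma additive_frag_eqI:
  assumes "\<And>a b. F (a - b) = F a - F b" "\<And>a b. G (a - b) = G a - G b"
    and "\<And>n x. F (frag_of (n, x)) = G (frag_of (n, x))"
  shows "F (a :: 'm level_frag) = (G a :: 'b::ab_group_add)"
proof -
  have "F 0 = 0" "G 0 = 0" using assms(1)[of 0 0] assms(2)[of 0 0] by auto
  with assms show ?thesis
    by (induction a rule: frag_induction[OF subset_UNIV]) auto
qed

lemma additive_map_zero_minus:
  assumes G: "abelian_group G" and H: "abelian_group H"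
    and closed: "\<And>x. x \<in> carrier G \<Longrightarrow> f x \<in> carrier H"
    and add: "\<And>x y. x \<in> carrier G \<Longrightarrow> y \<in> carrier G \<Longrightarrow> f (x \<oplus>\<^bsub>G\<^esub> y) = f x \<oplus>\<^bsub>H\<^esub> f y"
  shows "f \<zero>\<^bsub>G\<^esub> = \<zero>\<^bsub>H\<^esub>"
    and "x \<in> carrier G \<Longrightarrow> y \<in> carrier G \<Longrightarrow> f (x \<ominus>\<^bsub>G\<^esub> y) = f x \<ominus>\<^bsub>H\<^esub> f y"
proof -
  interpret A: abelian_group G by (rule G)
  interpret B: abelian_group H by (rule H)
  show "f \<zero>\<^bsub>G\<^esub> = \<zero>\<^bsub>H\<^esub>"
    using add[of "\<zero>\<^bsub>G\<^esub>" "\<zero>\<^bsub>G\<^esub>"] closed[of "\<zero>\<^bsub>G\<^esub>"] by (simp add: B.add.r_cancel_one)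
  assume xy: "x \<in> carrier G" "y \<in> carrier G"
  have "f ((x \<ominus>\<^bsub>G\<^esub> y) \<oplus>\<^bsub>G\<^esub> y) = f (x \<ominus>\<^bsub>G\<^esub> y) \<oplus>\<^bsub>H\<^esub> f y" using xy by (intro add) auto
  moreover have "(x \<ominus>\<^bsub>G\<^esub> y) \<oplus>\<^bsub>G\<^esub> y = x" using xy by (simp add: A.minus_eq A.a_assoc A.l_neg)
  moreover have "f (x \<ominus>\<^bsub>G\<^esub> y) \<in> carrier H" "f y \<in> carrier H" using xy by (auto intro: closed)
  ultimately show "f (x \<ominus>\<^bsub>G\<^esub> y) = f x \<ominus>\<^bsub>H\<^esub> f y" by (simp add: B.minus_eq B.a_assoc B.r_neg)
qed

definition FI_hom_family :: "(nat \<Rightarrow> bool) \<Rightarrow> (nat \<Rightarrow> nat) \<Rightarrow> (nat \<Rightarrow> nat \<Rightarrow> nat) \<Rightarrow> bool" where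
  "FI_hom_family p t g \<longleftrightarrow> (\<forall>n. p n \<longrightarrow> g n \<in> FI_hom {..<n} {..<t n})"

section \<open>Simplicial identities and evaluation\<close>

context FI_module begin

lemma abelian: "finite S \<Longrightarrow> abelian_group (obj V S)"
  using obj_module[of S] by (simp add: Module.module_def)

lemma frag_act_comp:
  assumes "FI_hom_family p t g" "FI_hom_family p' t' g'"
  shows "frag_act V p' t' g' (frag_act V p t g a) =
    frag_act V (\<lambda>n. p n \<and> p' (t n)) (t' \<circ> t) (\<lambda>n. compose {..<n} (g' (t n)) (g n)) a"
proof (rule additive_frag_eqI[where F = "\<lambda>a. frag_act V p' t' g' (frag_act V p t g a)"])
  fix n x show "frag_act V p' t' g' (frag_act V p t g (frag_of (n, x))) =
      frag_act V (\<lambda>n. p n \<and> p' (t n)) (t' \<circ> t) (\<lambda>n. compose {..<n} (g' (t n)) (g n)) (frag_of (n, x))"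
    using assms mor_closed[of "{..<n}" "{..<t n}" "g n" x]
      mor_comp[of "{..<n}" "{..<t n}" "{..<t' (t n)}" "g n" "g' (t n)" x]
    by (auto simp: frag_act_of FI_hom_family_def frag_act_def)
qed (simp_all add: frag_act_diff)

lemma frag_act_cong:
  "p = p' \<Longrightarrow> t = t' \<Longrightarrow> (\<And>n. p n \<Longrightarrow> g n = g' n) \<Longrightarrow> frag_act V p t g = frag_act V p' t' g'"
  unfolding frag_act_def by (intro arg_cong[where f = frag_extend] ext) (clarsimp split del: if_split cong: if_cong)

lemma insertions_ins: "insertions (ins V) (transp V)"
proof
  have fam: "FI_hom_family (\<lambda>n. j \<le> n) Suc (skip j)" "FI_hom_family (\<lambda>n. Suc j < n) (\<lambda>n. n) (swap_adj j)" for j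
    using skip_hom swap_adj_hom by (auto simp: FI_hom_family_def)
  fix i j :: nat and x y :: "'m level_frag"
  show "ins V j (x - y) = ins V j x - ins V j y" "transp V j (x - y) = transp V j x - transp V j y"
    by (simp_all add: ins_def transp_def frag_act_diff)
  show "transp V j (ins V j x) = ins V (Suc j) x"
    unfolding ins_def transp_def frag_act_comp[OF fam(1) fam(2)]
    by (rule fun_cong[OF frag_act_cong]) (auto simp: swap_skip fun_eq_iff)
  assume ij: "i \<le> j"
  show "ins V (Suc j) (ins V i x) = ins V i (ins V j x)"
    unfolding ins_def frag_act_comp[OF fam(1) fam(1)]
    by (rule fun_cong[OF frag_act_cong]) (use ij in \<open>auto simp: skip_skip fun_eq_iff\<close>)
  show "transp V (Suc j) (ins V i x) = ins V i (transp V j x)"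
    unfolding ins_def transp_def frag_act_comp[OF fam(1) fam(2)] frag_act_comp[OF fam(2) fam(1)]
    by (rule fun_cong[OF frag_act_cong]) (use ij in \<open>auto simp: swap_Suc_skip fun_eq_iff\<close>)
qed

text \<open>Counted from the end, the adjacent pair \<open>j\<close>, \<open>Suc j\<close> in a set
  of \<open>n\<close> elements begins at \<open>n - 2 - j\<close>, and the next position skips a
  smaller value. Hence the mirrored identities \<open>swap_skip'\<close> and
  \<open>swap_skip_greater\<close>.\<close>

lemma insertions_ins_rev: "insertions (ins_rev V) (transp_rev V)"
proof
  have fam: "FI_hom_family (\<lambda>n. j \<le> n) Suc (\<lambda>n. skip (n - j) n)"
      "FI_hom_family (\<lambda>n. Suc j < n) (\<lambda>n. n) (\<lambda>n. swap_adj (n - 2 - j) n)" for j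
    using skip_hom swap_adj_hom by (auto simp: FI_hom_family_def)
  fix i j :: nat and x y :: "'m level_frag"
  show "ins_rev V j (x - y) = ins_rev V j x - ins_rev V j y"
    "transp_rev V j (x - y) = transp_rev V j x - transp_rev V j y"
    by (simp_all add: ins_rev_def transp_rev_def frag_act_diff)
  have 1: "compose {..<n} (swap_adj (Suc n - 2 - j) (Suc n)) (skip (n - j) n) = skip (n - Suc j) n" if "Suc j \<le> n" for n
    using swap_skip'[of "n - Suc j" n] that by (simp add: Suc_diff_Suc Suc_diff_le numeral_2_eq_2)
  show "transp_rev V j (ins_rev V j x) = ins_rev V (Suc j) x"
    unfolding ins_rev_def transp_rev_def frag_act_comp[OF fam(1) fam(2)]
    by (rule fun_cong[OF frag_act_cong]) (use 1 in \<open>auto simp: fun_eq_iff\<close>)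
  assume ij: "i \<le> j"
  have 2: "compose {..<n} (skip (Suc n - Suc j) (Suc n)) (skip (n - i) n) =
      compose {..<n} (skip (Suc n - i) (Suc n)) (skip (n - j) n)" if "j \<le> n" for n
    using skip_skip[of "n - j" "n - i" n] that ij by (simp add: Suc_diff_le)
  show "ins_rev V (Suc j) (ins_rev V i x) = ins_rev V i (ins_rev V j x)"
    unfolding ins_rev_def frag_act_comp[OF fam(1) fam(1)]
    by (rule fun_cong[OF frag_act_cong]) (use ij 2 in \<open>auto simp: fun_eq_iff\<close>)
  have 3: "compose {..<n} (swap_adj (Suc n - 2 - Suc j) (Suc n)) (skip (n - i) n) =
      compose {..<n} (skip (n - i) n) (swap_adj (n - 2 - j) n)" if "Suc j < n" for n
    using swap_skip_greater[of "n - 2 - j" "n - i" n] that ij by (simp add: numeral_2_eq_2)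
  show "transp_rev V (Suc j) (ins_rev V i x) = ins_rev V i (transp_rev V j x)"
    unfolding ins_rev_def transp_rev_def frag_act_comp[OF fam(1) fam(2)] frag_act_comp[OF fam(2) fam(1)]
    by (rule fun_cong[OF frag_act_cong]) (use ij 3 in \<open>auto simp: fun_eq_iff\<close>)
qed

lemma evaluate:
  "evaluate V n \<in> hom (free_Abelian_group ({n} \<times> carrier (obj V {..<n}))) (add_monoid (obj V {..<n}))"
  "x \<in> carrier (obj V {..<n}) \<Longrightarrow> evaluate V n (frag_of (n, x)) = x"
proof -
  interpret comm_group "add_monoid (obj V {..<n})"
    using abelian_group.a_comm_group[OF abelian[of "{..<n}"]] by simp
  obtain h where "h \<in> hom (free_Abelian_group ({n} \<times> carrier (obj V {..<n}))) (add_monoid (obj V {..<n}))"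
    "\<And>y. y \<in> {n} \<times> carrier (obj V {..<n}) \<Longrightarrow> h (frag_of y) = snd y"
    using free_Abelian_group_universal[of snd "{n} \<times> carrier (obj V {..<n})"] by auto
  then have *: "\<exists>h. h \<in> hom (free_Abelian_group ({n} \<times> carrier (obj V {..<n}))) (add_monoid (obj V {..<n}))
     \<and> (\<forall>x\<in>carrier (obj V {..<n}). h (frag_of (n, x)) = x)" by auto
  from someI_ex[OF this] show
    "evaluate V n \<in> hom (free_Abelian_group ({n} \<times> carrier (obj V {..<n}))) (add_monoid (obj V {..<n}))"
    "x \<in> carrier (obj V {..<n}) \<Longrightarrow> evaluate V n (frag_of (n, x)) = x"
    unfolding evaluate_def by auto
qed

lemma evaluate_closed:
  "Poly_Mapping.keys a \<subseteq> {n} \<times> carrier (obj V {..<n}) \<Longrightarrow> evaluate V n a \<in> carrier (obj V {..<n})"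
  using evaluate(1)[of n] by (auto simp: hom_def Pi_def)

lemma evaluate_diff:
  assumes "Poly_Mapping.keys a \<subseteq> {n} \<times> carrier (obj V {..<n})" "Poly_Mapping.keys b \<subseteq> {n} \<times> carrier (obj V {..<n})"
  shows "evaluate V n (a - b) = evaluate V n a \<ominus>\<^bsub>obj V {..<n}\<^esub> evaluate V n b"
proof -
  interpret A: abelian_group "obj V {..<n}" by (rule abelian) simp
  have k: "Poly_Mapping.keys (a - b) \<subseteq> {n} \<times> carrier (obj V {..<n})"
    using assms keys_diff[of a b] by (simp add: order_trans[OF _ Un_least])
  have "evaluate V n ((a - b) + b) = evaluate V n (a - b) \<oplus>\<^bsub>obj V {..<n}\<^esub> evaluate V n b"
    using hom_mult[OF evaluate(1)[of n], of "a - b" b] k assms by simp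
  then show ?thesis using evaluate_closed[OF k] evaluate_closed[OF assms(1)] evaluate_closed[OF assms(2)]
    by (simp add: A.minus_eq A.a_assoc A.r_neg)
qed

lemma mor_zero: "finite S \<Longrightarrow> finite T \<Longrightarrow> f \<in> FI_hom S T \<Longrightarrow> mor V S T f \<zero>\<^bsub>obj V S\<^esub> = \<zero>\<^bsub>obj V T\<^esub>"
  by (rule additive_map_zero_minus(1)[OF abelian abelian mor_closed mor_add])

lemma mor_diff:
  assumes "finite S" "finite T" "f \<in> FI_hom S T" "x \<in> carrier (obj V S)" "y \<in> carrier (obj V S)"
  shows "mor V S T f (x \<ominus>\<^bsub>obj V S\<^esub> y) = mor V S T f x \<ominus>\<^bsub>obj V T\<^esub> mor V S T f y"
  using assms by (intro additive_map_zero_minus(2)[OF abelian abelian mor_closed mor_add])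

lemma evaluate_0: "evaluate V m 0 = \<zero>\<^bsub>obj V {..<m}\<^esub>"
proof -
  interpret B: abelian_group "obj V {..<m}" by (rule abelian) simp
  show ?thesis using evaluate_diff[of 0 m 0] evaluate_closed[of 0 m] by (simp add: B.minus_eq B.r_neg)
qed

lemma frag_act_level:
  assumes "FI_hom_family p t g" "Poly_Mapping.keys a \<subseteq> {n} \<times> carrier (obj V {..<n})"
  shows "Poly_Mapping.keys (frag_act V p t g a) \<subseteq> {t n} \<times> carrier (obj V {..<t n})"
    and "p n \<Longrightarrow> evaluate V (t n) (frag_act V p t g a) = mor V {..<n} {..<t n} (g n) (evaluate V n a)"
    and "\<not> p n \<Longrightarrow> frag_act V p t g a = 0"
proof -
  have *: "Poly_Mapping.keys (frag_act V p t g a) \<subseteq> {t n} \<times> carrier (obj V {..<t n}) \<and>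
      (p n \<longrightarrow> evaluate V (t n) (frag_act V p t g a) = mor V {..<n} {..<t n} (g n) (evaluate V n a)) \<and>
      (\<not> p n \<longrightarrow> frag_act V p t g a = 0)"
  proof (rule free_Abelian_group_induct[OF assms(2)], goal_cases)
    case 1
    have "frag_act V p t g 0 = 0" by (simp add: frag_act_def)
    moreover have "mor V {..<n} {..<t n} (g n) \<zero>\<^bsub>obj V {..<n}\<^esub> = \<zero>\<^bsub>obj V {..<t n}\<^esub>" if "p n"
      by (rule mor_zero) (use that assms(1) in \<open>auto simp: FI_hom_family_def\<close>)
    ultimately show ?case by (auto simp: evaluate_0)
  next
    case (2 x y)
    then have "Poly_Mapping.keys (frag_act V p t g x - frag_act V p t g y) \<subseteq> {t n} \<times> carrier (obj V {..<t n})"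
      using keys_diff[of "frag_act V p t g x" "frag_act V p t g y"] by (simp add: order_trans[OF _ Un_least])
    moreover have "evaluate V (t n) (frag_act V p t g (x - y)) = mor V {..<n} {..<t n} (g n) (evaluate V n (x - y))" if "p n"
      using 2 that assms(1) evaluate_closed[of x n] evaluate_closed[of y n]
      by (simp add: frag_act_diff evaluate_diff mor_diff FI_hom_family_def)
    ultimately show ?case using 2 by (simp add: frag_act_diff)
  next
    case (3 x)
    then obtain y where y: "x = (n, y)" "y \<in> carrier (obj V {..<n})" by auto
    show ?case
      using assms(1) y mor_closed[of "{..<n}" "{..<t n}" "g n" y]
      by (auto simp: frag_act_of evaluate(2) FI_hom_family_def)
  qed
  from * show "Poly_Mapping.keys (frag_act V p t g a) \<subseteq> {t n} \<times> carrier (obj V {..<t n})"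
    "p n \<Longrightarrow> evaluate V (t n) (frag_act V p t g a) = mor V {..<n} {..<t n} (g n) (evaluate V n a)"
    "\<not> p n \<Longrightarrow> frag_act V p t g a = 0" by auto
qed

text \<open>Subobjects are taken in abelian groups because exactness of the cube concerns the
  additive structure; closure under scalars is imposed as \<open>K_smult\<close> where free
  extensions are built.\<close>

definition FI_subgroup :: "(nat set \<Rightarrow> 'm set) \<Rightarrow> bool" where
  "FI_subgroup K \<longleftrightarrow> (\<forall>S. finite S \<longrightarrow> K S \<subseteq> carrier (obj V S) \<and> \<zero>\<^bsub>obj V S\<^esub> \<in> K S \<and>
      (\<forall>x\<in>K S. \<forall>y\<in>K S. x \<ominus>\<^bsub>obj V S\<^esub> y \<in> K S)) \<and>
    (\<forall>S T f x. finite S \<longrightarrow> finite T \<longrightarrow> f \<in> FI_hom S T \<longrightarrow> x \<in> K S \<longrightarrow> mor V S T f x \<in> K T)"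

lemma FI_subgroupD:
  assumes "FI_subgroup K" "finite S"
  shows "x \<in> K S \<Longrightarrow> x \<in> carrier (obj V S)" "\<zero>\<^bsub>obj V S\<^esub> \<in> K S"
    "x \<in> K S \<Longrightarrow> y \<in> K S \<Longrightarrow> x \<ominus>\<^bsub>obj V S\<^esub> y \<in> K S"
    "finite T \<Longrightarrow> f \<in> FI_hom S T \<Longrightarrow> x \<in> K S \<Longrightarrow> mor V S T f x \<in> K T"
  using assms unfolding FI_subgroup_def by auto

lemma frag_act_family:
  assumes "FI_hom_family p t g" "FI_subgroup K" "a \<in> level_family V K n"
  shows "frag_act V p t g a \<in> level_family V K (t n)"
proof (cases "p n")
  case True
  have "evaluate V n a \<in> K {..<n}" using assms(3) by (simp add: level_family_def)
  then have "mor V {..<n} {..<t n} (g n) (evaluate V n a) \<in> K {..<t n}"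
    using assms(1) True by (intro FI_subgroupD(4)[OF assms(2)]) (auto simp: FI_hom_family_def)
  then show ?thesis using assms True frag_act_level[OF assms(1), of a n]
    by (simp add: level_family_def)
next
  case False
  then show ?thesis using assms frag_act_level[OF assms(1), of a n]
    by (simp add: level_family_def evaluate_0 FI_subgroupD(2)[OF assms(2)])
qed

lemma add_subgroup_level_family:
  assumes "FI_subgroup K" shows "add_subgroup (level_family V K n)"
proof -
  have "a - b \<in> level_family V K n" if "a \<in> level_family V K n" "b \<in> level_family V K n" for a b
    using that keys_diff[of a b]
    by (simp add: level_family_def evaluate_diff FI_subgroupD(3)[OF assms] order_trans[OF _ Un_least])
  then show ?thesis by (auto simp: add_subgroup_def level_family_def evaluate_0 FI_subgroupD(2)[OF assms])
qed

lemma stable_level_family: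
  assumes "FI_subgroup K"
  shows "insertions.stable (ins V) (transp V) k (level_family V K)"
    and "insertions.stable (ins_rev V) (transp_rev V) k (level_family V K)"
proof -
  have fam: "FI_hom_family (\<lambda>n. j \<le> n) Suc (\<lambda>n. skip (n - j) n)" "FI_hom_family (\<lambda>n. j \<le> n) Suc (skip j)"
    "FI_hom_family (\<lambda>n. Suc j < n) (\<lambda>n. n) (\<lambda>n. swap_adj (n - 2 - j) n)"
    "FI_hom_family (\<lambda>n. Suc j < n) (\<lambda>n. n) (swap_adj j)" for j
    using skip_hom swap_adj_hom by (auto simp: FI_hom_family_def)
  note fam' = fam[THEN frag_act_family[OF _ assms]]
  show "insertions.stable (ins V) (transp V) k (level_family V K)"
    unfolding insertions.stable_def[OF insertions_ins] ins_def transp_def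
    using add_subgroup_level_family[OF assms] fam' by blast
  show "insertions.stable (ins_rev V) (transp_rev V) k (level_family V K)"
    unfolding insertions.stable_def[OF insertions_ins_rev] ins_rev_def transp_rev_def
    using add_subgroup_level_family[OF assms] fam' by blast
qed

end

section \<open>Degree-0 boundaries as images of smaller sets\<close>

lemma add_subgroup_sum: "add_subgroup A \<Longrightarrow> (\<And>p. p \<in> I \<Longrightarrow> f p \<in> A) \<Longrightarrow> sum f I \<in> A"
  by (induction I rule: infinite_finite_induct) (auto intro: add_subgroup_0 add_subgroup_add)

lemma (in abelian_group) minus_eq_zero_iff:
  assumes "x \<in> carrier G" "y \<in> carrier G" shows "x \<ominus> y = \<zero> \<longleftrightarrow> x = y"
proof
  assume "x \<ominus> y = \<zero>"
  moreover have "(x \<ominus> y) \<oplus> y = x" using assms by (simp add: minus_eq a_assoc l_neg)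
  ultimately show "x = y" using assms by simp
qed (use assms in \<open>simp add: minus_eq r_neg\<close>)

lemma factor_skip:
  assumes "f \<in> FI_hom A {..<Suc m}" and q: "q \<le> m" "q \<notin> f ` A"
  obtains g where "g \<in> FI_hom A {..<m}" "compose A (skip q m) g = f"
proof -
  have f: "f \<in> extensional A" "inj_on f A" "\<And>x. x \<in> A \<Longrightarrow> f x < Suc m"
    using assms by (auto simp: FI_hom_def PiE_def)
  have ne: "f x \<noteq> q" if "x \<in> A" for x using q that by blast
  let ?g = "\<lambda>x\<in>A. if f x < q then f x else f x - 1"
  have "inj_on ?g A"
  proof (rule inj_onI)
    fix x y assume xy: "x \<in> A" "y \<in> A" "?g x = ?g y"
    then have "f x = f y" using ne[of x] ne[of y] by (auto split: if_splits)
    then show "x = y" using f(2) xy by (auto dest: inj_onD)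
  qed
  moreover have "?g x < m" if "x \<in> A" for x using f(3)[OF that] ne[OF that] that q by auto
  ultimately have "?g \<in> FI_hom A {..<m}" by (auto simp: FI_hom_def)
  moreover have "compose A (skip q m) ?g = f"
  proof
    fix x show "compose A (skip q m) ?g x = f x"
    proof (cases "x \<in> A")
      case True
      then have "?g x < m" using \<open>\<And>x. x \<in> A \<Longrightarrow> ?g x < m\<close> by blast
      then show ?thesis using True ne[OF True] by (auto simp: compose_def skip_def)
    next
      case False
      then show ?thesis using f(1) by (simp add: compose_def extensional_def)
    qed
  qed
  ultimately show thesis by (rule that)
qed

text \<open>By cardinality the map misses some point, and it then factors through the insertion of
  that point. So one-point insertions account for all smaller sets.\<close>

lemma factor_through_skip:
  assumes "f \<in> FI_hom A {..<Suc m}" "finite A" "card A < Suc m"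
  obtains q g where "q \<le> m" "g \<in> FI_hom A {..<m}" "compose A (skip q m) g = f"
proof -
  have "card (f ` A) < Suc m" using card_image_le[OF assms(2), of f] assms(3) by simp
  then have "f ` A \<noteq> {..<Suc m}" by auto
  moreover have "f ` A \<subseteq> {..<Suc m}" using assms(1) by (auto simp: FI_hom_def)
  ultimately obtain q where "q < Suc m" "q \<notin> f ` A" by auto
  then show thesis using factor_skip[OF assms(1), of q] that by (metis less_Suc_eq_le)
qed

context FI_module begin

lemma FI_subgroup_add:
  assumes "FI_subgroup K" "finite S" "x \<in> K S" "y \<in> K S"
  shows "x \<oplus>\<^bsub>obj V S\<^esub> y \<in> K S"
proof -
  interpret A: abelian_group "obj V S" by (rule abelian) fact
  have c: "x \<in> carrier (obj V S)" "y \<in> carrier (obj V S)" using FI_subgroupD(1)[OF assms(1,2)] assms by auto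
  have "x \<ominus>\<^bsub>obj V S\<^esub> (\<zero>\<^bsub>obj V S\<^esub> \<ominus>\<^bsub>obj V S\<^esub> y) \<in> K S"
    by (intro FI_subgroupD(2,3)[OF assms(1,2)] assms)
  then show ?thesis using c by (simp add: A.minus_eq)
qed

lemma image_span_subset:
  assumes "FI_subgroup K" "finite S" "x \<in> image_span V K S" shows "x \<in> K S"
  using assms(3)
  by induction (use assms in \<open>auto intro: FI_subgroup_add FI_subgroupD\<close>)

lemma image_span_gen:
  assumes "FI_subgroup K" "finite S" "finite A" "card A < card S" "f \<in> FI_hom A S" "v \<in> K A"
  shows "mor V A S f v \<in> image_span V K S"
proof -
  interpret A: abelian_group "obj V S" by (rule abelian) fact
  have "mor V A S f v \<in> carrier (obj V S)"
    using assms FI_subgroupD(1)[OF assms(1) assms(3)] by (auto intro: mor_closed)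
  then show ?thesis using image_span.add[OF image_span.zero[of V S K] assms(3-6)] by simp
qed

lemma image_span_add:
  assumes "FI_subgroup K" "finite S" "x \<in> image_span V K S" "y \<in> image_span V K S"
  shows "x \<oplus>\<^bsub>obj V S\<^esub> y \<in> image_span V K S"
  using assms(4)
proof induction
  interpret A: abelian_group "obj V S" by (rule abelian) fact
  have x: "x \<in> carrier (obj V S)" using image_span_subset[OF assms(1-3)] FI_subgroupD(1)[OF assms(1,2)] by simp
  case zero
  then show ?case using x assms by simp
next
  interpret A: abelian_group "obj V S" by (rule abelian) fact
  have x: "x \<in> carrier (obj V S)" using image_span_subset[OF assms(1-3)] FI_subgroupD(1)[OF assms(1,2)] by simp
  case (add y A f v)
  have "mor V A S f v \<in> carrier (obj V S)"
    using add assms(2) FI_subgroupD(1)[OF assms(1) add(2)] by (auto intro: mor_closed)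
  moreover have "y \<in> carrier (obj V S)"
    using image_span_subset[OF assms(1,2) add(1)] FI_subgroupD(1)[OF assms(1,2)] by simp
  ultimately have "x \<oplus>\<^bsub>obj V S\<^esub> (y \<oplus>\<^bsub>obj V S\<^esub> mor V A S f v) = (x \<oplus>\<^bsub>obj V S\<^esub> y) \<oplus>\<^bsub>obj V S\<^esub> mor V A S f v"
    using x by (simp add: A.a_assoc)
  then show ?case using image_span.add[OF add.IH add(2-5)] by simp
qed

lemma image_span_mor:
  assumes "FI_subgroup K" "finite S" "finite T" "\<sigma> \<in> FI_hom S T" "x \<in> image_span V K S"
  shows "mor V S T \<sigma> x \<in> image_span V K T"
  using assms(5)
proof induction
  case zero
  then show ?case using assms by (simp add: mor_zero image_span.zero)
next
  case (add y A f v)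
  have v: "v \<in> carrier (obj V A)" using FI_subgroupD(1)[OF assms(1) add(2)] add by simp
  then have "mor V A S f v \<in> carrier (obj V S)"
    using add assms(2) by (auto intro: mor_closed)
  moreover have "y \<in> carrier (obj V S)"
    using image_span_subset[OF assms(1,2) add(1)] FI_subgroupD(1)[OF assms(1,2)] by simp
  ultimately have eq: "mor V S T \<sigma> (y \<oplus>\<^bsub>obj V S\<^esub> mor V A S f v) =
      mor V S T \<sigma> y \<oplus>\<^bsub>obj V T\<^esub> mor V A T (compose A \<sigma> f) v"
    using assms add v by (simp add: mor_add mor_comp)
  have "card S \<le> card T"
    using assms(3,4) by (auto simp: FI_hom_def intro!: card_inj_on_le)
  moreover have "compose A \<sigma> f \<in> FI_hom A T"
    using add assms(4) by (auto simp: FI_hom_def compose_def inj_on_def PiE_iff)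
  ultimately show ?case unfolding eq using add by (intro image_span.add) auto
qed

interpretation I: insertions "ins V" "transp V" by (rule insertions_ins)

lemma ins_level:
  assumes "Poly_Mapping.keys a \<subseteq> {n} \<times> carrier (obj V {..<n})" "j \<le> n"
  shows "evaluate V (Suc n) (ins V j a) = mor V {..<n} {..<Suc n} (skip j n) (evaluate V n a)"
  unfolding ins_def
  by (rule frag_act_level(2)) (use assms skip_hom in \<open>auto simp: FI_hom_family_def\<close>)

lemma insertion_span_subset:
  assumes "FI_subgroup K" "x \<in> I.insertion_span 0 0 (level_family V K) n"
  shows "x \<in> level_family V K n"
proof -
  obtain a where a: "\<And>p. p < n \<Longrightarrow> a p \<in> level_family V K (n - 1)" "x = (\<Sum>p<n. ins V p (a p))"
    using assms(2) by (auto simp: I.insertion_span_def)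
  have "ins V p (a p) \<in> level_family V K n" if "p < n" for p
    using stable_level_family(1)[OF assms(1), of 0] a(1)[OF that] that
    unfolding I.stable_def by (metis Suc_diff_1 le0 less_nat_zero_code neq0_conv)
  then show ?thesis unfolding a(2)
    using add_subgroup_level_family[OF assms(1)] by (intro add_subgroup_sum) auto
qed

lemma level_familyD:
  "a \<in> level_family V K n \<Longrightarrow> Poly_Mapping.keys a \<subseteq> {n} \<times> carrier (obj V {..<n})"
  "a \<in> level_family V K n \<Longrightarrow> evaluate V n a \<in> K {..<n}"
  by (auto simp: level_family_def)

lemma evaluate_add:
  assumes "Poly_Mapping.keys a \<subseteq> {n} \<times> carrier (obj V {..<n})" "Poly_Mapping.keys b \<subseteq> {n} \<times> carrier (obj V {..<n})"
  shows "evaluate V n (a + b) = evaluate V n a \<oplus>\<^bsub>obj V {..<n}\<^esub> evaluate V n b"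
  using hom_mult[OF evaluate(1)[of n], of a b] assms by simp

lemma frag_of_level_family:
  assumes "FI_subgroup K" "x \<in> K {..<n}" shows "frag_of (n, x) \<in> level_family V K n"
  using assms FI_subgroupD(1)[OF assms(1), of "{..<n}" x] by (simp add: level_family_def evaluate(2))

text \<open>Every insertion comes from a set with one point less; conversely, an arbitrary injection
  from a smaller set factors through some one-point insertion, whose coefficient is then
  enlarged.\<close>

lemma evaluate_insertion_span:
  assumes K: "FI_subgroup K"
  shows "evaluate V n ` I.insertion_span 0 0 (level_family V K) n = image_span V K {..<n}"
proof (intro equalityI subsetI)
  fix y assume "y \<in> evaluate V n ` I.insertion_span 0 0 (level_family V K) n"
  then obtain a where a: "\<And>p. p < n \<Longrightarrow> a p \<in> level_family V K (n - 1)" "y = evaluate V n (\<Sum>p<n. ins V p (a p))"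
    by (auto simp: I.insertion_span_def)
  have *: "ins V p (a p) \<in> level_family V K n \<and> evaluate V n (ins V p (a p)) \<in> image_span V K {..<n}"
    if p: "p < n" for p
  proof -
    obtain m where m: "n = Suc m" using p by (cases n) auto
    have ap: "a p \<in> level_family V K m" using a(1)[OF p] m by simp
    have "evaluate V n (ins V p (a p)) = mor V {..<m} {..<Suc m} (skip p m) (evaluate V m (a p))"
      unfolding m by (rule ins_level) (use level_familyD[OF ap] p m in auto)
    moreover have "mor V {..<m} {..<Suc m} (skip p m) (evaluate V m (a p)) \<in> image_span V K {..<Suc m}"
      by (rule image_span_gen[OF K]) (use level_familyD[OF ap] skip_hom in auto)
    moreover have "ins V p (a p) \<in> level_family V K (Suc m)"
      using stable_level_family(1)[OF K, of 0] ap unfolding I.stable_def by blast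
    ultimately show ?thesis using m by simp
  qed
  have "(\<Sum>p<k. ins V p (a p)) \<in> level_family V K n \<and> evaluate V n (\<Sum>p<k. ins V p (a p)) \<in> image_span V K {..<n}"
    if "k \<le> n" for k
    using that
  proof (induction k)
    case 0
    show ?case using add_subgroup_level_family[OF K] by (simp add: add_subgroup_0 evaluate_0 image_span.zero)
  next
    case (Suc k)
    then have k: "k < n" by simp
    let ?s = "\<Sum>p<k. ins V p (a p)"
    have s: "?s \<in> level_family V K n" "evaluate V n ?s \<in> image_span V K {..<n}" using Suc by auto
    have "evaluate V n (?s + ins V k (a k)) \<in> image_span V K {..<n}"
      unfolding evaluate_add[OF level_familyD(1)[OF s(1)] level_familyD(1)[OF conjunct1[OF *[OF k]]]]
      by (rule image_span_add[OF K _ s(2) conjunct2[OF *[OF k]]]) simp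
    moreover have "?s + ins V k (a k) \<in> level_family V K n"
      using s *[OF k] add_subgroup_level_family[OF K] by (auto intro: add_subgroup_add)
    ultimately show ?case by simp
  qed
  from this[of n] show "y \<in> image_span V K {..<n}" using a by simp
next
  fix y assume "y \<in> image_span V K {..<n}"
  then show "y \<in> evaluate V n ` I.insertion_span 0 0 (level_family V K) n"
  proof induction
    case zero
    have "(\<Sum>p<n. ins V (0 + p) 0) \<in> I.insertion_span 0 0 (level_family V K) n"
      unfolding I.insertion_span_def using add_subgroup_level_family[OF K, THEN add_subgroup_0]
      by (intro CollectI exI[of _ "\<lambda>_. 0"]) simp
    then have "0 \<in> I.insertion_span 0 0 (level_family V K) n" by simp
    then show ?case using evaluate_0 by (metis image_eqI)
  next
    case (add x A f v)
    from add.IH obtain X where X: "X \<in> I.insertion_span 0 0 (level_family V K) n" "x = evaluate V n X" by auto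
    then obtain a where a: "\<And>p. p < n \<Longrightarrow> a p \<in> level_family V K (n - 1)" "X = (\<Sum>p<n. ins V p (a p))"
      by (auto simp: I.insertion_span_def)
    obtain m where m: "n = Suc m" using add by (cases n) auto
    obtain q g where g: "q \<le> m" "g \<in> FI_hom A {..<m}" "compose A (skip q m) g = f"
      using factor_through_skip[of f A m] add m by auto
    let ?w = "mor V A {..<m} g v"
    have v: "v \<in> carrier (obj V A)" using FI_subgroupD(1)[OF K] add by blast
    have w: "?w \<in> K {..<m}" using add g by (intro FI_subgroupD(4)[OF K]) auto
    have fv: "mor V A {..<n} f v = mor V {..<m} {..<Suc m} (skip q m) ?w"
      unfolding m g(3)[symmetric] using add v g skip_hom by (intro mor_comp) auto
    let ?b = "frag_of (m, ?w)"
    have b: "?b \<in> level_family V K m" by (rule frag_of_level_family[OF K w])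
    have wc: "?w \<in> carrier (obj V {..<m})" using FI_subgroupD(1)[OF K _ w] by simp
    have evb: "evaluate V n (ins V q ?b) = mor V A {..<n} f v"
      using ins_level[OF level_familyD(1)[OF b] g(1)] evaluate(2)[OF wc] fv m by simp
    have insb: "ins V q ?b \<in> level_family V K n"
      using stable_level_family(1)[OF K, of 0] b m unfolding I.stable_def by blast
    let ?a = "\<lambda>p. a p + (if p = q then ?b else 0)"
    have "(\<Sum>p<n. ins V (0 + p) (?a p)) \<in> I.insertion_span 0 0 (level_family V K) n"
      unfolding I.insertion_span_def using a(1) b m add_subgroup_level_family[OF K]
      by (intro CollectI exI[of _ ?a]) (auto intro: add_subgroup_add)
    moreover have "ins V p (?a p) = ins V p (a p) + (if p = q then ins V q ?b else 0)" for p
      by (simp add: I.\<delta>_add)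
    then have "(\<Sum>p<n. ins V (0 + p) (?a p)) = X + ins V q ?b"
      using g(1) m by (simp add: sum.distrib a(2) del: sum.lessThan_Suc)
    ultimately have "X + ins V q ?b \<in> I.insertion_span 0 0 (level_family V K) n" by simp
    moreover have "evaluate V n (X + ins V q ?b) = x \<oplus>\<^bsub>obj V {..<n}\<^esub> mor V A {..<n} f v"
      using evaluate_add[OF level_familyD(1)[OF insertion_span_subset[OF K X(1)]] level_familyD(1)[OF insb]]
      by (simp add: evb X)
    ultimately show ?case by (metis image_eqI)
  qed
qed

section \<open>Koszul exactness of FI-modules in low degrees\<close>

abbreviation all_values :: "nat set \<Rightarrow> 'm set" where
  "all_values S \<equiv> carrier (obj V S)"

abbreviation zero_values :: "nat set \<Rightarrow> 'm set" where
  "zero_values S \<equiv> {\<zero>\<^bsub>obj V S\<^esub>}"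

lemma FI_subgroup_all: "FI_subgroup all_values"
  unfolding FI_subgroup_def
proof (intro conjI allI impI)
  fix S :: "nat set" assume "finite S"
  then interpret A: abelian_group "obj V S" by (rule abelian)
  show "\<zero>\<^bsub>obj V S\<^esub> \<in> carrier (obj V S)" "\<forall>x\<in>carrier (obj V S). \<forall>y\<in>carrier (obj V S). x \<ominus>\<^bsub>obj V S\<^esub> y \<in> carrier (obj V S)"
    by auto
qed (auto intro: mor_closed)

lemma FI_subgroup_zero: "FI_subgroup zero_values"
  unfolding FI_subgroup_def
proof (intro conjI allI impI)
  fix S :: "nat set" assume "finite S"
  then interpret A: abelian_group "obj V S" by (rule abelian)
  show "zero_values S \<subseteq> all_values S" "\<forall>x\<in>zero_values S. \<forall>y\<in>zero_values S. x \<ominus>\<^bsub>obj V S\<^esub> y \<in> zero_values S"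
    by (auto simp: A.minus_eq)
qed (auto simp: mor_zero)

lemma level_family_mono:
  assumes "FI_subgroup K" "FI_subgroup L" "K {..<n} \<subseteq> L {..<n}"
  shows "level_family V K n \<subseteq> level_family V L n"
  using assms by (auto simp: level_family_def)

lemma admissible_level_family:
  assumes "FI_subgroup K" "FI_subgroup L" "\<And>S. finite S \<Longrightarrow> L S \<subseteq> K S"
  shows "I.admissible k (level_family V K) (level_family V L)"
  using assms stable_level_family(1) level_family_mono[OF assms(2,1)]
  by (auto simp: I.admissible_def)

lemma level_family_zero_iff:
  assumes "Poly_Mapping.keys a \<subseteq> {n} \<times> carrier (obj V {..<n})" "Poly_Mapping.keys b \<subseteq> {n} \<times> carrier (obj V {..<n})"
  shows "a - b \<in> level_family V zero_values n \<longleftrightarrow> evaluate V n a = evaluate V n b"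
proof -
  interpret A: abelian_group "obj V {..<n}" by (rule abelian) simp
  show ?thesis
    using assms evaluate_closed[OF assms(1)] evaluate_closed[OF assms(2)] keys_diff[of a b]
    by (auto simp: level_family_def evaluate_diff A.minus_eq_zero_iff order_trans[OF _ Un_least])
qed

abbreviation FI_exact :: "(nat set \<Rightarrow> 'm set) \<Rightarrow> (nat set \<Rightarrow> 'm set) \<Rightarrow> nat \<Rightarrow> int \<Rightarrow> bool" where
  "FI_exact K L \<equiv> koszul_exact (ins V) 0 0 (level_family V K) (level_family V L)"

lemma FI_exact_0_iff:
  "FI_exact all_values zero_values n 0 \<longleftrightarrow> carrier (obj V {..<n}) \<subseteq> image_span V all_values {..<n}"
proof -
  let ?S = "I.insertion_span 0 0 (level_family V all_values) n"
  have "FI_exact all_values zero_values n 0 \<longleftrightarrow>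
      (\<forall>z\<in>level_family V all_values n. \<exists>x\<in>?S. evaluate V n z = evaluate V n x)"
    unfolding I.koszul_exact_0_iff add_0
    by (intro ball_cong bex_cong refl level_family_zero_iff level_familyD(1)
        level_familyD(1)[OF insertion_span_subset[OF FI_subgroup_all]])
  also have "\<dots> \<longleftrightarrow> (\<forall>y\<in>carrier (obj V {..<n}). y \<in> evaluate V n ` ?S)"
    (is "?L \<longleftrightarrow> ?R")
  proof
    assume L: ?L
    show ?R
    proof
      fix y assume y: "y \<in> carrier (obj V {..<n})"
      with L frag_of_level_family[OF FI_subgroup_all y] obtain x where "x \<in> ?S" "evaluate V n (frag_of (n, y)) = evaluate V n x"
        by blast
      then show "y \<in> evaluate V n ` ?S" using evaluate(2)[OF y] by auto
    qed
  next
    assume ?R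
    then show ?L using level_familyD(2)[of _ all_values n] by fastforce
  qed
  finally show ?thesis unfolding evaluate_insertion_span[OF FI_subgroup_all] by blast
qed

text \<open>H_1 of the quotient by \<open>K\<close> is the kernel of H_0(K) -> H_0(V): the elements
  of \<open>K\<close> that come from smaller sets within V, modulo those that come from smaller sets
  within \<open>K\<close>.\<close>

lemma FI_exact_1_iff:
  assumes K: "FI_subgroup K"
    and acyclic: "\<And>i. i \<ge> 1 \<Longrightarrow> FI_exact all_values zero_values n i"
  shows "FI_exact all_values K n 1 \<longleftrightarrow>
    image_span V all_values {..<n} \<inter> K {..<n} \<subseteq> image_span V K {..<n}"
proof -
  let ?S = "\<lambda>K. I.insertion_span 0 0 (level_family V K) n"
  have sub: "zero_values S \<subseteq> K S" "K S \<subseteq> all_values S" if "finite S" for S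
    using FI_subgroupD[OF K that] by auto
  have adm: "I.admissible 0 (level_family V all_values) (level_family V zero_values)"
    using FI_subgroupD(2)[OF FI_subgroup_all]
    by (intro admissible_level_family FI_subgroup_all FI_subgroup_zero) auto
  have "FI_exact all_values K n 1 \<longleftrightarrow>
    (\<forall>x\<in>?S all_values. x \<in> level_family V K n \<longrightarrow> (\<exists>y\<in>?S K. x - y \<in> level_family V zero_values n))"
    using I.koszul_exact_1_iff[OF adm stable_level_family(1)[OF K] _ _ acyclic]
      level_family_mono[OF FI_subgroup_zero K] level_family_mono[OF K FI_subgroup_all] sub by simp
  also have "\<dots> \<longleftrightarrow> (\<forall>x\<in>?S all_values. evaluate V n x \<in> K {..<n} \<longrightarrow> (\<exists>y\<in>?S K. evaluate V n x = evaluate V n y))"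
  proof (intro ball_cong refl)
    fix x assume "x \<in> ?S all_values"
    then have x: "x \<in> level_family V all_values n" by (rule insertion_span_subset[OF FI_subgroup_all])
    have "x \<in> level_family V K n \<longleftrightarrow> evaluate V n x \<in> K {..<n}"
      using level_familyD(1)[OF x] by (simp add: level_family_def)
    moreover have "x - y \<in> level_family V zero_values n \<longleftrightarrow> evaluate V n x = evaluate V n y" if "y \<in> ?S K" for y
      using level_family_zero_iff[OF level_familyD(1)[OF x] level_familyD(1)[OF insertion_span_subset[OF K that]]] .
    ultimately show "(x \<in> level_family V K n \<longrightarrow> (\<exists>y\<in>?S K. x - y \<in> level_family V zero_values n)) \<longleftrightarrow>
        (evaluate V n x \<in> K {..<n} \<longrightarrow> (\<exists>y\<in>?S K. evaluate V n x = evaluate V n y))" by simp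
  qed
  also have "\<dots> \<longleftrightarrow> (\<forall>x\<in>evaluate V n ` ?S all_values. x \<in> K {..<n} \<longrightarrow> x \<in> evaluate V n ` ?S K)"
    by (auto simp: image_iff)
  finally show ?thesis
    unfolding evaluate_insertion_span[OF FI_subgroup_all] evaluate_insertion_span[OF K] by blast
qed

lemma FI_exact_dimension_shift:
  assumes K: "FI_subgroup K"
    and acyclic: "\<And>i. i \<ge> 1 \<Longrightarrow> FI_exact all_values zero_values n i" and i: "i \<ge> 1"
  shows "FI_exact all_values K n (i + 1) \<longleftrightarrow> FI_exact K zero_values n i"
proof -
  have sub: "zero_values S \<subseteq> K S" "K S \<subseteq> all_values S" if "finite S" for S
    using FI_subgroupD[OF K that] by auto
  have adm: "I.admissible 0 (level_family V all_values) (level_family V zero_values)"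
    using FI_subgroupD(2)[OF FI_subgroup_all]
    by (intro admissible_level_family FI_subgroup_all FI_subgroup_zero) auto
  show ?thesis
    using I.koszul_exact_dimension_shift[OF adm stable_level_family(1)[OF K] _ _ acyclic i]
      level_family_mono[OF FI_subgroup_zero K] level_family_mono[OF K FI_subgroup_all] sub by simp
qed

text \<open>\<open>eventually_acyclic\<close> adds its points behind, whereas
  \<open>eventually_exact\<close> wants them in front. It is therefore applied to
  \<open>ins_rev\<close>, with the hypotheses reversed for \<open>N = 0\<close> and the conclusion
  reversed back for every large shift.\<close>

lemma eventually_exact_level_family:
  assumes t0: "\<And>n. int n > g \<Longrightarrow> FI_exact all_values zero_values n 0"
    and t1: "\<And>n. int n > r \<Longrightarrow> FI_exact all_values zero_values n 1"
  shows "I.eventually_exact (level_family V all_values) (level_family V zero_values)"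
proof -
  interpret J: insertions "ins_rev V" "transp_rev V" by (rule insertions_ins_rev)
  let ?Z = "level_family V all_values" and ?B = "level_family V zero_values"
  have admJ: "J.admissible 0 ?Z ?B"
    using stable_level_family(2) FI_subgroup_all FI_subgroup_zero level_family_mono[OF FI_subgroup_zero FI_subgroup_all]
      FI_subgroupD(2)[OF FI_subgroup_all] by (auto simp: J.admissible_def)
  have sg: "add_subgroup (?Z m)" "add_subgroup (?B m)" for m
    using add_subgroup_level_family FI_subgroup_all FI_subgroup_zero by auto
  have op: "ins_rev V j x = ins V (M - j) x" if "x \<in> ?Z M" "j \<le> M" for M j x
    unfolding ins_rev_def ins_def frag_act_def
    by (rule frag_extend_eq) (use level_familyD(1)[OF that(1)] that(2) in auto)
  note rev = koszul_exact_rev[of ?Z "ins_rev V" "ins V" ?B, OF op sg I.kd_minus]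
  define G where "G = nat (g + 1)"
  have t0': "koszul_exact (ins_rev V) 0 0 ?Z ?B n 0" if "int n > int G - 1" for n
    using rev(2)[where N = 0 and n = n and i = 0] t0[of n] that by (simp add: G_def split: if_splits)
  have t1': "koszul_exact (ins_rev V) 0 0 ?Z ?B n 1" if "int n > r" for n
    using rev(2)[where N = 0 and n = n and i = 1] t1[of n] that by simp
  obtain b0 where b0: "\<forall>b\<ge>b0. \<forall>i\<ge>1. \<forall>n. koszul_exact (ins_rev V) 0 b ?Z ?B n i"
    using J.eventually_acyclic[OF admJ t0' t1'] by blast
  have "koszul_exact (ins V) k k ?Z ?B n i" if "k \<ge> b0" "i \<ge> 1" for k n i
    using rev(1)[where N = k and n = n and i = i] b0 that by simp
  then show ?thesis unfolding I.eventually_exact_def by blast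
qed

end

section \<open>Morphisms and free modules\<close>

locale FI_map = dom: FI_module R V + cod: FI_module R W
  for R :: "('r, 'c) ring_scheme" (structure) and V :: "('r, 'm) FI_mod" and W :: "('r, 'n) FI_mod" +
  fixes \<phi> :: "nat set \<Rightarrow> 'm \<Rightarrow> 'n"
  assumes map_closed: "finite S \<Longrightarrow> x \<in> carrier (obj V S) \<Longrightarrow> \<phi> S x \<in> carrier (obj W S)"
    and map_add: "finite S \<Longrightarrow> x \<in> carrier (obj V S) \<Longrightarrow> y \<in> carrier (obj V S) \<Longrightarrow>
      \<phi> S (x \<oplus>\<^bsub>obj V S\<^esub> y) = \<phi> S x \<oplus>\<^bsub>obj W S\<^esub> \<phi> S y"
    and map_mor: "finite S \<Longrightarrow> finite T \<Longrightarrow> f \<in> FI_hom S T \<Longrightarrow> x \<in> carrier (obj V S) \<Longrightarrow>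
      \<phi> T (mor V S T f x) = mor W S T f (\<phi> S x)"
begin

definition kernel :: "nat set \<Rightarrow> 'm set" where
  "kernel S = {x \<in> carrier (obj V S). \<phi> S x = \<zero>\<^bsub>obj W S\<^esub>}"

lemma map_zero: "finite S \<Longrightarrow> \<phi> S \<zero>\<^bsub>obj V S\<^esub> = \<zero>\<^bsub>obj W S\<^esub>"
  by (rule additive_map_zero_minus(1)[OF dom.abelian cod.abelian map_closed map_add])

lemma map_diff:
  assumes "finite S" "x \<in> carrier (obj V S)" "y \<in> carrier (obj V S)"
  shows "\<phi> S (x \<ominus>\<^bsub>obj V S\<^esub> y) = \<phi> S x \<ominus>\<^bsub>obj W S\<^esub> \<phi> S y"
  using assms by (intro additive_map_zero_minus(2)[OF dom.abelian cod.abelian map_closed map_add])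

lemma FI_subgroup_kernel: "dom.FI_subgroup kernel"
  unfolding dom.FI_subgroup_def
proof (intro conjI allI impI)
  fix S :: "nat set" assume S: "finite S"
  interpret A: abelian_group "obj V S" by (rule dom.abelian) fact
  interpret B: abelian_group "obj W S" by (rule cod.abelian) fact
  show "kernel S \<subseteq> carrier (obj V S)" by (auto simp: kernel_def)
  show "\<zero>\<^bsub>obj V S\<^esub> \<in> kernel S" using S by (simp add: kernel_def map_zero)
  show "\<forall>x\<in>kernel S. \<forall>y\<in>kernel S. x \<ominus>\<^bsub>obj V S\<^esub> y \<in> kernel S"
    using S by (simp add: kernel_def map_diff B.minus_eq_zero_iff)
next
  fix S T :: "nat set" and f x assume "finite S" "finite T" "f \<in> FI_hom S T" "x \<in> kernel S"
  then show "mor V S T f x \<in> kernel T"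
    by (simp add: kernel_def map_mor cod.mor_zero dom.mor_closed)
qed

definition frag_map :: "'m level_frag \<Rightarrow> 'n level_frag" where
  "frag_map = frag_extend (\<lambda>(n, x). if x \<in> carrier (obj V {..<n}) then frag_of (n, \<phi> {..<n} x) else 0)"

lemma frag_map_diff: "frag_map (a - b) = frag_map a - frag_map b"
  by (simp add: frag_map_def frag_extend_diff)

lemma frag_map_of: "frag_map (frag_of (n, x)) = (if x \<in> carrier (obj V {..<n}) then frag_of (n, \<phi> {..<n} x) else 0)"
  by (simp add: frag_map_def)

lemma ins_of: "ins V j (frag_of (n, x)) = (if j \<le> n \<and> x \<in> carrier (obj V {..<n})
    then frag_of (Suc n, mor V {..<n} {..<Suc n} (skip j n) x) else 0)"
  by (simp add: ins_def frag_act_of)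

lemma insertion_map: "insertion_map (ins V) (transp V) (ins W) (transp W) frag_map"
proof (intro insertion_map.intro dom.insertions_ins cod.insertions_ins insertion_map_axioms.intro)
  show "frag_map (x - y) = frag_map x - frag_map y" for x y by (rule frag_map_diff)
  fix j a
  show "ins W j (frag_map a) = frag_map (ins V j a)"
  proof (rule additive_frag_eqI[where F = "\<lambda>a. ins W j (frag_map a)" and G = "\<lambda>a. frag_map (ins V j a)"])
    fix n x
    have "ins W j (frag_of (n, \<phi> {..<n} x)) = (if j \<le> n
        then frag_of (Suc n, mor W {..<n} {..<Suc n} (skip j n) (\<phi> {..<n} x)) else 0)"
      if "x \<in> carrier (obj V {..<n})"
      using map_closed[OF _ that] by (simp add: ins_def frag_act_of)
    moreover have "ins W j 0 = 0" "frag_map 0 = 0" by (simp_all add: ins_def frag_act_def frag_map_def)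
    ultimately show "ins W j (frag_map (frag_of (n, x))) = frag_map (ins V j (frag_of (n, x)))"
      using map_mor[OF _ _ skip_hom] dom.mor_closed[OF _ _ skip_hom]
      by (simp add: frag_map_of ins_of)
  qed (simp_all add: frag_map_diff ins_def frag_act_diff)
qed

lemma frag_map_level:
  assumes "Poly_Mapping.keys a \<subseteq> {n} \<times> carrier (obj V {..<n})"
  shows "Poly_Mapping.keys (frag_map a) \<subseteq> {n} \<times> carrier (obj W {..<n}) \<and>
    evaluate W n (frag_map a) = \<phi> {..<n} (evaluate V n a)"
proof (rule free_Abelian_group_induct[OF assms], goal_cases)
  case 1
  show ?case by (simp add: frag_map_def dom.evaluate_0 cod.evaluate_0 map_zero)
next
  case (2 x y)
  then show ?case
    using keys_diff[of "frag_map x" "frag_map y"] dom.evaluate_closed[of x n] dom.evaluate_closed[of y n]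
    by (simp add: frag_map_diff dom.evaluate_diff cod.evaluate_diff map_diff order_trans[OF _ Un_least])
next
  case (3 x)
  then obtain y where y: "x = (n, y)" "y \<in> carrier (obj V {..<n})" by auto
  then show ?case
    using map_closed[of "{..<n}" y] by (simp add: frag_map_of dom.evaluate(2) cod.evaluate(2))
qed

text \<open>The first isomorphism theorem for the quotient by the kernel, passed through
  \<open>koszul_exact_iso\<close>.\<close>

lemma FI_exact_kernel_iff:
  assumes L: "cod.FI_subgroup L" "\<And>S. finite S \<Longrightarrow> \<phi> S ` carrier (obj V S) = L S"
  shows "dom.FI_exact dom.all_values kernel n i \<longleftrightarrow> cod.FI_exact L cod.zero_values n i"
proof (rule insertion_map.koszul_exact_iso[OF insertion_map])
  note D = dom.level_familyD
  show "frag_map x \<in> level_family W L m" if x: "x \<in> level_family V dom.all_values m" for m x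
    using frag_map_level[OF D(1)[OF x]] D(2)[OF x] L(2)[of "{..<m}"] by (auto simp: level_family_def)
  show "frag_map x \<in> level_family W cod.zero_values m \<longleftrightarrow> x \<in> level_family V kernel m"
    if x: "x \<in> level_family V dom.all_values m" for m x
    using frag_map_level[OF D(1)[OF x]] x by (auto simp: level_family_def kernel_def)
  show "\<exists>x\<in>level_family V dom.all_values m. y - frag_map x \<in> level_family W cod.zero_values m"
    if y: "y \<in> level_family W L m" for m y
  proof -
    obtain x where x: "x \<in> carrier (obj V {..<m})" "\<phi> {..<m} x = evaluate W m y"
      using cod.level_familyD(2)[OF y] L(2)[of "{..<m}"] by force
    have f: "frag_of (m, x) \<in> level_family V dom.all_values m"
      by (rule dom.frag_of_level_family[OF dom.FI_subgroup_all x(1)])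
    have "y - frag_map (frag_of (m, x)) \<in> level_family W cod.zero_values m"
      using frag_map_level[OF D(1)[OF f]] x
      by (subst cod.level_family_zero_iff[OF cod.level_familyD(1)[OF y]]) (auto simp: dom.evaluate(2))
    with f show ?thesis by blast
  qed
  show "insertions.admissible (ins V) (transp V) 0 (level_family V dom.all_values) (level_family V kernel)"
    by (intro dom.admissible_level_family dom.FI_subgroup_all FI_subgroup_kernel)
      (auto simp: kernel_def)
  show "insertions.admissible (ins W) (transp W) 0 (level_family W L) (level_family W cod.zero_values)"
    using cod.FI_subgroupD(2)[OF L(1)]
    by (intro cod.admissible_level_family cod.FI_subgroup_zero L(1)) auto
qed

end

section \<open>Free FI-modules are acyclic for the Koszul complex\<close>

context cring begin

lemma compose_inj:
  assumes "g \<in> FI_hom T U" "f \<in> FI_hom S T" "f' \<in> FI_hom S T" "compose S g f = compose S g f'"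
  shows "f = f'"
proof
  fix x show "f x = f' x"
  proof (cases "x \<in> S")
    case True
    then have "g (f x) = g (f' x)" using assms(4) by (metis compose_eq)
    moreover have "f x \<in> T" "f' x \<in> T" using assms True by (auto simp: FI_hom_def)
    ultimately show ?thesis using assms(1) by (auto simp: FI_hom_def dest: inj_onD)
  next
    case False
    then show ?thesis using assms by (auto simp: FI_hom_def PiE_def extensional_def)
  qed
qed

lemma inj_on_compose_key:
  assumes g: "g \<in> FI_hom T U" and A: "\<And>S x f. (S, x, f) \<in> A \<Longrightarrow> f \<in> FI_hom S T"
  shows "inj_on (\<lambda>(S, x, f). (S, x, compose S g f)) A"
proof (rule inj_onI)
  fix p q assume pq: "p \<in> A" "q \<in> A"
    and eq: "(\<lambda>(S, x, f). (S, x, compose S g f)) p = (\<lambda>(S, x, f). (S, x, compose S g f)) q"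
  obtain S x f S' x' f' where "p = (S, x, f)" "q = (S', x', f')" by (cases p, cases q)
  with pq eq show "p = q" using compose_inj[OF g A A, of S x f x f'] by auto
qed

lemma FI_free_carrier:
  "v \<in> carrier (obj (FI_free R X) T) \<longleftrightarrow>
    (\<forall>k. v k \<in> carrier R) \<and> finite (support R v) \<and> support R v \<subseteq> free_basis X T"
  by (auto simp: FI_free_def)

lemma FI_free_mor_compose:
  assumes "v \<in> carrier (obj (FI_free R X) T)" "g \<in> FI_hom T U" "f \<in> FI_hom S T"
  shows "mor (FI_free R X) T U g v (S, x, compose S g f) = v (S, x, f)"
proof -
  have "{f' \<in> FI_hom S T. compose S g f' = compose S g f} = {f}"
    using assms compose_inj[OF assms(2)] by blast
  moreover have "v (S, x, f) \<in> carrier R" using assms(1) by (simp add: FI_free_carrier)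
  ultimately show ?thesis by (simp add: FI_free_def)
qed

lemma FI_free_mor_other:
  assumes "h \<notin> compose S g ` FI_hom S T"
  shows "mor (FI_free R X) T U g v (S, x, h) = \<zero>"
proof -
  have *: "{f' \<in> FI_hom S T. compose S g f' = h} = {}"
    using assms by blast
  show ?thesis by (simp add: FI_free_def *)
qed

lemma FI_hom_compose: "f \<in> FI_hom S T \<Longrightarrow> g \<in> FI_hom T U \<Longrightarrow> compose S g f \<in> FI_hom S U"
  by (auto simp: FI_hom_def compose_def inj_on_def PiE_iff)

lemma FI_free_mor_closed:
  assumes v: "v \<in> carrier (obj (FI_free R X) T)" and g: "g \<in> FI_hom T U"
  shows "mor (FI_free R X) T U g v \<in> carrier (obj (FI_free R X) U)"
proof -
  let ?w = "mor (FI_free R X) T U g v"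
  have val: "?w (S, x, h) \<in> carrier R" for S x h
    using FI_free_mor_compose[OF v g] FI_free_mor_other[of h S g T X U v x] v
    by (cases "h \<in> compose S g ` FI_hom S T") (auto simp: FI_free_carrier)
  have supp: "support R ?w \<subseteq> (\<lambda>(S, x, f). (S, x, compose S g f)) ` support R v \<inter> free_basis X U"
  proof
    fix k assume k: "k \<in> support R ?w"
    obtain S x h where kk: "k = (S, x, h)" by (cases k)
    then obtain f where f: "f \<in> FI_hom S T" "h = compose S g f"
      using k FI_free_mor_other[of h S g T X U v x] by (auto simp: support_def)
    then have "(S, x, f) \<in> support R v" using k kk FI_free_mor_compose[OF v g f(1)] by (simp add: support_def)
    moreover then have "(S, x, f) \<in> free_basis X T" using v by (auto simp: FI_free_carrier)
    ultimately show "k \<in> (\<lambda>(S, x, f). (S, x, compose S g f)) ` support R v \<inter> free_basis X U"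
      using kk f FI_hom_compose[OF f(1) g] by (force simp: free_basis_def)
  qed
  then have "finite (support R ?w)" using v by (meson FI_free_carrier finite_imageI finite_subset le_inf_iff)
  then show ?thesis using val supp by (auto simp: FI_free_carrier)
qed

lemma module_FI_free: "Module.module R (obj (FI_free R X) T)"
proof -
  let ?M = "obj (FI_free R X) T"
  have supp_add: "support R (\<lambda>k. u k \<oplus> v k) \<subseteq> support R u \<union> support R v"
    if "\<forall>k. u k \<in> carrier R" "\<forall>k. v k \<in> carrier R" for u v :: "_ \<Rightarrow> 'a"
    by (auto simp: support_def)
  have supp_mult: "support R (\<lambda>k. a \<otimes> v k) \<subseteq> support R v" if "a \<in> carrier R" for v :: "_ \<Rightarrow> 'a" and a
    using that by (auto simp: support_def)
  have add: "x \<oplus>\<^bsub>?M\<^esub> y = (\<lambda>k. x k \<oplus> y k)" and zero: "\<zero>\<^bsub>?M\<^esub> = (\<lambda>k. \<zero>)" and smult: "a \<odot>\<^bsub>?M\<^esub> x = (\<lambda>k. a \<otimes> x k)" for x y a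
    by (simp_all add: FI_free_def)
  have fin: "finite (support R (\<lambda>k. u k \<oplus> v k))" if "\<forall>k. u k \<in> carrier R" "\<forall>k. v k \<in> carrier R"
      "finite (support R u)" "finite (support R v)" for u v :: "_ \<Rightarrow> 'a"
    using supp_add[OF that(1,2)] that(3,4) by (meson finite_UnI finite_subset)
  have fin': "finite (support R (\<lambda>k. a \<otimes> v k))" if "a \<in> carrier R" "finite (support R v)" for v :: "_ \<Rightarrow> 'a" and a
    using supp_mult[OF that(1), of v] that(2) by (rule finite_subset)
  show ?thesis
  proof (rule moduleI)
    show "cring R" by (rule is_cring)
    show "abelian_group ?M"
    proof (rule abelian_groupI)
      fix x assume x: "x \<in> carrier ?M"
      have eq: "support R (\<lambda>k. \<ominus> x k) = support R x" using x by (auto simp: support_def FI_free_carrier)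
      have "(\<lambda>k. \<ominus> x k) \<in> carrier ?M" using x unfolding FI_free_carrier eq by simp
      moreover have "(\<lambda>k. \<ominus> x k) \<oplus>\<^bsub>?M\<^esub> x = \<zero>\<^bsub>?M\<^esub>" using x by (auto simp: add zero FI_free_carrier l_neg)
      ultimately show "\<exists>y\<in>carrier ?M. y \<oplus>\<^bsub>?M\<^esub> x = \<zero>\<^bsub>?M\<^esub>" by blast
    next
      fix x y assume "x \<in> carrier ?M" "y \<in> carrier ?M"
      then show "x \<oplus>\<^bsub>?M\<^esub> y \<in> carrier ?M"
        using supp_add[of x y] fin[of x y] unfolding FI_free_carrier add by blast
    qed (auto simp: FI_free_carrier add zero fun_eq_iff a_ac support_def)
  next
    fix a x assume "a \<in> carrier R" "x \<in> carrier ?M"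
    then show "a \<odot>\<^bsub>?M\<^esub> x \<in> carrier ?M"
      using supp_mult[of a x] fin'[of a x] unfolding FI_free_carrier smult by blast
  qed (auto simp: FI_free_carrier add smult fun_eq_iff l_distr r_distr m_assoc)
qed

lemma FI_module_FI_free:
  fixes X :: "nat set \<Rightarrow> 'x set"
  shows "FI_module R (FI_free R X)"
proof (intro FI_module.intro FI_module_axioms.intro)
  show "cring R" by (rule is_cring)
  have add: "x \<oplus>\<^bsub>obj (FI_free R X) T\<^esub> y = (\<lambda>k. x k \<oplus> y k)" and smult: "a \<odot>\<^bsub>obj (FI_free R X) T\<^esub> x = (\<lambda>k. a \<otimes> x k)" for x y a T
    by (simp_all add: FI_free_def)
  fix S T :: "nat set" and f assume f: "f \<in> FI_hom S T"
  fix x assume x: "x \<in> carrier (obj (FI_free R X) S)"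
  show "mor (FI_free R X) S T f x \<in> carrier (obj (FI_free R X) T)"
    by (rule FI_free_mor_closed[OF x f])
  {
    fix y assume y: "y \<in> carrier (obj (FI_free R X) S)"
    interpret M: Module.module R "obj (FI_free R X) S" by (rule module_FI_free)
    have xy: "x \<oplus>\<^bsub>obj (FI_free R X) S\<^esub> y \<in> carrier (obj (FI_free R X) S)" using x y by simp
    show "mor (FI_free R X) S T f (x \<oplus>\<^bsub>obj (FI_free R X) S\<^esub> y) =
        mor (FI_free R X) S T f x \<oplus>\<^bsub>obj (FI_free R X) T\<^esub> mor (FI_free R X) S T f y"
    proof
      fix k :: "nat set \<times> 'x \<times> (nat \<Rightarrow> nat)"
      obtain A z h where k: "k = (A, z, h)" by (cases k)
      show "mor (FI_free R X) S T f (x \<oplus>\<^bsub>obj (FI_free R X) S\<^esub> y) k =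
          (mor (FI_free R X) S T f x \<oplus>\<^bsub>obj (FI_free R X) T\<^esub> mor (FI_free R X) S T f y) k"
        using FI_free_mor_compose[OF xy f] FI_free_mor_compose[OF x f] FI_free_mor_compose[OF y f]
          FI_free_mor_other[of h A f S X T]
        by (cases "h \<in> compose A f ` FI_hom A S") (auto simp: k add)
    qed
  }
  {
    fix a assume a: "a \<in> carrier R"
    interpret M: Module.module R "obj (FI_free R X) S" by (rule module_FI_free)
    have ax: "a \<odot>\<^bsub>obj (FI_free R X) S\<^esub> x \<in> carrier (obj (FI_free R X) S)" using x a by simp
    show "mor (FI_free R X) S T f (a \<odot>\<^bsub>obj (FI_free R X) S\<^esub> x) =
        a \<odot>\<^bsub>obj (FI_free R X) T\<^esub> mor (FI_free R X) S T f x"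
    proof
      fix k :: "nat set \<times> 'x \<times> (nat \<Rightarrow> nat)"
      obtain A z h where k: "k = (A, z, h)" by (cases k)
      show "mor (FI_free R X) S T f (a \<odot>\<^bsub>obj (FI_free R X) S\<^esub> x) k =
          (a \<odot>\<^bsub>obj (FI_free R X) T\<^esub> mor (FI_free R X) S T f x) k"
        using FI_free_mor_compose[OF ax f] FI_free_mor_compose[OF x f]
          FI_free_mor_other[of h A f S X T] a
        by (cases "h \<in> compose A f ` FI_hom A S") (auto simp: k smult)
    qed
  }
  {
    fix U :: "nat set" and g assume g: "g \<in> FI_hom T U"
    show "mor (FI_free R X) S U (compose S g f) x = mor (FI_free R X) T U g (mor (FI_free R X) S T f x)"
    proof
      fix k :: "nat set \<times> 'x \<times> (nat \<Rightarrow> nat)"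
      obtain A z h where k: "k = (A, z, h)" by (cases k)
      have fx: "mor (FI_free R X) S T f x \<in> carrier (obj (FI_free R X) T)" by (rule FI_free_mor_closed[OF x f])
      have gf: "compose S g f \<in> FI_hom S U" by (rule FI_hom_compose[OF f g])
      have assoc: "compose A (compose S g f) e = compose A g (compose A f e)" if "e \<in> FI_hom A S" for e
        using that by (auto simp: FI_hom_def compose_def fun_eq_iff)
      show "mor (FI_free R X) S U (compose S g f) x k = mor (FI_free R X) T U g (mor (FI_free R X) S T f x) k"
      proof (cases "h \<in> compose A (compose S g f) ` FI_hom A S")
        case True
        then obtain e where e: "e \<in> FI_hom A S" "h = compose A (compose S g f) e" by auto
        have "mor (FI_free R X) T U g (mor (FI_free R X) S T f x) k = x (A, z, e)"
          unfolding k e(2) assoc[OF e(1)]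
          using FI_free_mor_compose[OF fx g FI_hom_compose[OF e(1) f]] FI_free_mor_compose[OF x f e(1)] by simp
        then show ?thesis using FI_free_mor_compose[OF x gf e(1)] k e(2) by simp
      next
        case False
        have "mor (FI_free R X) T U g (mor (FI_free R X) S T f x) k = \<zero>"
        proof (cases "h \<in> compose A g ` FI_hom A T")
          case True
          then obtain e where e: "e \<in> FI_hom A T" "h = compose A g e" by auto
          have "e \<notin> compose A f ` FI_hom A S"
          proof
            assume "e \<in> compose A f ` FI_hom A S"
            then obtain e' where "e' \<in> FI_hom A S" "e = compose A f e'" by auto
            then have "h = compose A (compose S g f) e'" using e(2) assoc by simp
            with False \<open>e' \<in> FI_hom A S\<close> show False by blast
          qed
          then show ?thesis using FI_free_mor_compose[OF fx g e(1)] FI_free_mor_other[of e A f S X T x] k e(2) by simp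
        qed (simp add: k FI_free_mor_other)
        then show ?thesis using False by (simp add: k FI_free_mor_other)
      qed
    qed
  }
next
  fix S :: "nat set" and x assume x: "x \<in> carrier (obj (FI_free R X) S)"
  show "mor (FI_free R X) S S (\<lambda>s\<in>S. s) x = x"
  proof
    fix k :: "nat set \<times> 'x \<times> (nat \<Rightarrow> nat)"
    obtain A z h where k: "k = (A, z, h)" by (cases k)
    have id: "(\<lambda>s\<in>S. s) \<in> FI_hom S S" by (auto simp: FI_hom_def inj_on_def)
    have comp: "compose A (\<lambda>s\<in>S. s) e = e" if "e \<in> FI_hom A S" for e
      using that by (auto simp: FI_hom_def compose_def fun_eq_iff PiE_def extensional_def)
    show "mor (FI_free R X) S S (\<lambda>s\<in>S. s) x k = x k"
    proof (cases "h \<in> FI_hom A S")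
      case True
      then show ?thesis using FI_free_mor_compose[OF x id True] comp k by simp
    next
      case False
      have "(A, z, h) \<notin> support R x" using x False by (auto simp: FI_free_carrier free_basis_def)
      then have "x (A, z, h) = \<zero>" by (simp add: support_def)
      moreover have "h \<notin> compose A (\<lambda>s\<in>S. s) ` FI_hom A S" using False comp by auto
      ultimately show ?thesis using k by (simp add: FI_free_mor_other)
    qed
  qed
qed (rule module_FI_free)

text \<open>Dividing out the basis injections that miss one of the first \<open>k\<close> points
  (\<open>Mi k\<close>) leaves those whose image contains \<open>{..<k}\<close>. Insertion at
  position \<open>k\<close> preserves this property and is injective on the basis; its image
  consists of the injections missing \<open>k\<close>, so dividing it out passes from
  \<open>k\<close> to \<open>Suc k\<close>. The insertions thus form a regular sequence.\<close>

lemma FI_free_acyclic: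
  assumes i: "i \<ge> 1"
  shows "koszul_exact (ins (FI_free R X)) 0 0 (level_family (FI_free R X) (\<lambda>S. carrier (obj (FI_free R X) S)))
    (level_family (FI_free R X) (\<lambda>S. {\<zero>\<^bsub>obj (FI_free R X) S\<^esub>})) n i"
proof -
  define F where "F = FI_free R X"
  interpret F: FI_module R F unfolding F_def by (rule FI_module_FI_free)
  interpret I: insertions "ins F" "transp F" by (rule F.insertions_ins)
  let ?Z = "level_family F F.all_values"
  let ?B = "I.iterated_cokernel ?Z (level_family F F.zero_values)"
  define Mi where "Mi k m = {a \<in> ?Z m. \<forall>S x f. evaluate F m a (S, x, f) \<noteq> \<zero> \<longrightarrow> \<not> {..<k} \<subseteq> f ` S}" for k m
  have adm: "I.admissible 0 ?Z (level_family F F.zero_values)"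
    using F.FI_subgroupD(2)[OF F.FI_subgroup_all]
    by (intro F.admissible_level_family F.FI_subgroup_all F.FI_subgroup_zero) auto
  have stZ: "I.stable 0 ?Z" using adm by (simp add: I.admissible_def)
  have insZ: "ins F k z \<in> ?Z (Suc m)" if "z \<in> ?Z m" for k z m
    using stZ that unfolding I.stable_def by blast
  have ev_ins: "evaluate F (Suc m) (ins F k z) = mor F {..<m} {..<Suc m} (skip k m) (evaluate F m z)"
    if "z \<in> ?Z m" "k \<le> m" for k z m
    by (rule F.ins_level[OF F.level_familyD(1)[OF that(1)] that(2)])
  have evc: "evaluate F m z \<in> carrier (obj F {..<m})" if "z \<in> ?Z m" for z m
    by (rule F.evaluate_closed[OF F.level_familyD(1)[OF that]])
  have valc: "evaluate F m z k \<in> carrier R" if "z \<in> ?Z m" for z m k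
    using evc[OF that] by (cases k) (simp add: F_def FI_free_carrier)
  have ev_add: "evaluate F m (a + b) k = evaluate F m a k \<oplus> evaluate F m b k" if "a \<in> ?Z m" "b \<in> ?Z m" for a b m k
    using F.evaluate_add[OF F.level_familyD(1)[OF that(1)] F.level_familyD(1)[OF that(2)]]
    by (simp add: F_def FI_free_def)
  have push: "mor F {..<m} {..<Suc m} (skip k m) v (S, x, compose S (skip k m) f) = v (S, x, f)"
    if "v \<in> carrier (obj F {..<m})" "f \<in> FI_hom S {..<m}" for m k v S x f
    using FI_free_mor_compose[OF _ skip_hom that(2)] that(1) by (simp add: F_def)
  have push0: "mor F {..<m} {..<Suc m} (skip k m) v (S, x, h) = \<zero>"
    if "h \<notin> compose S (skip k m) ` FI_hom S {..<m}" for m k v S x h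
    unfolding F_def by (rule FI_free_mor_other[OF that])
  have supp: "f \<in> FI_hom S {..<m}" if "z \<in> ?Z m" "evaluate F m z (S, x, f) \<noteq> \<zero>" for z m S x f
    using evc[OF that(1)] that(2) by (auto simp: F_def FI_free_carrier support_def free_basis_def)
  have B: "?B k m = Mi k m" if "k \<le> m" for k m
    using that
  proof (induction k arbitrary: m)
    case 0
    have z: "\<zero>\<^bsub>obj F {..<m}\<^esub> = (\<lambda>k. \<zero>)" by (simp add: F_def FI_free_def)
    then have "(\<lambda>k. \<zero>) \<in> F.all_values {..<m}"
      using F.FI_subgroupD(2)[OF F.FI_subgroup_all, of "{..<m}"] by simp
    then show ?case by (auto simp: Mi_def level_family_def z)
  next
    case (Suc k)
    then obtain m' where m: "m = Suc m'" "k \<le> m'" by (cases m) auto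
    have IH: "?B k m = Mi k m" using Suc by simp
    have "?B (Suc k) m = {b + ins F k z | b z. b \<in> Mi k m \<and> z \<in> ?Z m'}"
      using IH by (simp add: I.cokernel_def m)
    also have "\<dots> = Mi (Suc k) m"
    proof (intro equalityI subsetI)
      fix a assume "a \<in> {b + ins F k z | b z. b \<in> Mi k m \<and> z \<in> ?Z m'}"
      then obtain b z where *: "a = b + ins F k z" "b \<in> Mi k m" "z \<in> ?Z m'" by auto
      have b: "b \<in> ?Z m" using * by (simp add: Mi_def)
      have z: "ins F k z \<in> ?Z m" using insZ[OF *(3)] m by simp
      have aZ: "a \<in> ?Z m" using *(1) b z stZ by (auto intro: add_subgroup_add I.stable_add_subgroup)
      have "\<not> {..<Suc k} \<subseteq> f ` S" if ne: "evaluate F m a (S, x, f) \<noteq> \<zero>" for S x f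
      proof
        assume f: "{..<Suc k} \<subseteq> f ` S"
        then have "evaluate F m b (S, x, f) = \<zero>" using *(2) by (fastforce simp: Mi_def)
        moreover have "f \<notin> compose S (skip k m') ` FI_hom S {..<m'}"
        proof
          assume "f \<in> compose S (skip k m') ` FI_hom S {..<m'}"
          then obtain e where "e \<in> FI_hom S {..<m'}" "f = compose S (skip k m') e" by auto
          then have "k \<notin> f ` S" by (auto simp: compose_def skip_def FI_hom_def split: if_splits)
          then show False using f by auto
        qed
        then have "evaluate F m (ins F k z) (S, x, f) = \<zero>"
          unfolding m(1) ev_ins[OF *(3) m(2)] by (rule push0)
        ultimately show False using ne ev_add[OF b z] *(1) by simp
      qed
      with aZ show "a \<in> Mi (Suc k) m" by (auto simp: Mi_def)
    next
      fix a assume a: "a \<in> Mi (Suc k) m"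
      then have aZ: "a \<in> ?Z m" by (simp add: Mi_def)
      let ?v = "evaluate F m a"
      \<comment> \<open>\<open>w\<close> pulls back along \<open>skip k\<close> the coefficients of
        \<open>a\<close> at injections missing \<open>k\<close>. If the image of \<open>h\<close>
        contains \<open>{..<k}\<close>, then either \<open>h\<close> misses \<open>k\<close> and the
        two coefficients cancel, or \<open>h\<close> attains \<open>k\<close> and \<open>a\<close>
        has coefficient zero there; so the difference lies in \<open>Mi k m\<close>.\<close>
      define w where "w = (\<lambda>(S, x, f). if f \<in> FI_hom S {..<m'} then ?v (S, x, compose S (skip k m') f) else \<zero>)"
      have "w \<in> carrier (obj F {..<m'})"
      proof -
        let ?h = "\<lambda>(S, x, f). (S, x, compose S (skip k m') f)"
        have img: "?h ` support R w \<subseteq> support R ?v" by (auto simp: w_def support_def split: if_splits)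
        have hom: "f \<in> FI_hom S {..<m'}" if "(S, x, f) \<in> support R w" for S x f
          using that by (auto simp: w_def support_def split: if_splits)
        have "inj_on ?h (support R w)" by (rule inj_on_compose_key[OF skip_hom hom])
        moreover have fin: "finite (support R ?v)" using evc[OF aZ] by (simp add: F_def FI_free_carrier)
        ultimately have "finite (support R w)"
          using finite_subset[OF img fin] finite_imageD by blast
        moreover have "support R w \<subseteq> free_basis X {..<m'}"
        proof
          fix p assume p: "p \<in> support R w"
          obtain S x f where pe: "p = (S, x, f)" by (cases p)
          have "?h p \<in> support R ?v" using img p by blast
          then have "?h p \<in> free_basis X {..<m}" using evc[OF aZ] by (auto simp: F_def FI_free_carrier)
          then show "p \<in> free_basis X {..<m'}" using hom p pe by (auto simp: free_basis_def)
        qed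
        moreover have "w p \<in> carrier R" for p
          using valc[OF aZ] by (cases p) (simp add: w_def)
        ultimately show ?thesis by (simp add: F_def FI_free_carrier)
      qed
      note wc = this
      let ?z = "frag_of (m', w)"
      have z: "?z \<in> ?Z m'" using F.frag_of_level_family[OF F.FI_subgroup_all] wc by blast
      have insz: "ins F k ?z \<in> ?Z m" using insZ[OF z] m by simp
      let ?b = "a - ins F k ?z"
      have b: "?b \<in> ?Z m" using aZ insz stZ by (auto intro: add_subgroup_diff I.stable_add_subgroup)
      have evz: "evaluate F m (ins F k ?z) = mor F {..<m'} {..<Suc m'} (skip k m') w"
        using ev_ins[OF z m(2)] F.evaluate(2)[OF wc] m(1) by simp
      have "\<not> {..<k} \<subseteq> h ` S" if ne: "evaluate F m ?b (S, x, h) \<noteq> \<zero>" for S x h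
      proof
        assume h: "{..<k} \<subseteq> h ` S"
        have "?v (S, x, h) = evaluate F m (ins F k ?z) (S, x, h)"
        proof (cases "h \<in> compose S (skip k m') ` FI_hom S {..<m'}")
          case True
          then obtain e where e: "e \<in> FI_hom S {..<m'}" "h = compose S (skip k m') e" by auto
          show ?thesis unfolding evz e(2) push[OF wc e(1)] using e by (simp add: w_def)
        next
          case False
          have "?v (S, x, h) = \<zero>"
          proof (rule ccontr)
            assume nz: "?v (S, x, h) \<noteq> \<zero>"
            have "\<not> {..<Suc k} \<subseteq> h ` S" using a nz by (auto simp: Mi_def)
            then have "k \<notin> h ` S" using h by (auto simp: lessThan_Suc)
            from factor_skip[OF supp[OF aZ nz, unfolded m(1)] m(2) this] False show False by blast
          qed
          then show ?thesis unfolding evz push0[OF False] .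
        qed
        moreover have "?v (S, x, h) = evaluate F m ?b (S, x, h) \<oplus> evaluate F m (ins F k ?z) (S, x, h)"
          using ev_add[OF b insz] by simp
        ultimately show False
          using ne valc[OF b] valc[OF insz] by (simp add: add.r_cancel_one')
      qed
      with b have "?b \<in> Mi k m" by (auto simp: Mi_def)
      moreover have "a = ?b + ins F k ?z" by simp
      ultimately show "a \<in> {b + ins F k z | b z. b \<in> Mi k m \<and> z \<in> ?Z m'}" using z by blast
    qed
    finally show ?case .
  qed
  have inj: "I.insertion_inj k ?Z (?B k) m" if "k \<le> m" for k m
    unfolding I.insertion_inj_def
  proof (intro ballI impI)
    fix v assume v: "v \<in> ?Z m" "ins F k v \<in> ?B k (Suc m)"
    have "ins F k v \<in> Mi k (Suc m)" using v(2) B that by simp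
    then have nb: "\<not> {..<k} \<subseteq> h ` S" if "mor F {..<m} {..<Suc m} (skip k m) (evaluate F m v) (S, x, h) \<noteq> \<zero>" for S x h
      using that ev_ins[OF v(1) \<open>k \<le> m\<close>] by (auto simp: Mi_def)
    have "\<not> {..<k} \<subseteq> f ` S" if ne: "evaluate F m v (S, x, f) \<noteq> \<zero>" for S x f
    proof
      assume f: "{..<k} \<subseteq> f ` S"
      have fh: "f \<in> FI_hom S {..<m}" by (rule supp[OF v(1) ne])
      have "\<not> {..<k} \<subseteq> compose S (skip k m) f ` S"
        by (rule nb) (use push[OF evc[OF v(1)] fh] ne in simp)
      moreover have "j \<in> compose S (skip k m) f ` S" if "j < k" for j
      proof -
        have "j \<in> f ` S" using f that by blast
        then obtain s where "s \<in> S" "f s = j" by auto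
        then have "compose S (skip k m) f s = j" using that \<open>k \<le> m\<close> by (simp add: compose_def skip_def)
        then show ?thesis using \<open>s \<in> S\<close> by blast
      qed
      ultimately show False by auto
    qed
    then have "v \<in> Mi k m" using v(1) by (auto simp: Mi_def)
    then show "v \<in> ?B k m" using B that by simp
  qed
  from I.acyclic_if_insertion_inj[OF adm inj i, of 0 n, unfolded I.iterated_cokernel.simps(1)]
  show ?thesis by (simp add: F_def)
qed

end

section \<open>The image of the proper subsets\<close>

context FI_module begin

lemma finsum_in_FI_subgroup:
  assumes K: "FI_subgroup K" "finite S" and f: "\<And>i. i \<in> I \<Longrightarrow> f i \<in> K S"
  shows "finsum (obj V S) f I \<in> K S"
proof -
  interpret A: abelian_group "obj V S" by (rule abelian) fact
  show ?thesis
  proof (cases "finite I")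
    case True
    then show ?thesis using f
    proof (induction I)
      case empty
      then show ?case using FI_subgroupD(2)[OF K] by simp
    next
      case (insert i I)
      have "f \<in> I \<rightarrow> carrier (obj V S)" "f i \<in> carrier (obj V S)"
        using insert.prems FI_subgroupD(1)[OF K] by auto
      then have "finsum (obj V S) f (insert i I) = f i \<oplus>\<^bsub>obj V S\<^esub> finsum (obj V S) f I"
        using insert.hyps by (intro A.finsum_insert)
      then show ?case using insert FI_subgroup_add[OF K] by simp
    qed
  next
    case False
    then show ?thesis using FI_subgroupD(2)[OF K] by (simp add: A.finsum_infinite)
  qed
qed

lemma mor_finsum:
  assumes fin: "finite S" "finite T" and g: "g \<in> FI_hom S T" and I: "finite I" "\<And>i. i \<in> I \<Longrightarrow> f i \<in> carrier (obj V S)"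
  shows "mor V S T g (finsum (obj V S) f I) = finsum (obj V T) (\<lambda>i. mor V S T g (f i)) I"
proof -
  interpret A: abelian_group "obj V S" by (rule abelian) fact
  interpret B: abelian_group "obj V T" by (rule abelian) fact
  show ?thesis using I
  proof (induction I)
    case empty
    then show ?case using mor_zero[OF fin g] by simp
  next
    case (insert i I)
    have *: "f \<in> I \<rightarrow> carrier (obj V S)" "f i \<in> carrier (obj V S)"
      "(\<lambda>i. mor V S T g (f i)) \<in> I \<rightarrow> carrier (obj V T)" "mor V S T g (f i) \<in> carrier (obj V T)"
      using insert.prems mor_closed[OF fin g] by auto
    have "finsum (obj V S) f I \<in> carrier (obj V S)" using *(1) by (rule A.finsum_closed)
    then show ?case
      using insert * by (simp add: mor_add[OF fin g] del: Pi_split_insert_domain)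
  qed
qed

text \<open>An injection from a smaller set factors through its image, which is a proper subset for
  reasons of cardinality.\<close>

lemma image_span_eq_proper_image:
  assumes S: "finite S"
  shows "image_span V all_values S = proper_image V S"
proof -
  interpret A: abelian_group "obj V S" by (rule abelian) fact
  let ?i = "\<lambda>A. (\<lambda>a\<in>A. a)"
  let ?P = "{A. A \<subset> S}"
  have finP: "finite ?P" using S by (auto intro: finite_subset[of _ "Pow S"])
  have inc: "?i A \<in> FI_hom A S" if "A \<subseteq> S" for A
    using that by (auto simp: FI_hom_def inj_on_def)
  have car: "mor V A S (?i A) v \<in> carrier (obj V S)" if "A \<subset> S" "v \<in> carrier (obj V A)" for A v
    using that S inc finite_subset[of A S] by (intro mor_closed) auto
  show ?thesis
  proof (intro equalityI subsetI)
    fix x assume "x \<in> image_span V all_values S"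
    then show "x \<in> proper_image V S"
    proof induction
      case zero
      have z: "mor V A S (?i A) \<zero>\<^bsub>obj V A\<^esub> = \<zero>\<^bsub>obj V S\<^esub>" if "A \<subset> S" for A
        using that S inc finite_subset[of A S] by (intro mor_zero) auto
      have "finsum (obj V S) (\<lambda>A. mor V A S (?i A) \<zero>\<^bsub>obj V A\<^esub>) ?P = finsum (obj V S) (\<lambda>A. \<zero>\<^bsub>obj V S\<^esub>) ?P"
        by (rule A.finsum_cong') (auto simp: z)
      then have "\<zero>\<^bsub>obj V S\<^esub> = finsum (obj V S) (\<lambda>A. mor V A S (?i A) \<zero>\<^bsub>obj V A\<^esub>) ?P" by simp
      moreover have "\<zero>\<^bsub>obj V A\<^esub> \<in> carrier (obj V A)" if "A \<subset> S" for A
        by (rule FI_subgroupD(2)[OF FI_subgroup_all]) (use that S finite_subset[of A S] in blast)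
      ultimately show ?case
        unfolding proper_image_def by (intro CollectI exI[of _ "\<lambda>A. \<zero>\<^bsub>obj V A\<^esub>"] conjI allI impI)
    next
      case (add x A f v)
      from add.IH obtain u where u: "\<And>C. C \<subset> S \<Longrightarrow> u C \<in> carrier (obj V C)"
        "x = finsum (obj V S) (\<lambda>A. mor V A S (?i A) (u A)) ?P" by (auto simp: proper_image_def)
      let ?D = "f ` A"
      have "card ?D < card S" using add card_image_le[of A f] by simp
      moreover have "?D \<subseteq> S" using add by (auto simp: FI_hom_def)
      ultimately have D: "?D \<subset> S" by auto
      have finD: "finite ?D" using add by simp
      have fD: "f \<in> FI_hom A ?D" using add by (auto simp: FI_hom_def PiE_iff)
      let ?w = "mor V A ?D f v"
      have w: "?w \<in> carrier (obj V ?D)" using add fD finD by (intro mor_closed) auto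
      have "compose A (?i ?D) f = f"
        using add by (auto simp: compose_def fun_eq_iff FI_hom_def PiE_def extensional_def)
      then have fv: "mor V A S f v = mor V ?D S (?i ?D) ?w"
        using mor_comp[OF add(2) finD S fD inc, of v] D add by auto
      \<comment> \<open>The new element enters only the component of the proper subset
        \<open>?D\<close>, where it is added to what is already there.\<close>
      let ?u = "\<lambda>C. u C \<oplus>\<^bsub>obj V C\<^esub> (if C = ?D then ?w else \<zero>\<^bsub>obj V C\<^esub>)"
      have sub: "finite C" if "C \<subset> S" for C using that S finite_subset[of C S] by auto
      have w': "(if C = ?D then ?w else \<zero>\<^bsub>obj V C\<^esub>) \<in> carrier (obj V C)" if "C \<subset> S" for C
        using w FI_subgroupD(2)[OF FI_subgroup_all sub[OF that]] by auto
      have u': "?u C \<in> carrier (obj V C)" if "C \<subset> S" for C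
      proof -
        interpret C: abelian_group "obj V C" by (rule abelian) (rule sub[OF that])
        show ?thesis using u(1)[OF that] w'[OF that] by simp
      qed
      have eq: "mor V C S (?i C) (?u C) = mor V C S (?i C) (u C) \<oplus>\<^bsub>obj V S\<^esub> (if ?D = C then mor V ?D S (?i ?D) ?w else \<zero>\<^bsub>obj V S\<^esub>)"
        if C: "C \<subset> S" for C
      proof -
        have C': "finite C" "?i C \<in> FI_hom C S" using sub[OF C] inc[of C] C by auto
        note sum = mor_add[OF C'(1) S C'(2) u(1)[OF C] w'[OF C]]
        show ?thesis
        proof (cases "C = ?D")
          case True
          show ?thesis unfolding sum by (simp only: True refl if_True)
        next
          case False
          then have "?D \<noteq> C" by blast
          then show ?thesis unfolding sum using False mor_zero[OF C'(1) S C'(2)] by (simp only: if_False)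
        qed
      qed
      let ?a = "\<lambda>C. mor V C S (?i C) (u C)"
      let ?b = "\<lambda>C. if ?D = C then mor V ?D S (?i ?D) ?w else \<zero>\<^bsub>obj V S\<^esub>"
      have a: "?a \<in> ?P \<rightarrow> carrier (obj V S)" using car u(1) by blast
      have b: "?b \<in> ?P \<rightarrow> carrier (obj V S)" using car[OF D w] A.zero_closed by (simp only: Pi_iff split: if_split) blast
      have "finsum (obj V S) (\<lambda>C. mor V C S (?i C) (?u C)) ?P = finsum (obj V S) (\<lambda>C. ?a C \<oplus>\<^bsub>obj V S\<^esub> ?b C) ?P"
      proof (rule A.finsum_cong'[OF refl])
        show "(\<lambda>C. ?a C \<oplus>\<^bsub>obj V S\<^esub> ?b C) \<in> ?P \<rightarrow> carrier (obj V S)"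
          using a b A.a_closed by blast
        show "mor V C S (?i C) (?u C) = ?a C \<oplus>\<^bsub>obj V S\<^esub> ?b C" if "C \<in> ?P" for C
          by (rule eq) (use that in simp)
      qed
      also have "\<dots> = x \<oplus>\<^bsub>obj V S\<^esub> finsum (obj V S) ?b ?P"
        unfolding u(2) by (rule A.finsum_addf[OF a b])
      also have "finsum (obj V S) ?b ?P = mor V ?D S (?i ?D) ?w"
        by (rule A.finsum_singleton[of ?D ?P "\<lambda>_. mor V ?D S (?i ?D) ?w"]) (use D finP car[OF D w] in auto)
      finally have "x \<oplus>\<^bsub>obj V S\<^esub> mor V A S f v = finsum (obj V S) (\<lambda>C. mor V C S (?i C) (?u C)) ?P"
        unfolding fv by (rule sym)
      with u' show ?case
        unfolding proper_image_def by (intro CollectI exI[of _ ?u] conjI allI impI)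
    qed
  next
    fix x assume "x \<in> proper_image V S"
    then obtain u where u: "\<And>C. C \<subset> S \<Longrightarrow> u C \<in> carrier (obj V C)"
        "x = finsum (obj V S) (\<lambda>A. mor V A S (?i A) (u A)) ?P" by (auto simp: proper_image_def)
    have "finsum (obj V S) (\<lambda>A. mor V A S (?i A) (u A)) Q \<in> image_span V all_values S" if "finite Q" "Q \<subseteq> ?P" for Q
      using that
    proof (induction Q)
      case empty
      then show ?case by (simp add: image_span.zero)
    next
      case (insert C Q)
      have C: "C \<subset> S" "Q \<subseteq> ?P" using insert.prems by auto
      have "(\<lambda>A. mor V A S (?i A) (u A)) \<in> Q \<rightarrow> carrier (obj V S)" using C(2) car u(1) by blast
      then have "finsum (obj V S) (\<lambda>A. mor V A S (?i A) (u A)) (insert C Q) =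
          mor V C S (?i C) (u C) \<oplus>\<^bsub>obj V S\<^esub> finsum (obj V S) (\<lambda>A. mor V A S (?i A) (u A)) Q"
        using insert.hyps car[OF C(1) u(1)[OF C(1)]] by (intro A.finsum_insert)
      moreover have "mor V C S (?i C) (u C) \<in> image_span V all_values S"
        by (rule image_span_gen[OF FI_subgroup_all S _ psubset_card_mono[OF S C(1)] inc u(1)[OF C(1)]])
          (use C(1) S finite_subset[of C S] in auto)
      ultimately show ?case using image_span_add[OF FI_subgroup_all S _ insert.IH[OF C(2)]] by (simp only:)
    qed
    from this[OF finP] show "x \<in> image_span V all_values S" using u by simp
  qed
qed

text \<open>Bijections are morphisms of FI, so the criterion for H_1 depends only on the
  cardinality, and it suffices to test it on the sets \<open>{..<n}\<close>.\<close>

lemma image_span_transport: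
  assumes K: "FI_subgroup K" and fin: "finite S" "finite T" and card: "card S = card T"
    and sub: "image_span V all_values S \<inter> K S \<subseteq> image_span V K S"
  shows "image_span V all_values T \<inter> K T \<subseteq> image_span V K T"
proof
  fix y assume y: "y \<in> image_span V all_values T \<inter> K T"
  obtain h where h: "bij_betw h S T" using fin card finite_same_card_bij by blast
  let ?f = "restrict h S" and ?g = "restrict (inv_into S h) T"
  have f: "?f \<in> FI_hom S T" using h by (auto simp: FI_hom_def bij_betw_def inj_on_def)
  have g: "?g \<in> FI_hom T S" using bij_betw_inv_into[OF h] by (auto simp: FI_hom_def bij_betw_def inj_on_def)
  have yc: "y \<in> carrier (obj V T)" using y FI_subgroupD(1)[OF K fin(2)] by auto
  have "compose T ?f ?g = (\<lambda>t\<in>T. t)"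
    using h bij_betw_inv_into[OF h] by (auto simp: compose_def fun_eq_iff bij_betw_inv_into_right dest: bij_betwE)
  then have eq: "mor V S T ?f (mor V T S ?g y) = y"
    using mor_comp[OF fin(2,1,2) g f yc] mor_id[OF fin(2) yc] by simp
  have "mor V T S ?g y \<in> image_span V all_values S \<inter> K S"
    using y image_span_mor[OF FI_subgroup_all fin(2,1) g] FI_subgroupD(4)[OF K fin(2,1) g] by blast
  then have "mor V S T ?f (mor V T S ?g y) \<in> image_span V K T"
    using sub by (intro image_span_mor[OF K fin f]) blast
  then show "y \<in> image_span V K T" by (simp add: eq)
qed

end

context FI_map begin

lemma map_image_span_subset:
  assumes S: "finite S" and L: "\<And>A v. finite A \<Longrightarrow> v \<in> carrier (obj V A) \<Longrightarrow> \<phi> A v \<in> L A"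
    and "x \<in> image_span V dom.all_values S"
  shows "\<phi> S x \<in> image_span W L S"
  using assms(3)
proof induction
  case zero
  then show ?case using S by (simp add: map_zero image_span.zero)
next
  case (add x A f v)
  have x: "x \<in> carrier (obj V S)" using dom.image_span_subset[OF dom.FI_subgroup_all S add(1)] .
  have v: "mor V A S f v \<in> carrier (obj V S)" using add S by (intro dom.mor_closed) auto
  have "\<phi> S (x \<oplus>\<^bsub>obj V S\<^esub> mor V A S f v) = \<phi> S x \<oplus>\<^bsub>obj W S\<^esub> mor W A S f (\<phi> A v)"
    using map_add[OF S x v] map_mor[OF add(2) S add(4) add(5)] by simp
  then show ?case using image_span.add[OF add.IH add(2-4) L[OF add(2) add(5)]] by simp
qed

text \<open>Generators of the span of \<open>L\<close> lift one at a time because the map is onto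
  \<open>L\<close> on every set; this is the right exactness of H_0 in terms of spans.\<close>

lemma map_image_span:
  assumes L: "\<And>S. finite S \<Longrightarrow> \<phi> S ` carrier (obj V S) = L S" and S: "finite S"
  shows "\<phi> S ` image_span V dom.all_values S = image_span W L S"
proof (intro equalityI subsetI)
  fix y assume "y \<in> \<phi> S ` image_span V dom.all_values S"
  then show "y \<in> image_span W L S" using map_image_span_subset[OF S, of L] L by blast
next
  fix y assume "y \<in> image_span W L S"
  then show "y \<in> \<phi> S ` image_span V dom.all_values S"
  proof induction
    case zero
    show ?case using map_zero[OF S] image_span.zero[of V S dom.all_values] by (metis image_eqI)
  next
    case (add y A f v)
    from add.IH obtain x where x: "x \<in> image_span V dom.all_values S" "y = \<phi> S x" by auto
    obtain u where u: "u \<in> carrier (obj V A)" "v = \<phi> A u" using L[OF add(2)] add(5) by force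
    have xc: "x \<in> carrier (obj V S)" using dom.image_span_subset[OF dom.FI_subgroup_all S x(1)] .
    have v: "mor V A S f u \<in> carrier (obj V S)" using add S u by (intro dom.mor_closed) auto
    have "\<phi> S (x \<oplus>\<^bsub>obj V S\<^esub> mor V A S f u) = y \<oplus>\<^bsub>obj W S\<^esub> mor W A S f v"
      using map_add[OF S xc v] map_mor[OF add(2) S add(4) u(1)] x u by simp
    moreover have "x \<oplus>\<^bsub>obj V S\<^esub> mor V A S f u \<in> image_span V dom.all_values S"
      by (rule image_span.add[OF x(1) add(2-4) u(1)])
    ultimately show ?case by (metis image_eqI)
  qed
qed

end

section \<open>The canonical resolution\<close>

text \<open>\<open>K\<close> is the subobject in which the images of the generators lie: the whole
  module for the augmentation, the kernel of the preceding map for a differential. Keeping it inside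
  \<open>W\<close> avoids a separate module for each kernel.\<close>

locale free_extension = FI_module R W for R :: "('r, 'c) ring_scheme" (structure) and W :: "('r, 'm) FI_mod" +
  fixes X :: "nat set \<Rightarrow> 'x set" and \<eta> :: "'x \<Rightarrow> 'm" and K :: "nat set \<Rightarrow> 'm set"
  assumes K: "FI_subgroup K" and K_smult: "finite S \<Longrightarrow> a \<in> carrier R \<Longrightarrow> x \<in> K S \<Longrightarrow> a \<odot>\<^bsub>obj W S\<^esub> x \<in> K S"
    and gens: "finite S \<Longrightarrow> z \<in> X S \<Longrightarrow> \<eta> z \<in> K S"
begin

abbreviation "F \<equiv> FI_free R X"

abbreviation term_at where
  "term_at T v \<equiv> (\<lambda>(S, z, f). v (S, z, f) \<odot>\<^bsub>obj W T\<^esub> mor W S T f (\<eta> z))"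

lemma gen_in: "finite T \<Longrightarrow> (S, z, f) \<in> free_basis X T \<Longrightarrow> mor W S T f (\<eta> z) \<in> K T"
  by (auto simp: free_basis_def intro: FI_subgroupD(4)[OF K] gens)

lemma term_in: "finite T \<Longrightarrow> (\<forall>k. v k \<in> carrier R) \<Longrightarrow> k \<in> free_basis X T \<Longrightarrow> term_at T v k \<in> K T"
  by (cases k) (auto intro: K_smult gen_in)

text \<open>Sums over different supports become comparable once they are extended by zero terms to a
  common finite set of keys.\<close>

lemma free_ext_superset:
  assumes T: "finite T" and v: "v \<in> carrier (obj F T)"
    and A: "finite A" "support R v \<subseteq> A" "A \<subseteq> free_basis X T"
  shows "free_ext R W \<eta> T v = finsum (obj W T) (term_at T v) A"
proof -
  interpret M: Module.module R "obj W T" by (rule obj_module) fact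
  have vc: "\<forall>k. v k \<in> carrier R" using v unfolding FI_free_carrier by blast
  have Kc: "x \<in> carrier (obj W T)" if "x \<in> K T" for x using FI_subgroupD(1)[OF K T that] .
  show ?thesis
    unfolding free_ext_def
  proof (rule M.add.finprod_mono_neutral_cong_left)
    show "term_at T v \<in> A \<rightarrow> carrier (obj W T)"
      using term_in[OF T vc] A(3) Kc by blast
    fix k assume k: "k \<in> A - support R v"
    then have "v k = \<zero>" by (simp add: support_def)
    moreover obtain S z f where "k = (S, z, f)" by (cases k)
    ultimately show "term_at T v k = \<zero>\<^bsub>obj W T\<^esub>"
      using k A(3) Kc[OF gen_in[OF T, of S z f]] by auto
  qed (use A in auto)
qed

lemma free_ext_in:
  assumes T: "finite T" and v: "v \<in> carrier (obj F T)"
  shows "free_ext R W \<eta> T v \<in> K T"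
  unfolding free_ext_def
  by (rule finsum_in_FI_subgroup[OF K T]) (use v term_in[OF T, of v] in \<open>auto simp: FI_free_carrier\<close>)

lemma free_ext_add:
  assumes T: "finite T" and u: "u \<in> carrier (obj F T)" and v: "v \<in> carrier (obj F T)"
  shows "free_ext R W \<eta> T (u \<oplus>\<^bsub>obj F T\<^esub> v) = free_ext R W \<eta> T u \<oplus>\<^bsub>obj W T\<^esub> free_ext R W \<eta> T v"
proof -
  interpret M: Module.module R "obj W T" by (rule obj_module) fact
  interpret N: Module.module R "obj F T" by (rule module_FI_free)
  have uv: "u \<oplus>\<^bsub>obj F T\<^esub> v \<in> carrier (obj F T)" using u v by simp
  have eq: "u \<oplus>\<^bsub>obj F T\<^esub> v = (\<lambda>k. u k \<oplus> v k)" by (simp add: FI_free_def)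
  have c: "\<forall>k. u k \<in> carrier R" "\<forall>k. v k \<in> carrier R" using u v unfolding FI_free_carrier by blast+
  let ?A = "support R u \<union> support R v"
  have A: "finite ?A" "?A \<subseteq> free_basis X T" using u v by (auto simp: FI_free_carrier)
  have Kc: "x \<in> carrier (obj W T)" if "x \<in> K T" for x using FI_subgroupD(1)[OF K T that] .
  have tc: "term_at T w k \<in> carrier (obj W T)" if "\<forall>k. w k \<in> carrier R" "k \<in> ?A" for w k
    using Kc[OF term_in[OF T that(1)]] that(2) A(2) by blast
  have "support R (u \<oplus>\<^bsub>obj F T\<^esub> v) \<subseteq> ?A" unfolding eq using c by (auto simp: support_def)
  then have "free_ext R W \<eta> T (u \<oplus>\<^bsub>obj F T\<^esub> v) = finsum (obj W T) (term_at T (u \<oplus>\<^bsub>obj F T\<^esub> v)) ?A"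
    by (rule free_ext_superset[OF T uv A(1) _ A(2)])
  also have "\<dots> = finsum (obj W T) (\<lambda>k. term_at T u k \<oplus>\<^bsub>obj W T\<^esub> term_at T v k) ?A"
  proof (rule M.finsum_cong'[OF refl])
    show "(\<lambda>k. term_at T u k \<oplus>\<^bsub>obj W T\<^esub> term_at T v k) \<in> ?A \<rightarrow> carrier (obj W T)"
      using tc[OF c(1)] tc[OF c(2)] by blast
    fix k assume k: "k \<in> ?A"
    obtain S z f where kk: "k = (S, z, f)" by (cases k)
    have "mor W S T f (\<eta> z) \<in> carrier (obj W T)" using Kc[OF gen_in[OF T]] k kk A(2) by blast
    then show "term_at T (u \<oplus>\<^bsub>obj F T\<^esub> v) k = term_at T u k \<oplus>\<^bsub>obj W T\<^esub> term_at T v k"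
      using c by (simp add: kk eq M.smult_l_distr)
  qed
  also have "\<dots> = finsum (obj W T) (term_at T u) ?A \<oplus>\<^bsub>obj W T\<^esub> finsum (obj W T) (term_at T v) ?A"
    using tc[OF c(1)] tc[OF c(2)] by (intro M.finsum_addf) auto
  also have "\<dots> = free_ext R W \<eta> T u \<oplus>\<^bsub>obj W T\<^esub> free_ext R W \<eta> T v"
    using free_ext_superset[OF T u A(1) _ A(2)] free_ext_superset[OF T v A(1) _ A(2)] by simp
  finally show ?thesis .
qed

lemma free_ext_smult:
  assumes T: "finite T" and a: "a \<in> carrier R" and v: "v \<in> carrier (obj F T)"
  shows "free_ext R W \<eta> T (a \<odot>\<^bsub>obj F T\<^esub> v) = a \<odot>\<^bsub>obj W T\<^esub> free_ext R W \<eta> T v"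
proof -
  interpret M: Module.module R "obj W T" by (rule obj_module) fact
  interpret N: Module.module R "obj F T" by (rule module_FI_free)
  have av: "a \<odot>\<^bsub>obj F T\<^esub> v \<in> carrier (obj F T)" using a v by simp
  have eq: "a \<odot>\<^bsub>obj F T\<^esub> v = (\<lambda>k. a \<otimes> v k)" by (simp add: FI_free_def)
  have c: "\<forall>k. v k \<in> carrier R" using v unfolding FI_free_carrier by blast
  let ?A = "support R v"
  have A: "finite ?A" "?A \<subseteq> free_basis X T" using v by (auto simp: FI_free_carrier)
  have Kc: "x \<in> carrier (obj W T)" if "x \<in> K T" for x using FI_subgroupD(1)[OF K T that] .
  have tc: "term_at T v k \<in> carrier (obj W T)" if "k \<in> ?A" for k
    using Kc[OF term_in[OF T c]] that A(2) by blast
  have hom: "a \<odot>\<^bsub>obj W T\<^esub> finsum (obj W T) (term_at T v) Q = finsum (obj W T) (\<lambda>k. a \<odot>\<^bsub>obj W T\<^esub> term_at T v k) Q"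
    if "finite Q" "Q \<subseteq> ?A" for Q
    using that
  proof (induction Q)
    case empty
    then show ?case using a by simp
  next
    case (insert k Q)
    have 1: "term_at T v \<in> Q \<rightarrow> carrier (obj W T)" "term_at T v k \<in> carrier (obj W T)"
      using insert.prems tc by blast+
    have 2: "(\<lambda>k. a \<odot>\<^bsub>obj W T\<^esub> term_at T v k) \<in> Q \<rightarrow> carrier (obj W T)" "a \<odot>\<^bsub>obj W T\<^esub> term_at T v k \<in> carrier (obj W T)"
      using 1 a M.smult_closed by blast+
    have "finsum (obj W T) (term_at T v) (insert k Q) = term_at T v k \<oplus>\<^bsub>obj W T\<^esub> finsum (obj W T) (term_at T v) Q"
      using insert.hyps 1 by (intro M.finsum_insert)
    moreover have "finsum (obj W T) (\<lambda>k. a \<odot>\<^bsub>obj W T\<^esub> term_at T v k) (insert k Q) =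
        a \<odot>\<^bsub>obj W T\<^esub> term_at T v k \<oplus>\<^bsub>obj W T\<^esub> finsum (obj W T) (\<lambda>k. a \<odot>\<^bsub>obj W T\<^esub> term_at T v k) Q"
      using insert.hyps 2 by (intro M.finsum_insert)
    moreover have "finsum (obj W T) (term_at T v) Q \<in> carrier (obj W T)" using 1 by (intro M.finsum_closed)
    ultimately show ?case using insert M.smult_r_distr[OF a 1(2)] by simp
  qed
  have "support R (a \<odot>\<^bsub>obj F T\<^esub> v) \<subseteq> ?A" unfolding eq using a by (auto simp: support_def)
  then have "free_ext R W \<eta> T (a \<odot>\<^bsub>obj F T\<^esub> v) = finsum (obj W T) (term_at T (a \<odot>\<^bsub>obj F T\<^esub> v)) ?A"
    by (rule free_ext_superset[OF T av A(1) _ A(2)])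
  also have "\<dots> = finsum (obj W T) (\<lambda>k. a \<odot>\<^bsub>obj W T\<^esub> term_at T v k) ?A"
  proof (rule M.finsum_cong'[OF refl])
    show "(\<lambda>k. a \<odot>\<^bsub>obj W T\<^esub> term_at T v k) \<in> ?A \<rightarrow> carrier (obj W T)" using tc a by blast
    fix k assume k: "k \<in> ?A"
    obtain S z f where kk: "k = (S, z, f)" by (cases k)
    have "mor W S T f (\<eta> z) \<in> carrier (obj W T)" using Kc[OF gen_in[OF T]] k kk A(2) by blast
    then show "term_at T (a \<odot>\<^bsub>obj F T\<^esub> v) k = a \<odot>\<^bsub>obj W T\<^esub> term_at T v k"
      using c a by (simp add: kk eq M.smult_assoc1)
  qed
  also have "\<dots> = a \<odot>\<^bsub>obj W T\<^esub> free_ext R W \<eta> T v"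
    using hom[OF A(1)] by (simp add: free_ext_def)
  finally show ?thesis .
qed

text \<open>Pushing forward along \<open>g\<close> relabels the keys injectively, so the two sums
  agree after reindexing.\<close>

lemma free_ext_mor:
  assumes T: "finite T" "finite U" and g: "g \<in> FI_hom T U" and v: "v \<in> carrier (obj F T)"
  shows "free_ext R W \<eta> U (mor F T U g v) = mor W T U g (free_ext R W \<eta> T v)"
proof -
  interpret M: Module.module R "obj W T" by (rule obj_module) fact
  interpret N: Module.module R "obj W U" by (rule obj_module) fact
  have c: "\<forall>k. v k \<in> carrier R" using v unfolding FI_free_carrier by blast
  let ?A = "support R v" and ?h = "\<lambda>(S, z, f). (S, z, compose S g f)"
  have A: "finite ?A" "?A \<subseteq> free_basis X T" using v by (auto simp: FI_free_carrier)
  have Kc: "x \<in> carrier (obj W T)" if "x \<in> K T" for x using FI_subgroupD(1)[OF K T(1) that] .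
  have KcU: "x \<in> carrier (obj W U)" if "x \<in> K U" for x using FI_subgroupD(1)[OF K T(2) that] .
  have gv: "mor F T U g v \<in> carrier (obj F U)" by (rule FI_free_mor_closed[OF v g])
  have gvc: "\<forall>k. mor F T U g v k \<in> carrier R" using gv unfolding FI_free_carrier by blast
  have hom: "f \<in> FI_hom S T" if "(S, z, f) \<in> ?A" for S z f
    using that A(2) by (auto simp: free_basis_def)
  have inj: "inj_on ?h ?A" by (rule inj_on_compose_key[OF g hom])
  have hA: "?h ` ?A \<subseteq> free_basis X U"
    using A(2) FI_hom_compose[OF _ g] by (auto simp: free_basis_def)
  have supp: "support R (mor F T U g v) \<subseteq> ?h ` ?A"
  proof
    fix k assume k: "k \<in> support R (mor F T U g v)"
    obtain S x h where kk: "k = (S, x, h)" by (cases k)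
    then obtain f where f: "f \<in> FI_hom S T" "h = compose S g f"
      using k FI_free_mor_other[of h S g T X U v x] by (auto simp: support_def)
    then have "(S, x, f) \<in> ?A" using k kk FI_free_mor_compose[OF v g f(1)] by (simp add: support_def)
    then show "k \<in> ?h ` ?A" using kk f by force
  qed
  have "free_ext R W \<eta> U (mor F T U g v) = finsum (obj W U) (term_at U (mor F T U g v)) (?h ` ?A)"
    using A by (intro free_ext_superset[OF T(2) gv _ supp hA]) simp
  also have "\<dots> = finsum (obj W U) (\<lambda>k. term_at U (mor F T U g v) (?h k)) ?A"
    by (rule N.finsum_reindex[OF _ inj]) (use term_in[OF T(2) gvc] hA KcU in blast)
  also have "\<dots> = finsum (obj W U) (\<lambda>k. mor W T U g (term_at T v k)) ?A"
  proof (rule N.finsum_cong'[OF refl])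
    show "(\<lambda>k. mor W T U g (term_at T v k)) \<in> ?A \<rightarrow> carrier (obj W U)"
      using term_in[OF T(1) c] A(2) Kc mor_closed[OF T g] by blast
    fix k assume k: "k \<in> ?A"
    obtain S z f where kk: "k = (S, z, f)" by (cases k)
    have b: "(S, z, f) \<in> free_basis X T" using k kk A(2) by auto
    then have S: "finite S" "f \<in> FI_hom S T" "\<eta> z \<in> carrier (obj W S)"
      using gens FI_subgroupD(1)[OF K] by (auto simp: free_basis_def)
    have m: "mor W S T f (\<eta> z) \<in> carrier (obj W T)" using Kc[OF gen_in[OF T(1) b]] .
    show "term_at U (mor F T U g v) (?h k) = mor W T U g (term_at T v k)"
      using FI_free_mor_compose[OF v g S(2)] mor_comp[OF S(1) T S(2) g S(3)] mor_smult[OF T g _ m] c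
      by (simp add: kk)
  qed
  also have "\<dots> = mor W T U g (finsum (obj W T) (term_at T v) ?A)"
    by (rule mor_finsum[OF T g A(1), symmetric]) (use term_in[OF T(1) c] A(2) Kc in blast)
  finally show ?thesis by (simp add: free_ext_def)
qed

lemma FI_map_free_ext: "FI_map R F W (free_ext R W \<eta>)"
proof (intro FI_map.intro FI_map_axioms.intro FI_module_FI_free FI_module_axioms)
  show "free_ext R W \<eta> S x \<in> carrier (obj W S)" if "finite S" "x \<in> carrier (obj F S)" for S x
    using FI_subgroupD(1)[OF K that(1) free_ext_in[OF that]] .
qed (use free_ext_add free_ext_mor in auto)

lemma free_ext_generator:
  assumes S: "finite S" and z: "z \<in> X S"
  shows "(\<lambda>k. if k = (S, z, \<lambda>s\<in>S. s) then \<one> else \<zero>) \<in> carrier (obj F S)"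
    and "free_ext R W \<eta> S (\<lambda>k. if k = (S, z, \<lambda>s\<in>S. s) then \<one> else \<zero>) = \<eta> z"
proof -
  interpret M: Module.module R "obj W S" by (rule obj_module) fact
  let ?k = "(S, z, \<lambda>s\<in>S. s)" and ?v = "\<lambda>k. if k = (S, z, \<lambda>s\<in>S. s) then \<one> else \<zero>"
  have "(\<lambda>s\<in>S. s) \<in> FI_hom S S" by (auto simp: FI_hom_def inj_on_def)
  then have b: "{?k} \<subseteq> free_basis X S" using S z by (simp add: free_basis_def)
  have supp: "support R ?v \<subseteq> {?k}" by (auto simp: support_def)
  show v: "?v \<in> carrier (obj F S)"
    unfolding FI_free_carrier using supp b finite_subset[OF supp] by auto
  have c: "\<eta> z \<in> carrier (obj W S)" using FI_subgroupD(1)[OF K S gens[OF S z]] .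
  have "free_ext R W \<eta> S ?v = finsum (obj W S) (term_at S ?v) {?k}"
    by (rule free_ext_superset[OF S v _ supp b]) simp
  also have "\<dots> = \<eta> z" using c mor_id[OF S c] by simp
  finally show "free_ext R W \<eta> S ?v = \<eta> z" .
qed

end

section \<open>Cosets and the quotient H_0\<close>

lemma (in abelian_group) additive_subgroupI_minus:
  assumes H: "H \<subseteq> carrier G" "\<zero> \<in> H" "\<And>x y. x \<in> H \<Longrightarrow> y \<in> H \<Longrightarrow> x \<ominus> y \<in> H"
  shows "additive_subgroup H G"
proof -
  have inv: "\<ominus> x \<in> H" if "x \<in> H" for x
    using H(3)[OF H(2) that] H(1) that by (auto simp: minus_eq)
  have "x \<oplus> y \<in> H" if "x \<in> H" "y \<in> H" for x y
    using H(3)[OF that(1) inv[OF that(2)]] H(1) that by (auto simp: minus_eq)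
  with inv H show ?thesis
    by (intro additive_subgroupI add.subgroupI) auto
qed

lemma (in abelian_subgroup) a_rcos_eq_iff:
  assumes "x \<in> carrier G" "y \<in> carrier G"
  shows "H +> x = H +> y \<longleftrightarrow> x \<ominus> y \<in> H"
  using assms a_rcos_module[of y x] a_repr_independence'[of x y] a_rcos_self[of x]
  by (auto simp: minus_eq)

lemma (in abelian_subgroup) a_rcos_eq_self_iff:
  "x \<in> carrier G \<Longrightarrow> H +> x = H \<longleftrightarrow> x \<in> H"
  using a_rcos_const[of x] a_rcos_self[of x] by auto

text \<open>A double quotient (Y/H)/(L/H) is trivial exactly if Y lies in L + H. The left-hand side
  is the set of cosets of cosets that appears when the definition of homology is unfolded.\<close>

lemma (in abelian_subgroup) quotient_of_cosets_trivial_iff: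
  assumes L: "additive_subgroup L G" and Y: "Y \<subseteq> carrier G" "Y \<noteq> {}"
  shows "(\<Union>C\<in>(\<lambda>x. H +> x) ` Y. {\<Union>h\<in>(\<lambda>x. H +> x) ` L. {h <+>\<^bsub>G\<^esub> C}}) = {(\<lambda>x. H +> x) ` L} \<longleftrightarrow>
    (\<forall>x\<in>Y. \<exists>\<kappa>\<in>L. x \<ominus> \<kappa> \<in> H)" (is "?lhs \<longleftrightarrow> ?rhs")
proof -
  interpret L: additive_subgroup L G by fact
  have Lc: "\<kappa> \<in> carrier G" if "\<kappa> \<in> L" for \<kappa> using L.a_subset that by blast
  let ?q = "\<lambda>x. H +> x"
  have coset: "(\<Union>h\<in>?q ` L. {h <+>\<^bsub>G\<^esub> ?q x}) = (\<lambda>\<kappa>. ?q (\<kappa> \<oplus> x)) ` L" if "x \<in> Y" for x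
  proof -
    have "(\<Union>h\<in>?q ` L. {h <+>\<^bsub>G\<^esub> ?q x}) = (\<lambda>\<kappa>. ?q \<kappa> <+>\<^bsub>G\<^esub> ?q x) ` L" by blast
    also have "\<dots> = (\<lambda>\<kappa>. ?q (\<kappa> \<oplus> x)) ` L"
    proof (rule image_cong[OF refl])
      fix \<kappa> assume "\<kappa> \<in> L"
      then show "?q \<kappa> <+>\<^bsub>G\<^esub> ?q x = ?q (\<kappa> \<oplus> x)" using a_rcos_sum[OF Lc] that Y(1) by blast
    qed
    finally show ?thesis .
  qed
  have iff: "(\<lambda>\<kappa>. ?q (\<kappa> \<oplus> x)) ` L = ?q ` L \<longleftrightarrow> (\<exists>\<kappa>\<in>L. x \<ominus> \<kappa> \<in> H)" if x: "x \<in> Y" for x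
  proof
    have xc: "x \<in> carrier G" using x Y by blast
    assume "(\<lambda>\<kappa>. ?q (\<kappa> \<oplus> x)) ` L = ?q ` L"
    moreover have "?q (\<zero> \<oplus> x) \<in> (\<lambda>\<kappa>. ?q (\<kappa> \<oplus> x)) ` L" using L.zero_closed by blast
    ultimately obtain \<kappa> where "\<kappa> \<in> L" "?q x = ?q \<kappa>" using xc by auto
    then show "\<exists>\<kappa>\<in>L. x \<ominus> \<kappa> \<in> H" using a_rcos_eq_iff[OF xc Lc] by blast
  next
    have xc: "x \<in> carrier G" using x Y by blast
    assume "\<exists>\<kappa>\<in>L. x \<ominus> \<kappa> \<in> H"
    then obtain \<kappa> where \<kappa>: "\<kappa> \<in> L" "?q x = ?q \<kappa>" using a_rcos_eq_iff[OF xc Lc] by blast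
    have eq: "?q (\<mu> \<oplus> x) = ?q (\<mu> \<oplus> \<kappa>)" if "\<mu> \<in> L" for \<mu>
      using a_rcos_sum[OF Lc[OF that] xc] a_rcos_sum[OF Lc[OF that] Lc[OF \<kappa>(1)]] \<kappa>(2) by simp
    show "(\<lambda>\<kappa>. ?q (\<kappa> \<oplus> x)) ` L = ?q ` L"
    proof (intro equalityI subsetI)
      fix C assume "C \<in> (\<lambda>\<kappa>. ?q (\<kappa> \<oplus> x)) ` L"
      then obtain \<mu> where \<mu>: "\<mu> \<in> L" "C = ?q (\<mu> \<oplus> x)" by blast
      then have "C = ?q (\<mu> \<oplus> \<kappa>)" using eq by simp
      moreover have "\<mu> \<oplus> \<kappa> \<in> L" using \<mu> \<kappa> by simp
      ultimately show "C \<in> ?q ` L" by blast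
    next
      fix C assume "C \<in> ?q ` L"
      then obtain \<mu> where \<mu>: "\<mu> \<in> L" "C = ?q \<mu>" by blast
      have m: "\<mu> \<oplus> \<ominus> \<kappa> \<in> L" using \<mu> \<kappa> by simp
      have "(\<mu> \<oplus> \<ominus> \<kappa>) \<oplus> \<kappa> = \<mu>" using Lc \<mu> \<kappa> by (simp add: a_assoc l_neg)
      then have "C = ?q ((\<mu> \<oplus> \<ominus> \<kappa>) \<oplus> x)" using eq[OF m] \<mu> by simp
      with m show "C \<in> (\<lambda>\<kappa>. ?q (\<kappa> \<oplus> x)) ` L" by blast
    qed
  qed
  have single: "F ` Y = {c} \<longleftrightarrow> (\<forall>x\<in>Y. F x = c)" for F :: "'a \<Rightarrow> 'a set set" and c
    using Y(2) by blast
  have "(\<Union>C\<in>?q ` Y. {\<Union>h\<in>?q ` L. {h <+>\<^bsub>G\<^esub> C}}) = (\<lambda>x. \<Union>h\<in>?q ` L. {h <+>\<^bsub>G\<^esub> ?q x}) ` Y"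
    by blast
  also have "\<dots> = (\<lambda>x. (\<lambda>\<kappa>. ?q (\<kappa> \<oplus> x)) ` L) ` Y"
    by (rule image_cong[OF refl coset])
  finally have "?lhs \<longleftrightarrow> (\<forall>x\<in>Y. (\<lambda>\<kappa>. ?q (\<kappa> \<oplus> x)) ` L = ?q ` L)"
    by (simp only: single)
  also have "\<dots> \<longleftrightarrow> ?rhs" using iff by simp
  finally show ?thesis .
qed

context FI_module begin

lemma additive_subgroup_FI:
  assumes "FI_subgroup K" "finite S" shows "additive_subgroup (K S) (obj V S)"
proof -
  interpret A: abelian_group "obj V S" by (rule abelian) fact
  show ?thesis using FI_subgroupD[OF assms] by (intro A.additive_subgroupI_minus) blast+
qed

lemma additive_subgroup_image_span:
  assumes K: "FI_subgroup K" and S: "finite S"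
  shows "additive_subgroup (image_span V K S) (obj V S)"
proof -
  interpret A: abelian_group "obj V S" by (rule abelian) fact
  have car: "x \<in> carrier (obj V S)" if "x \<in> image_span V K S" for x
    using image_span_subset[OF K S that] FI_subgroupD(1)[OF K S] by blast
  show ?thesis
  proof (rule A.additive_subgroupI_minus)
    fix x y assume x: "x \<in> image_span V K S" and "y \<in> image_span V K S"
    from this(2) show "x \<ominus>\<^bsub>obj V S\<^esub> y \<in> image_span V K S"
    proof induction
      case zero
      have "\<ominus>\<^bsub>obj V S\<^esub> \<zero>\<^bsub>obj V S\<^esub> = \<zero>\<^bsub>obj V S\<^esub>"
        by (rule A.minus_equality) simp_all
      then have "x \<ominus>\<^bsub>obj V S\<^esub> \<zero>\<^bsub>obj V S\<^esub> = x" using car[OF x] by (simp add: A.minus_eq)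
      with x show ?case by simp
    next
      case (add y A f v)
      interpret C: abelian_group "obj V A" by (rule abelian) fact
      have v: "v \<in> carrier (obj V A)" using FI_subgroupD(1)[OF K add(2) add(5)] .
      have nv: "\<zero>\<^bsub>obj V A\<^esub> \<ominus>\<^bsub>obj V A\<^esub> v \<in> K A"
        using FI_subgroupD(3)[OF K add(2) FI_subgroupD(2)[OF K add(2)] add(5)] .
      have m: "mor V A S f v \<in> carrier (obj V S)" using mor_closed[OF add(2) S add(4) v] .
      have "mor V A S f (\<zero>\<^bsub>obj V A\<^esub> \<ominus>\<^bsub>obj V A\<^esub> v) = \<ominus>\<^bsub>obj V S\<^esub> mor V A S f v"
        using mor_diff[OF add(2) S add(4) C.zero_closed v] mor_zero[OF add(2) S add(4)] m by (simp add: A.minus_eq)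
      moreover have "x \<ominus>\<^bsub>obj V S\<^esub> (y \<oplus>\<^bsub>obj V S\<^esub> mor V A S f v) = (x \<ominus>\<^bsub>obj V S\<^esub> y) \<oplus>\<^bsub>obj V S\<^esub> \<ominus>\<^bsub>obj V S\<^esub> mor V A S f v"
        using car[OF x] car[OF add(1)] m by (simp add: A.minus_eq A.minus_add A.a_assoc)
      ultimately show ?case using image_span.add[OF add.IH add(2-4) nv] by simp
    qed
  qed (use car in \<open>auto intro: image_span.zero\<close>)
qed

lemma abelian_subgroup_proper_image:
  assumes "finite S" shows "abelian_subgroup (proper_image V S) (obj V S)"
  using additive_subgroup_image_span[OF FI_subgroup_all assms] abelian[OF assms]
  unfolding image_span_eq_proper_image[OF assms] by (rule abelian_subgroupI3)

lemma carrier_FI_H0: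
  "carrier (obj (FI_H0 V) S) = (\<lambda>x. proper_image V S +>\<^bsub>obj V S\<^esub> x) ` carrier (obj V S)"
  by (auto simp: FI_H0_def FI_quot_def quot_module_def A_RCOSETS_def')

lemma zero_FI_H0: "\<zero>\<^bsub>obj (FI_H0 V) S\<^esub> = proper_image V S"
  by (simp add: FI_H0_def FI_quot_def quot_module_def)

lemma add_FI_H0: "(\<oplus>\<^bsub>obj (FI_H0 V) S\<^esub>) = (<+>\<^bsub>obj V S\<^esub>)"
  by (simp add: FI_H0_def FI_quot_def quot_module_def)

lemma zero_at_FI_H0_iff:
  assumes S: "finite S"
  shows "zero_at (FI_H0 V) S \<longleftrightarrow> carrier (obj V S) \<subseteq> image_span V all_values S"
proof -
  interpret D: abelian_subgroup "proper_image V S" "obj V S" by (rule abelian_subgroup_proper_image) fact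
  have "zero_at (FI_H0 V) S \<longleftrightarrow> (\<forall>x\<in>carrier (obj V S). proper_image V S +>\<^bsub>obj V S\<^esub> x = proper_image V S)"
    unfolding zero_at_def carrier_FI_H0 zero_FI_H0 using D.zero_closed D.a_subset by blast
  also have "\<dots> \<longleftrightarrow> (\<forall>x\<in>carrier (obj V S). x \<in> proper_image V S)"
    using D.a_rcos_eq_self_iff by blast
  finally show ?thesis unfolding image_span_eq_proper_image[OF S] by blast
qed

end

context FI_map begin

lemma map_proper_image: "finite S \<Longrightarrow> x \<in> proper_image V S \<Longrightarrow> \<phi> S x \<in> proper_image W S"
  using map_image_span_subset[where L = cod.all_values, OF _ map_closed]
  by (simp add: dom.image_span_eq_proper_image cod.image_span_eq_proper_image)

lemma FI_H0_map_coset: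
  assumes S: "finite S" and x: "x \<in> carrier (obj V S)"
  shows "FI_H0_map W \<phi> S (proper_image V S +>\<^bsub>obj V S\<^esub> x) = proper_image W S +>\<^bsub>obj W S\<^esub> \<phi> S x"
proof -
  interpret D: abelian_subgroup "proper_image V S" "obj V S" by (rule dom.abelian_subgroup_proper_image) fact
  interpret E: abelian_subgroup "proper_image W S" "obj W S" by (rule cod.abelian_subgroup_proper_image) fact
  have "proper_image W S +>\<^bsub>obj W S\<^esub> \<phi> S y = proper_image W S +>\<^bsub>obj W S\<^esub> \<phi> S x"
    if y: "y \<in> proper_image V S +>\<^bsub>obj V S\<^esub> x" for y
  proof -
    obtain d where d: "d \<in> proper_image V S" "y = d \<oplus>\<^bsub>obj V S\<^esub> x" using y by (auto simp: a_r_coset_def')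
    have dc: "d \<in> carrier (obj V S)" using d D.a_subset by blast
    have "y \<in> carrier (obj V S)" using d dc x by simp
    moreover have "y \<ominus>\<^bsub>obj V S\<^esub> x = d" using d dc x by (simp add: D.minus_eq D.a_assoc D.r_neg)
    ultimately have "\<phi> S y \<ominus>\<^bsub>obj W S\<^esub> \<phi> S x \<in> proper_image W S"
      using map_diff[OF S _ x, of y] map_proper_image[OF S d(1)] by simp
    then show ?thesis using E.a_rcos_eq_iff map_closed[OF S] \<open>y \<in> carrier (obj V S)\<close> x by simp
  qed
  moreover have "x \<in> proper_image V S +>\<^bsub>obj V S\<^esub> x" using D.a_rcos_self[OF x] .
  ultimately show ?thesis unfolding FI_H0_map_def by blast
qed

end

text \<open>Off its support a function is zero, so its graph over the support determines it.\<close>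

lemma encode_inj: "inj_on (encode R) {v. finite (support R v)}"
proof (rule inj_onI)
  fix u v :: "('a, 'b) label key \<Rightarrow> 'b"
  assume uv: "u \<in> {v. finite (support R v)}" "v \<in> {v. finite (support R v)}" "encode R u = encode R v"
  let ?A = "\<lambda>u. (\<lambda>k. (k, u k)) ` support R u"
  have "Abs_fset (?A u) = Abs_fset (?A v)" using uv(3) by (simp add: encode_def)
  then have eq: "?A u = ?A v" using uv(1,2) by (subst (asm) Abs_fset_inject) auto
  show "u = v"
  proof
    fix k
    have "(k, u k) \<in> ?A v" if "k \<in> support R u" using eq that by blast
    moreover have "(k, v k) \<in> ?A u" if "k \<in> support R v" using eq that by blast
    ultimately show "u k = v k"
      by (cases "k \<in> support R u"; cases "k \<in> support R v") (auto simp: support_def)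
  qed
qed

lemma decode_encode: "finite (support R v) \<Longrightarrow> decode R (encode R v) = v"
  unfolding decode_def by (rule inv_into_f_f[OF encode_inj]) simp

context free_extension begin

lemma kernel_smult:
  assumes S: "finite S" and a: "a \<in> carrier R" and v: "v \<in> carrier (obj F S)" "free_ext R W \<eta> S v = \<zero>\<^bsub>obj W S\<^esub>"
  shows "a \<odot>\<^bsub>obj F S\<^esub> v \<in> carrier (obj F S)" "free_ext R W \<eta> S (a \<odot>\<^bsub>obj F S\<^esub> v) = \<zero>\<^bsub>obj W S\<^esub>"
proof -
  interpret M: Module.module R "obj W S" by (rule obj_module) fact
  interpret N: Module.module R "obj F S" by (rule module_FI_free)
  show "a \<odot>\<^bsub>obj F S\<^esub> v \<in> carrier (obj F S)" using a v by simp
  show "free_ext R W \<eta> S (a \<odot>\<^bsub>obj F S\<^esub> v) = \<zero>\<^bsub>obj W S\<^esub>"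
    using free_ext_smult[OF S a v(1)] v(2) a by simp
qed

lemma FI_subgroup_kernel:
  "FI_module.FI_subgroup F (\<lambda>S. {v \<in> carrier (obj F S). free_ext R W \<eta> S v = \<zero>\<^bsub>obj W S\<^esub>})"
proof -
  interpret M: FI_map R F W "free_ext R W \<eta>" by (rule FI_map_free_ext)
  show ?thesis using M.FI_subgroup_kernel unfolding M.kernel_def[abs_def] .
qed

end

section \<open>Exactness of the canonical resolution\<close>

context FI_module begin

abbreviation augment :: "nat set \<Rightarrow> ('m, 'r) chain \<Rightarrow> 'm" where
  "augment \<equiv> free_ext R V (\<lambda>x. case x of Elt v \<Rightarrow> v)"

text \<open>The syzygy with index \<open>q + 1\<close>, treating the augmentation and the
  differentials uniformly.\<close>

definition res_kernel :: "nat \<Rightarrow> nat set \<Rightarrow> ('m, 'r) chain set" where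
  "res_kernel q S = (case q of
      0 \<Rightarrow> {v \<in> carrier (obj (res R V 0) S). augment S v = \<zero>\<^bsub>obj V S\<^esub>}
    | Suc p \<Rightarrow> {v \<in> carrier (obj (res R V (Suc p)) S). res_diff R V p S v = \<zero>\<^bsub>obj (res R V p) S\<^esub>})"

lemma res_gens_Suc: "res_gens R V (Suc q) S = encode R ` res_kernel q S"
  by (cases q) (simp_all add: res_kernel_def res_def res_diff_def)

lemma FI_module_res: "FI_module R (res R V q)"
  unfolding res_def by (rule FI_module_FI_free)

lemma augment_extension: "free_extension R V (res_gens R V 0) (\<lambda>x. case x of Elt v \<Rightarrow> v) all_values"
proof (intro free_extension.intro FI_module_axioms free_extension_axioms.intro FI_subgroup_all)
  fix S :: "nat set" and a x assume "finite S" "a \<in> carrier R" "x \<in> all_values S"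
  then show "a \<odot>\<^bsub>obj V S\<^esub> x \<in> all_values S" using Module.module.smult_closed[OF obj_module] by blast
qed auto

text \<open>The two statements depend on each other: the extension into the \<open>q\<close>-th
  kernel needs that kernel to be a submodule, and the next kernel is a submodule because it is the
  kernel of this extension.\<close>

lemma res_kernel_FI_subgroup:
  "FI_module.FI_subgroup (res R V q) (res_kernel q) \<and>
    (\<forall>S a x. finite S \<longrightarrow> a \<in> carrier R \<longrightarrow> x \<in> res_kernel q S \<longrightarrow> a \<odot>\<^bsub>obj (res R V q) S\<^esub> x \<in> res_kernel q S)"
    (is "?P q")
  and res_extension: "free_extension R (res R V q) (res_gens R V (Suc q)) (decode R) (res_kernel q)"
proof -
  have ext: "free_extension R (res R V q) (res_gens R V (Suc q)) (decode R) (res_kernel q)" if P: "?P q" for q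
  proof (intro free_extension.intro FI_module_res free_extension_axioms.intro)
    fix S :: "nat set" and z assume S: "finite S" and "z \<in> res_gens R V (Suc q) S"
    then obtain v where v: "v \<in> res_kernel q S" "z = encode R v" by (auto simp: res_gens_Suc)
    then have "v \<in> carrier (obj (res R V q) S)" by (cases q) (auto simp: res_kernel_def)
    then have "finite (support R v)" unfolding res_def by (simp add: FI_free_carrier)
    then show "decode R z \<in> res_kernel q S" using v by (simp add: decode_encode)
  qed (use P in auto)
  have P: "?P q" for q
  proof (induction q)
    case 0
    interpret E: free_extension R V "res_gens R V 0" "\<lambda>x. case x of Elt v \<Rightarrow> v" all_values
      by (rule augment_extension)
    show ?case using E.FI_subgroup_kernel E.kernel_smult unfolding res_kernel_def res_def by simp
  next
    case (Suc q)
    interpret E: free_extension R "res R V q" "res_gens R V (Suc q)" "decode R" "res_kernel q"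
      by (rule ext[OF Suc])
    show ?case using E.FI_subgroup_kernel E.kernel_smult unfolding res_kernel_def res_diff_def
      by (simp add: res_def)
  qed
  show "?P q" by (rule P)
  show "free_extension R (res R V q) (res_gens R V (Suc q)) (decode R) (res_kernel q)" by (rule ext[OF P])
qed

lemma FI_map_augment: "FI_map R (res R V 0) V augment"
  unfolding res_def by (rule free_extension.FI_map_free_ext[OF augment_extension])

lemma FI_map_res_diff: "FI_map R (res R V (Suc q)) (res R V q) (res_diff R V q)"
  using free_extension.FI_map_free_ext[OF res_extension] unfolding res_diff_def by (simp add: res_def)

lemma augment_surj:
  assumes S: "finite S" shows "augment S ` carrier (obj (res R V 0) S) = carrier (obj V S)"
proof (intro equalityI subsetI)
  interpret E: free_extension R V "res_gens R V 0" "\<lambda>x. case x of Elt v \<Rightarrow> v" all_values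
    by (rule augment_extension)
  show "y \<in> carrier (obj V S)" if "y \<in> augment S ` carrier (obj (res R V 0) S)" for y
    using that E.free_ext_in[OF S] unfolding res_def by auto
  fix y assume "y \<in> carrier (obj V S)"
  then have "Elt y \<in> res_gens R V 0 S" by simp
  note gen = E.free_ext_generator[OF S this]
  show "y \<in> augment S ` carrier (obj (res R V 0) S)"
    unfolding res_def by (rule image_eqI[OF _ gen(1)]) (simp only: gen(2) label.case)
qed

text \<open>Each element of the kernel is the image of the generator labelled by its own code, so
  exactness is built into the resolution.\<close>

lemma res_diff_image:
  assumes S: "finite S" shows "res_diff R V q S ` carrier (obj (res R V (Suc q)) S) = res_kernel q S"
proof (intro equalityI subsetI)
  interpret E: free_extension R "res R V q" "res_gens R V (Suc q)" "decode R" "res_kernel q"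
    by (rule res_extension)
  show "y \<in> res_kernel q S" if "y \<in> res_diff R V q S ` carrier (obj (res R V (Suc q)) S)" for y
    using that E.free_ext_in[OF S] unfolding res_diff_def by (auto simp: res_def)
  fix y assume y: "y \<in> res_kernel q S"
  then have "y \<in> carrier (obj (res R V q) S)" by (cases q) (auto simp: res_kernel_def)
  then have "finite (support R y)" unfolding res_def by (simp add: FI_free_carrier)
  then have d: "decode R (encode R y) = y" by (rule decode_encode)
  have "encode R y \<in> res_gens R V (Suc q) S" using y by (simp add: res_gens_Suc)
  note gen = E.free_ext_generator[OF S this]
  show "y \<in> res_diff R V q S ` carrier (obj (res R V (Suc q)) S)"
    unfolding res_diff_def res_def[of R V "Suc q"]
    by (rule image_eqI[OF _ gen(1)]) (simp only: gen(2) d)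
qed

end

section \<open>FI-homology as Koszul exactness\<close>

lemma zero_at_subquotient:
  "zero_at (FI_quot (FI_sub W Y) N) S \<longleftrightarrow> (\<Union>C\<in>Y S. {\<Union>h\<in>N S. {h \<oplus>\<^bsub>obj W S\<^esub> C}}) = {N S}"
  by (simp add: zero_at_def FI_quot_def FI_sub_def quot_module_def A_RCOSETS_def' a_r_coset_def')

context FI_module begin

text \<open>Let P be term \<open>q\<close> and K its kernel. The next term maps onto K, so by right
  exactness of H_0 the cycles modulo boundaries become the kernel of H_0(K) -> H_0(P), which is what
  the two spans compare.\<close>

lemma zero_at_FI_homology_iff:
  assumes S: "finite S"
  shows "zero_at (FI_homology R V (Suc q)) S \<longleftrightarrow>
    image_span (res R V q) (\<lambda>S. carrier (obj (res R V q) S)) S \<inter> res_kernel q S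
      \<subseteq> image_span (res R V q) (res_kernel q) S"
proof -
  let ?P = "res R V (Suc q)" and ?P' = "res R V q" and ?P2 = "res R V (Suc (Suc q))"
  let ?d = "res_diff R V q S" and ?d2 = "res_diff R V (Suc q) S"
  interpret M: FI_map R ?P ?P' "res_diff R V q" by (rule FI_map_res_diff)
  interpret M2: FI_map R ?P2 ?P "res_diff R V (Suc q)" by (rule FI_map_res_diff)
  let ?D = "proper_image ?P S" and ?D' = "proper_image ?P' S"
  interpret D: abelian_subgroup ?D "obj ?P S" by (rule M.dom.abelian_subgroup_proper_image) fact
  interpret D': abelian_subgroup ?D' "obj ?P' S" by (rule M.cod.abelian_subgroup_proper_image) fact
  have K: "M.cod.FI_subgroup (res_kernel q)" and K1: "M.dom.FI_subgroup (res_kernel (Suc q))"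
    using res_kernel_FI_subgroup by blast+
  let ?q = "\<lambda>x. ?D +>\<^bsub>obj ?P S\<^esub> x"
  define Y where "Y = {x \<in> carrier (obj ?P S). ?d x \<in> ?D'}"
  have ker: "x \<in> res_kernel (Suc q) S \<longleftrightarrow> x \<in> carrier (obj ?P S) \<and> ?d x = \<zero>\<^bsub>obj ?P' S\<^esub>" for x
    by (simp add: res_kernel_def)
  have coset: "FI_H0_map ?P' (res_diff R V q) S (?q x) = \<zero>\<^bsub>obj (FI_H0 ?P') S\<^esub> \<longleftrightarrow> ?d x \<in> ?D'"
    if "x \<in> carrier (obj ?P S)" for x
    unfolding M.FI_H0_map_coset[OF S that] M.cod.zero_FI_H0
    by (rule D'.a_rcos_eq_self_iff) (rule M.map_closed[OF S that])
  have cyc: "H0_cycles R V (Suc q) S = ?q ` Y"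
    unfolding H0_cycles.simps M.dom.carrier_FI_H0 Y_def using coset by blast
  have bd: "H0_boundaries R V (Suc q) S = ?q ` res_kernel (Suc q) S"
  proof -
    have "H0_boundaries R V (Suc q) S = (\<lambda>x. FI_H0_map ?P (res_diff R V (Suc q)) S (proper_image ?P2 S +>\<^bsub>obj ?P2 S\<^esub> x)) ` carrier (obj ?P2 S)"
      unfolding H0_boundaries_def M2.dom.carrier_FI_H0 image_image ..
    also have "\<dots> = (\<lambda>x. ?q (?d2 x)) ` carrier (obj ?P2 S)"
      by (rule image_cong[OF refl M2.FI_H0_map_coset[OF S]])
    also have "\<dots> = ?q ` res_kernel (Suc q) S"
      unfolding res_diff_image[OF S, of "Suc q", symmetric] image_image ..
    finally show ?thesis .
  qed
  have "zero_at (FI_homology R V (Suc q)) S \<longleftrightarrow>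
      (\<Union>C\<in>?q ` Y. {\<Union>h\<in>?q ` res_kernel (Suc q) S. {h <+>\<^bsub>obj ?P S\<^esub> C}}) = {?q ` res_kernel (Suc q) S}"
    unfolding FI_homology_def zero_at_subquotient cyc bd M.dom.add_FI_H0 ..
  also have "\<dots> \<longleftrightarrow> (\<forall>x\<in>Y. \<exists>\<kappa>\<in>res_kernel (Suc q) S. x \<ominus>\<^bsub>obj ?P S\<^esub> \<kappa> \<in> ?D)"
  proof (rule D.quotient_of_cosets_trivial_iff)
    show "additive_subgroup (res_kernel (Suc q) S) (obj ?P S)" by (rule M.dom.additive_subgroup_FI[OF K1 S])
    have "\<zero>\<^bsub>obj ?P S\<^esub> \<in> Y" using M.map_zero[OF S] D'.zero_closed by (simp add: Y_def)
    then show "Y \<noteq> {}" by blast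
  qed (auto simp: Y_def)
  \<comment> \<open>The differential identifies the term modulo \<open>res_kernel (Suc q)\<close>
    with \<open>res_kernel q\<close>, so the free choice of \<kappa> disappears on passing to
    images.\<close>
  also have "\<dots> \<longleftrightarrow> ?D' \<inter> res_kernel q S \<subseteq> ?d ` ?D"
  proof
    assume L: "\<forall>x\<in>Y. \<exists>\<kappa>\<in>res_kernel (Suc q) S. x \<ominus>\<^bsub>obj ?P S\<^esub> \<kappa> \<in> ?D"
    show "?D' \<inter> res_kernel q S \<subseteq> ?d ` ?D"
    proof
      fix y assume y: "y \<in> ?D' \<inter> res_kernel q S"
      then obtain x where x: "x \<in> carrier (obj ?P S)" "y = ?d x"
        unfolding res_diff_image[OF S, symmetric] by blast
      then have "x \<in> Y" using y by (simp add: Y_def)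
      with L obtain \<kappa> where \<kappa>: "\<kappa> \<in> res_kernel (Suc q) S" "x \<ominus>\<^bsub>obj ?P S\<^esub> \<kappa> \<in> ?D" by blast
      then have kc: "\<kappa> \<in> carrier (obj ?P S)" "?d \<kappa> = \<zero>\<^bsub>obj ?P' S\<^esub>" using ker by auto
      have "?d (x \<ominus>\<^bsub>obj ?P S\<^esub> \<kappa>) = ?d x \<ominus>\<^bsub>obj ?P' S\<^esub> \<zero>\<^bsub>obj ?P' S\<^esub>"
        using M.map_diff[OF S x(1) kc(1)] kc(2) by simp
      also have "\<dots> = ?d x \<ominus>\<^bsub>obj ?P' S\<^esub> (?d x \<ominus>\<^bsub>obj ?P' S\<^esub> ?d x)"
        using D'.minus_eq_zero_iff[of "?d x" "?d x"] M.map_closed[OF S x(1)] by simp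
      also have "\<dots> = ?d x"
        using M.map_closed[OF S x(1)] by (simp add: D'.minus_eq D'.minus_add D'.a_assoc D'.r_neg)
      finally show "y \<in> ?d ` ?D" using \<kappa>(2) x(2) by (metis image_eqI)
    qed
  next
    assume R: "?D' \<inter> res_kernel q S \<subseteq> ?d ` ?D"
    show "\<forall>x\<in>Y. \<exists>\<kappa>\<in>res_kernel (Suc q) S. x \<ominus>\<^bsub>obj ?P S\<^esub> \<kappa> \<in> ?D"
    proof
      fix x assume "x \<in> Y"
      then have x: "x \<in> carrier (obj ?P S)" "?d x \<in> ?D'" by (auto simp: Y_def)
      then have "?d x \<in> res_kernel q S" unfolding res_diff_image[OF S, symmetric] by blast
      then obtain \<epsilon> where e: "\<epsilon> \<in> ?D" "?d x = ?d \<epsilon>" using R x(2) by blast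
      have ec: "\<epsilon> \<in> carrier (obj ?P S)" using e(1) D.a_subset by blast
      have "?d (x \<ominus>\<^bsub>obj ?P S\<^esub> \<epsilon>) = \<zero>\<^bsub>obj ?P' S\<^esub>"
        using M.map_diff[OF S x(1) ec] e(2) D'.minus_eq_zero_iff[OF M.map_closed[OF S ec] M.map_closed[OF S ec]] by simp
      then have k: "x \<ominus>\<^bsub>obj ?P S\<^esub> \<epsilon> \<in> res_kernel (Suc q) S" using ker x(1) ec by simp
      have "x \<ominus>\<^bsub>obj ?P S\<^esub> (x \<ominus>\<^bsub>obj ?P S\<^esub> \<epsilon>) = \<epsilon>"
        using x(1) ec by (simp add: D.minus_eq D.minus_add D.a_assoc[symmetric] D.r_neg)
      with k e(1) show "\<exists>\<kappa>\<in>res_kernel (Suc q) S. x \<ominus>\<^bsub>obj ?P S\<^esub> \<kappa> \<in> ?D" by (metis)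
    qed
  qed
  also have "?d ` ?D = image_span ?P' (res_kernel q) S"
    using M.map_image_span[OF res_diff_image S] unfolding M.dom.image_span_eq_proper_image[OF S] .
  finally show ?thesis unfolding M.cod.image_span_eq_proper_image[OF S] .
qed

abbreviation res_exact :: "nat \<Rightarrow> nat \<Rightarrow> int \<Rightarrow> bool" where
  "res_exact q \<equiv> FI_module.FI_exact (res R V q) (\<lambda>S. carrier (obj (res R V q) S)) (res_kernel q)"

lemma res_acyclic:
  "i \<ge> 1 \<Longrightarrow> FI_module.FI_exact (res R V q) (\<lambda>S. carrier (obj (res R V q) S)) (\<lambda>S. {\<zero>\<^bsub>obj (res R V q) S\<^esub>}) n i"
  unfolding res_def by (rule FI_free_acyclic)

lemma res_exact_0_iff: "res_exact 0 n i \<longleftrightarrow> FI_exact all_values zero_values n i"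
proof -
  interpret M: FI_map R "res R V 0" V augment by (rule FI_map_augment)
  have "res_kernel 0 = M.kernel" by (auto simp: fun_eq_iff res_kernel_def M.kernel_def)
  then show ?thesis using M.FI_exact_kernel_iff[OF FI_subgroup_all augment_surj] by simp
qed

text \<open>Term \<open>q\<close> is acyclic, so its quotient by the kernel has as H_(i+1) the H_i
  of that kernel; and the kernel is in turn the quotient of the next term by the next
  kernel.\<close>

lemma res_exact_shift: "i \<ge> 1 \<Longrightarrow> res_exact q n (i + 1) \<longleftrightarrow> res_exact (Suc q) n i"
proof -
  assume i: "i \<ge> 1"
  interpret M: FI_map R "res R V (Suc q)" "res R V q" "res_diff R V q" by (rule FI_map_res_diff)
  have K: "M.cod.FI_subgroup (res_kernel q)" using res_kernel_FI_subgroup by blast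
  have "res_kernel (Suc q) = M.kernel" by (auto simp: fun_eq_iff res_kernel_def M.kernel_def)
  then have "res_exact (Suc q) n i \<longleftrightarrow> M.cod.FI_exact (res_kernel q) M.cod.zero_values n i"
    using M.FI_exact_kernel_iff[OF K res_diff_image] by simp
  moreover have "res_exact q n (i + 1) \<longleftrightarrow> M.cod.FI_exact (res_kernel q) M.cod.zero_values n i"
    by (rule M.cod.FI_exact_dimension_shift[OF K res_acyclic i])
  ultimately show ?thesis by simp
qed

lemma res_exact_iterated_shift: "i \<ge> 1 \<Longrightarrow> res_exact 0 n (int q + i) \<longleftrightarrow> res_exact q n i"
proof (induction q arbitrary: i)
  case (Suc q)
  have "res_exact 0 n (int q + (i + 1)) \<longleftrightarrow> res_exact q n (i + 1)" using Suc by simp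
  moreover have "int (Suc q) + i = int q + (i + 1)" by simp
  ultimately show ?case using res_exact_shift[OF Suc.prems, of q n] by (simp only:)
qed simp

text \<open>Koszul degree \<open>q + 1\<close> of V is shifted down to degree 1 of term
  \<open>q\<close> modulo its kernel, where the derived functor and the Koszul complex pose the same
  comparison of spans.\<close>

theorem zero_at_FI_homology_iff_FI_exact:
  assumes S: "finite S" and i: "i \<ge> 1"
  shows "zero_at (FI_homology R V i) S \<longleftrightarrow> FI_exact all_values zero_values (card S) (int i)"
proof -
  obtain q where q: "i = Suc q" using i by (cases i) auto
  interpret P: FI_module R "res R V q" by (rule FI_module_res)
  have K: "P.FI_subgroup (res_kernel q)" using res_kernel_FI_subgroup by blast
  let ?ok = "\<lambda>S. image_span (res R V q) P.all_values S \<inter> res_kernel q S \<subseteq> image_span (res R V q) (res_kernel q) S"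
  have "zero_at (FI_homology R V i) S \<longleftrightarrow> ?ok S"
    unfolding q by (rule zero_at_FI_homology_iff[OF S])
  also have "\<dots> \<longleftrightarrow> ?ok {..<card S}"
    using P.image_span_transport[OF K S, of "{..<card S}"] P.image_span_transport[OF K _ S, of "{..<card S}"] by auto
  also have "\<dots> \<longleftrightarrow> res_exact q (card S) 1"
    by (rule P.FI_exact_1_iff[OF K res_acyclic, symmetric])
  also have "\<dots> \<longleftrightarrow> FI_exact all_values zero_values (card S) (int i)"
    using res_exact_iterated_shift[of 1 "card S" q] unfolding res_exact_0_iff q by (simp add: add.commute)
  finally show ?thesis .
qed

lemma zero_at_FI_H0_iff_FI_exact:
  "zero_at (FI_H0 V) {..<n} \<longleftrightarrow> FI_exact all_values zero_values n 0"
  unfolding FI_exact_0_iff by (rule zero_at_FI_H0_iff) simp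

end

section \<open>Degrees and the range in which the regularity is attained\<close>

lemma FI_degree_leD:
  assumes "FI_degree W \<le> ereal (real_of_int g)" "finite S" "int (card S) > g"
  shows "zero_at W S"
proof -
  \<comment> \<open>Passing to the strict bound \<open>g + 1\<close> produces an actual member
    \<open>d\<close> of the set below it; being an integer, \<open>d\<close> is at most
    \<open>g\<close>.\<close>
  have "FI_degree W < ereal (real_of_int (g + 1))"
    using assms(1) by (rule order_le_less_trans) simp
  then obtain d where "ereal (real_of_int d) < ereal (real_of_int (g + 1))"
    "\<forall>S. finite S \<longrightarrow> int (card S) > d \<longrightarrow> zero_at W S"
    unfolding FI_degree_def Inf_less_iff by auto
  then show ?thesis using assms by auto
qed

lemma FI_degree_leI:
  assumes "d \<ge> -1" "\<And>S. finite S \<Longrightarrow> int (card S) > d \<Longrightarrow> zero_at W S"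
  shows "FI_degree W \<le> ereal (real_of_int d)"
  unfolding FI_degree_def by (rule Inf_lower) (use assms in blast)

lemma FI_degree_ge:
  assumes "finite S" "\<not> zero_at W S"
  shows "ereal (real (card S)) \<le> FI_degree W"
  unfolding FI_degree_def
proof (rule Inf_greatest)
  fix x assume "x \<in> {ereal (real_of_int d) | d. d \<ge> -1 \<and> (\<forall>S. finite S \<longrightarrow> int (card S) > d \<longrightarrow> zero_at W S)}"
  then obtain d where d: "x = ereal (real_of_int d)" "\<forall>S. finite S \<longrightarrow> int (card S) > d \<longrightarrow> zero_at W S" by blast
  then have "int (card S) \<le> d" using assms by (metis not_less)
  then show "ereal (real (card S)) \<le> x" unfolding d(1) by simp
qed

theorem corollaryC:
  fixes R :: "('r, 'c) ring_scheme" and V :: "('r, 'm) FI_mod" and g r :: int and a :: nat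
  assumes "cring R"
    and "FI_module R V"
    and "presented_in_finite_degrees R V"
    and "\<not> FI_H0_acyclic R V"
    and "FI_t R V 0 \<le> ereal (real_of_int g)"
    and "FI_t R V 1 \<le> ereal (real_of_int r)"
    and "int a \<ge>
      (if \<one>\<^bsub>R\<^esub> \<oplus>\<^bsub>R\<^esub> \<one>\<^bsub>R\<^esub> \<in> Units R
       then if g < r then max 1 (g + r - 1) else max 1 (2 * r - 2)
       else if g < r then max 1 (2 * g + 2 * r - 2) else max 1 (4 * r - 4))"
  shows "FI_t R V a - ereal (real a) = FI_reg R V"
proof -
  interpret V: FI_module R V by fact
  interpret I: insertions "ins V" "transp V" by (rule V.insertions_ins)
  let ?Z = "level_family V V.all_values" and ?B = "level_family V V.zero_values"
  have hom: "zero_at (FI_homology R V i) S \<longleftrightarrow> I.exact ?Z ?B 0 (card S) (int i)" if "finite S" "i \<ge> 1" for S i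
    by (rule V.zero_at_FI_homology_iff_FI_exact[OF that])
  have t0: "I.exact ?Z ?B 0 n 0" if "int n > g" for n
    unfolding V.zero_at_FI_H0_iff_FI_exact[symmetric]
    using FI_degree_leD[of "FI_H0 V" g "{..<n}"] assms(5) that by (simp add: FI_t_def)
  have t1: "I.exact ?Z ?B 0 n 1" if "int n > r" for n
    using FI_degree_leD[of "FI_homology R V 1" r "{..<n}"] hom[of "{..<n}" 1] assms(6) that by (simp add: FI_t_def)
  obtain i0 S0 where S0: "finite S0" "i0 \<ge> 1" "\<not> zero_at (FI_homology R V i0) S0"
    using assms(4) unfolding FI_H0_acyclic_def by blast
  have adm: "I.admissible 0 ?Z ?B"
    using V.FI_subgroupD(2)[OF V.FI_subgroup_all]
    by (intro V.admissible_level_family V.FI_subgroup_all V.FI_subgroup_zero) auto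
  obtain \<rho> :: nat where \<rho>: "int \<rho> \<le> g + r - 1" "int \<rho> \<le> 2 * r - 2" "r \<ge> 1"
    "\<And>i n. i \<ge> 1 \<Longrightarrow> n > i + \<rho> \<Longrightarrow> I.exact ?Z ?B 0 n (int i)"
    "\<And>i. i \<ge> 1 \<Longrightarrow> i \<ge> \<rho> \<Longrightarrow> \<not> I.exact ?Z ?B 0 (i + \<rho>) (int i)"
    by (rule I.regularity_attained[OF adm V.eventually_exact_level_family[OF t0 t1] t0 t1 S0(2)])
      (use hom[OF S0(1,2)] S0(3) in auto)
  \<comment> \<open>Since \<rho> is a natural number, \<open>g + r - 1\<close> and
    \<open>2 * r - 2\<close> are nonnegative, so their doubles bound \<rho> as well. Each of the
    four thresholds is therefore at least the maximum of 1 and \<rho>.\<close>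
  have a: "a \<ge> 1" "a \<ge> \<rho>" using assms(7) \<rho>(1-3) by (auto split: if_splits)
  have le: "FI_t R V i - ereal (real i) \<le> ereal (real \<rho>)" if i: "i \<ge> 1" for i
  proof -
    have "FI_degree (FI_homology R V i) \<le> ereal (real_of_int (int i + int \<rho>))"
      by (rule FI_degree_leI) (use hom i \<rho>(4)[OF i] in auto)
    then show ?thesis using i by (cases "FI_degree (FI_homology R V i)") (auto simp: FI_t_def)
  qed
  have "\<not> zero_at (FI_homology R V a) {..<a + \<rho>}"
    using hom[of "{..<a + \<rho>}" a] \<rho>(5)[OF a] a by simp
  from FI_degree_ge[OF _ this] have "ereal (real (a + \<rho>)) \<le> FI_t R V a" using a by (simp add: FI_t_def)
  then have "ereal (real \<rho>) \<le> FI_t R V a - ereal (real a)"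
    by (cases "FI_t R V a") auto
  with le[OF a(1)] have eq: "FI_t R V a - ereal (real a) = ereal (real \<rho>)" by (rule antisym)
  have "FI_reg R V = ereal (real \<rho>)"
    unfolding FI_reg_def
  proof (rule antisym)
    show "(SUP i\<in>{1..}. FI_t R V i - ereal (real i)) \<le> ereal (real \<rho>)"
      by (rule SUP_least) (use le in simp)
    show "ereal (real \<rho>) \<le> (SUP i\<in>{1..}. FI_t R V i - ereal (real i))"
      unfolding eq[symmetric] by (rule SUP_upper) (use a in simp)
  qed
  with eq show ?thesis by simp
qed

end
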